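(* For every standard relation $w\in\mathcal{I}_{\mathrm{ST}}$, one has $L(\lambda(w))=0$.
   Context: Let $\mathcal{A}_z=\mathbb{Z}\langle e_0,e_1,e_z\rangle$ be the free non-commutative (associative, unital) ring on formal symbols $e_0,e_1,e_z$, and $\mathcal{A}=\mathbb{Z}\langle e_0,e_1\rangle\subset\mathcal{A}_z$. Put $\mathcal{A}_z^0=\mathbb{Z}\oplus\mathbb{Z}e_z\oplus\bigoplus_{a\in\{1,z\},\,b\in\{0,z\}}e_a\mathcal{A}_ze_b$, $\mathcal{A}^0=\mathbb{Z}\oplus e_1\mathcal{A}e_0$, $\mathcal{A}_z^{-2}=\mathbb{Z}\oplus e_1\mathcal{A}_ze_0\oplus e_z\mathcal{A}_ze_0$, and $\mathcal{A}_z^{-1}=\mathcal{A}_z^{-2}\,\mathbb{Z}\langle e_z\rangle$ (the span of concatenations $ue_z^k$, $u\in\mathcal{A}_z^{-2}$, $k\ge0$). Tensor products are over $\mathbb{Z}$. $L:\mathcal{A}^0\to\mathbb{R}$ is the $\mathbb{Z}$-linear map with $L(1)=1$ and $L(e_{a_1}\cdots e_{a_m})=\int_{0<t_1<\cdots<t_m<1}\prod_{i=1}^m\frac{dt_i}{t_i-a_i}$ for words in $\mathcal{A}^0$. For $\alpha,\beta\in\{0,1,z\}$ define the linear operator $\partial_{\alpha,\beta}$ on $\mathcal{A}_z$ by $\partial_{\alpha,\beta}(e_{a_1}\cdots e_{a_n})=\sum_{i=1}^n\left(\delta_{\{a_i,a_{i+1}\},\{\alpha,\beta\}}-\delta_{\{a_{i-1},a_i\},\{\alpha,\beta\}}\right)e_{a_1}\cdots\widehat{e_{a_i}}\cdots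 e_{a_n}$, where $a_0=0$, $a_{n+1}=1$, the hat denotes omission, and $\delta_{S,T}=1$ if $S=T$ as sets and $0$ otherwise. $\mathrm{Const}:\mathcal{A}_z\to\mathcal{A}$ is the linear map sending a word to itself if it contains no letter $e_z$, and to $0$ otherwise. The set of standard relations is $\mathcal{I}_{\mathrm{ST}}=\{w\in\mathcal{A}_z^0\mid \mathrm{Const}(\partial_{z,\alpha_1}\cdots\partial_{z,\alpha_r}w)=0\text{ for all }r\ge0\text{ and }\alpha_1,\dots,\alpha_r\in\{0,1\}\}$. The shuffle product $ш$ on $\mathcal{A}_z$ is the bilinear product with $w\,ш\,1=1\,ш\,w=w$ and $e_au\,ш\,e_bv=e_a(u\,ш\,e_bv)+e_b(e_au\,ш\,v)$. The duality map $\tau_z$ is the anti-automorphism of the ring $\mathcal{A}_z$ (so $\tau_z(uv)=\tau_z(v)\tau_z(u)$) with $\tau_z(e_0)=e_z-e_1$, $\tau_z(e_1)=e_z-e_0$, $\tau_z(e_z)=e_z$. The map $u\otimes v\mapsto u\,ш\,v$ is an isomorphism $\mathcal{A}_z^{-2}\otimes(\mathcal{A}_z^0\cap\mathbb{Z}\langle e_1,e_z\rangle)\to\mathcal{A}_z^0$; let $\mathrm{reg}_{\{z,1\}}$ be its inverse. The map $u\otimes v\mapsto u\,ш\,v$ is also an isomorphism $\mathcal{A}_z^{-2}\otimes\mathbb{Z}\langle e_z\rangle\to\mathcal{A}_z^{-1}$; let $\mathrm{reg}_{\{z\}}$ be its inverse. Define $N:\mathcal{A}_z^0\to\mathcal{A}_z^{-1}$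 as the composition of $\mathrm{reg}_{\{z,1\}}$, then $\mathrm{id}\otimes\tau_z$ (which lands in $\mathcal{A}_z^{-2}\otimes(\mathcal{A}_z^0\cap\mathbb{Z}\langle e_0,e_z\rangle)$), then $u\otimes v\mapsto u\,ш\,v$. Define $\lambda:\mathcal{A}_z^0\to\mathcal{A}^0$ as the composition of $N$, then $\mathrm{reg}_{\{z\}}:\mathcal{A}_z^{-1}\to\mathcal{A}_z^{-2}\otimes\mathbb{Z}\langle e_z\rangle$, then $\mathrm{id}\otimes\mathrm{const}:\mathcal{A}_z^{-2}\otimes\mathbb{Z}\langle e_z\rangle\to\mathcal{A}_z^{-2}$ (where $\mathrm{const}$ takes the constant term: $1\mapsto1$, $e_z^k\mapsto0$ for $k\ge1$), then $\lambda':\mathcal{A}_z^{-2}\to\mathcal{A}^0$, the restriction of the ring homomorphism replacing $e_z$ by $e_1$. *)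

theory Defs
  imports "HOL-Analysis.Analysis" "HOL-Library.Poly_Mapping"
begin

datatype letter = E0 | E1 | EZ

type_synonym word = "letter list"

text \<open>
  Words form the free monoid on the letters. Writing it additively makes
  \<open>word \<Rightarrow>\<^sub>0 int\<close>, with the convolution product of the library, the monoid ring
  of that monoid, that is \<open>\<int>\<langle>e\<^sub>0, e\<^sub>1, e\<^sub>z\<rangle>\<close>.
\<close>

instantiation list :: (type) monoid_add
begin

definition zero_list :: "'a list" where "zero_list = []"

definition plus_list :: "'a list \<Rightarrow> 'a list \<Rightarrow> 'a list" where "plus_list = (@)"

instance
  by standard (simp_all add: zero_list_def plus_list_def)

end

type_synonym Az = "word \<Rightarrow>\<^sub>0 int"

text \<open>
  The tensor square of \<open>Az\<close> over the integers, as the free abelian group on pairs of words;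
  the pair \<open>(u, v)\<close> stands for \<open>u \<otimes> v\<close>.
\<close>

type_synonym Az2 = "word \<times> word \<Rightarrow>\<^sub>0 int"

definition gen :: "letter \<Rightarrow> Az" where
  "gen a = frag_of [a]"

definition span_basis :: "'a set \<Rightarrow> ('a \<Rightarrow>\<^sub>0 int) set" where
  "span_basis W = {x. Poly_Mapping.keys x \<subseteq> W}"

definition words_z0 :: "word set" where
  "words_z0 = {[], [EZ]} \<union> {a # u @ [b] | a u b. a \<in> {E1, EZ} \<and> b \<in> {E0, EZ}}"

definition words_zm2 :: "word set" where
  "words_zm2 = {[]} \<union> {E1 # u @ [E0] | u. True} \<union> {EZ # u @ [E0] | u. True}"

definition Az0 :: "Az set" where
  "Az0 = span_basis words_z0"

text \<open>
  \<open>L\<close>, given by a formula on words. It is meaningful on \<open>\<int> \<oplus> e\<^sub>1 \<int>\<langle>e\<^sub>0, e\<^sub>1\<rangle> e\<^sub>0\<close>, where the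
  integrals converge absolutely; \<open>pole EZ\<close> is left unspecified, and letter number \<open>i\<close> of a word
  is counted from \<open>0\<close>.
\<close>

fun pole :: "letter \<Rightarrow> real" where
  "pole E0 = 0"
| "pole E1 = 1"

definition simplex_set :: "nat \<Rightarrow> (nat \<Rightarrow> real) set" where
  "simplex_set m = {t \<in> {..<m} \<rightarrow>\<^sub>E UNIV.
     (\<forall>i<m. 0 < t i \<and> t i < 1) \<and> (\<forall>i j. i < j \<and> j < m \<longrightarrow> t i < t j)}"

definition L_word :: "word \<Rightarrow> real" where
  "L_word w = (if w = [] then 1
     else set_lebesgue_integral (\<Pi>\<^sub>M i\<in>{..<length w}. lborel) (simplex_set (length w))
            (\<lambda>t. \<Prod>i<length w. 1 / (t i - pole (w ! i))))"

definition L_map :: "Az \<Rightarrow> real" where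
  "L_map x = (\<Sum>w\<in>Poly_Mapping.keys x. of_int (Poly_Mapping.lookup x w) * L_word w)"

text \<open>
  With \<open>a = E0 # w @ [E1]\<close>, the letters of \<open>w\<close> are \<open>a ! 1, \<dots>, a ! n\<close>, and \<open>a ! 0\<close> and
  \<open>a ! (n + 1)\<close> are the boundary conventions.
\<close>

definition del_word :: "letter \<Rightarrow> letter \<Rightarrow> word \<Rightarrow> Az" where
  "del_word \<alpha> \<beta> w = (let a = E0 # w @ [E1] in
     \<Sum>i = 1..length w.
       frag_cmul (of_bool ({a ! i, a ! (i + 1)} = {\<alpha>, \<beta>})
                  - of_bool ({a ! (i - 1), a ! i} = {\<alpha>, \<beta>}))
         (frag_of (take (i - 1) w @ drop i w)))"

definition del_op :: "letter \<Rightarrow> letter \<Rightarrow> Az \<Rightarrow> Az" where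
  "del_op \<alpha> \<beta> = frag_extend (del_word \<alpha> \<beta>)"

definition Const_map :: "Az \<Rightarrow> Az" where
  "Const_map = frag_extend (\<lambda>w. if EZ \<in> set w then 0 else frag_of w)"

definition I_ST :: "Az set" where
  "I_ST = {w \<in> Az0. \<forall>\<alpha>s. set \<alpha>s \<subseteq> {E0, E1} \<longrightarrow> Const_map (foldr (del_op EZ) \<alpha>s w) = 0}"

fun shuffle_word :: "word \<Rightarrow> word \<Rightarrow> Az" where
  "shuffle_word [] v = frag_of v"
| "shuffle_word u [] = frag_of u"
| "shuffle_word (a # u) (b # v) =
     gen a * shuffle_word u (b # v) + gen b * shuffle_word (a # u) v"

definition shuffle :: "Az \<Rightarrow> Az \<Rightarrow> Az" where
  "shuffle x y = frag_extend (\<lambda>u. frag_extend (\<lambda>v. shuffle_word u v) y) x"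

definition tensor :: "Az \<Rightarrow> Az \<Rightarrow> Az2" where
  "tensor x y = frag_extend (\<lambda>u. frag_extend (\<lambda>v. frag_of (u, v)) y) x"

definition tensor_map :: "(Az \<Rightarrow> Az) \<Rightarrow> (Az \<Rightarrow> Az) \<Rightarrow> Az2 \<Rightarrow> Az2" where
  "tensor_map f g = frag_extend (\<lambda>(u, v). tensor (f (frag_of u)) (g (frag_of v)))"

definition shuffle_map :: "Az2 \<Rightarrow> Az" where
  "shuffle_map = frag_extend (\<lambda>(u, v). shuffle (frag_of u) (frag_of v))"

fun tau_letter :: "letter \<Rightarrow> Az" where
  "tau_letter E0 = gen EZ - gen E1"
| "tau_letter E1 = gen EZ - gen E0"
| "tau_letter EZ = gen EZ"

definition tau_z :: "Az \<Rightarrow> Az" where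
  "tau_z = frag_extend (\<lambda>w. prod_list (map tau_letter (rev w)))"

text \<open>
  The inverses of the two shuffle isomorphisms. They are only applied to elements of the
  respective images \<open>\<A>\<^sub>z\<^sup>0\<close> and \<open>\<A>\<^sub>z\<^sup>-\<^sup>1\<close>.
\<close>

definition reg_z1 :: "Az \<Rightarrow> Az2" where
  "reg_z1 = inv_into (span_basis (words_zm2 \<times> (words_z0 \<inter> lists {E1, EZ}))) shuffle_map"

definition reg_z :: "Az \<Rightarrow> Az2" where
  "reg_z = inv_into (span_basis (words_zm2 \<times> lists {EZ})) shuffle_map"

definition N_map :: "Az \<Rightarrow> Az" where
  "N_map x = shuffle_map (tensor_map id tau_z (reg_z1 x))"

definition const_term :: "Az \<Rightarrow> int" where
  "const_term x = Poly_Mapping.lookup x []"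

definition id_tensor_const :: "Az2 \<Rightarrow> Az" where
  "id_tensor_const = frag_extend (\<lambda>(u, v). frag_cmul (const_term (frag_of v)) (frag_of u))"

definition lambda' :: "Az \<Rightarrow> Az" where
  "lambda' = frag_extend (\<lambda>w. prod_list (map (\<lambda>a. if a = EZ then gen E1 else gen a) w))"

definition lambda_map :: "Az \<Rightarrow> Az" where
  "lambda_map x = lambda' (id_tensor_const (reg_z (N_map x)))"

end

theory Submission
  imports Defs
begin

text \<open>
  For real \<open>z > 1\<close> let \<open>L\<^sub>z\<close> be the iterated integral over \<open>0 < t\<^sub>1 < \<dots> < t\<^sub>m < 1\<close> with \<open>e\<^sub>z\<close> standing for
  \<open>dt / (t - z)\<close>. Partial fractions and integration by parts give
  \<open>d/dz L\<^sub>z(w) = L\<^sub>z(\<partial>\<^sub>z\<^sub>,\<^sub>0 w) / z + L\<^sub>z(\<partial>\<^sub>z\<^sub>,\<^sub>1 w) / (z - 1)\<close>, and \<open>L\<^sub>z(w)\<close> tends to \<open>L(Const w)\<close> as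
  \<open>z\<close> tends to infinity, so by induction on the length \<open>L\<^sub>z\<close> vanishes on standard relations.

  The substitution \<open>t \<mapsto> z (1 - t) / (z - t)\<close> shows that \<open>\<tau>\<^sub>z\<close> preserves \<open>L\<^sub>z\<close>, hence so does \<open>N\<close>. Writing
  \<open>N(w)\<close> as a sum of shuffles of \<open>u\<^sub>k\<close> and \<open>e\<^sub>z\<^sup>k\<close> gives \<open>\<Sum>\<^sub>k L\<^sub>z(u\<^sub>k) l(z)\<^sup>k / k! = 0\<close> with
  \<open>l(z) = log (1 - 1/z)\<close>. As \<open>z\<close> tends to one, \<open>L\<^sub>z(u\<^sub>k)\<close> tends to \<open>L(\<lambda>'(u\<^sub>k))\<close> at the rate
  \<open>(z - 1)\<^sup>1\<^sup>/\<^sup>4\<close>, which beats every power of \<open>l(z)\<close>. So the polynomial with coefficients \<open>L(\<lambda>'(u\<^sub>k)) / k!\<close>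
  tends to zero along \<open>l(z) \<rightarrow> -\<infinity>\<close> and vanishes; its constant coefficient is \<open>L(\<lambda>(w))\<close>.
\<close>

section \<open>Words, shuffles and regularization\<close>

text \<open>The kernels of e_0 and e_1 are unbounded, so every exchange of limits or integrals needs
  a majorant. Induction on words peels off the smallest variable and leaves an integral over s < t_2
  < ... < 1 whose word may begin with e_0; it is finite for s > 0 but not for s = 0. Hence bounds,
  limits and derivatives are treated for lower end points t > 0 as well, with powers of (1 - t) / t
  as majorants, and only the outermost integration, with e_1 or e_z in front, reaches t = 0. Single
  terms of the differential equation can diverge at either end while their sum is finite, as for
  words ending in e_1 e_z.

  Near z = 1 convergence without a rate would not suffice, because L_z(u_k) is multiplied by powers
  of a divergent logarithm. The exponent 1/4 comes from interpolation: part of the factor z - 1 in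
  the difference of the kernels of e_z and e_1 is given up to keep the pole at s = 1 integrable. At
  z = 1 both kernels coincide, which is how lambda' enters.\<close>

abbreviation keys :: "('a \<Rightarrow>\<^sub>0 int) \<Rightarrow> 'a set" where
  "keys \<equiv> Poly_Mapping.keys"

text \<open>The additive extension of a function on basis elements to the free abelian group.
  \<open>L_map\<close> is \<open>lin L_word\<close>, and L_z is \<open>lin\<close> of the integrals
  of words, so linear identities reduce to words.\<close>

definition lin :: "('a \<Rightarrow> real) \<Rightarrow> ('a \<Rightarrow>\<^sub>0 int) \<Rightarrow> real" where
  "lin f x = (\<Sum>w\<in>keys x. of_int (Poly_Mapping.lookup x w) * f w)"

lemma lin_superset:
  assumes "finite S" "keys x \<subseteq> S"
  shows "lin f x = (\<Sum>w\<in>S. of_int (Poly_Mapping.lookup x w) * f w)"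
  unfolding lin_def using assms by (intro sum.mono_neutral_left) (auto simp: in_keys_iff)

lemma lin_0 [simp]: "lin f 0 = 0"
  by (simp add: lin_def)

lemma lin_frag_of [simp]: "lin f (frag_of w) = f w"
  by (simp add: lin_def)

lemma lin_add: "lin f (x + y) = lin f x + lin f y"
proof -
  let ?S = "keys x \<union> keys y"
  have "lin f (x + y) = (\<Sum>w\<in>?S. of_int (Poly_Mapping.lookup (x + y) w) * f w)"
    using keys_add[of x y] by (intro lin_superset) auto
  then show ?thesis
    by (simp add: lin_superset[of ?S x] lin_superset[of ?S y] lookup_add sum.distrib algebra_simps)
qed

lemma lin_minus: "lin f (- x) = - lin f x"
  using lin_add[of f x "- x"] by simp

lemma lin_diff: "lin f (x - y) = lin f x - lin f y"
  using lin_add[of f x "- y"] by (simp add: lin_minus)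

lemma lin_cmul: "lin f (frag_cmul c x) = of_int c * lin f x"
  unfolding lin_superset[OF finite_keys keys_cmul, of f]
    by (simp add: lin_def sum_distrib_left mult.assoc)

lemma lin_sum: "lin f (sum g A) = (\<Sum>i\<in>A. lin f (g i))"
  by (induction A rule: infinite_finite_induct) (simp_all add: lin_add)

lemma lin_sum_list: "lin f (sum_list (map g xs)) = (\<Sum>x\<leftarrow>xs. lin f (g x))"
  by (induction xs) (simp_all add: lin_add)

lemma lin_frag_extend: "lin f (frag_extend g x) = lin (\<lambda>w. lin f (g w)) x"
  by (simp add: frag_extend_def lin_sum lin_cmul lin_def[of _ x])

lemma lin_cong:
  "(\<And>w. w \<in> keys x \<Longrightarrow> f w = g w) \<Longrightarrow> lin f x = lin g x"
  by (simp add: lin_def)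

lemma lin_mult_left: "lin (\<lambda>w. c * f w) x = c * lin f x"
  by (simp add: lin_def sum_distrib_left mult_ac)

lemma lin_plus: "lin (\<lambda>w. f w + g w) x = lin f x + lin g x"
  by (simp add: lin_def sum.distrib algebra_simps)

lemma frag_of_mult: "frag_of (u :: 'a list) * frag_of v = frag_of (u @ v)"
  by (simp add: mult_single plus_list_def)

lemma frag_of_Nil: "frag_of ([] :: 'a list) = 1"
  by (metis single_one zero_list_def)

lemma frag_UNIV_induct [case_names zero one diff]:
  assumes "P 0" "\<And>w. P (frag_of w)" "\<And>x y. P x \<Longrightarrow> P y \<Longrightarrow> P (x - y)"
  shows "P x"
  by (rule frag_induction[where S = UNIV]) (use assms in auto)

lemma gen_times_eq_frag_extend:
  "gen a * x = frag_extend (\<lambda>w. frag_of (a # w)) x"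
  by (induction x rule: frag_UNIV_induct)
     (auto simp: gen_def frag_of_mult frag_extend_diff right_diff_distrib)

lemma times_gen_eq_frag_extend:
  "x * gen a = frag_extend (\<lambda>w. frag_of (w @ [a])) x"
  by (induction x rule: frag_UNIV_induct)
     (auto simp: gen_def frag_of_mult frag_extend_diff left_diff_distrib)

lemma keys_gen_times: "keys (gen a * x) \<subseteq> (Cons a) ` keys x"
  unfolding gen_times_eq_frag_extend by (rule order_trans[OF keys_frag_extend]) auto

lemma span_basis_0 [simp]: "0 \<in> span_basis W"
  by (simp add: span_basis_def)

lemma span_basis_frag_of [simp]: "frag_of w \<in> span_basis W \<longleftrightarrow> w \<in> W"
  by (simp add: span_basis_def)

lemma span_basis_add: "x \<in> span_basis W \<Longrightarrow> y \<in> span_basis W \<Longrightarrow> x + y \<in> span_basis W"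
  using keys_add[of x y] by (auto simp: span_basis_def)

lemma span_basis_diff: "x \<in> span_basis W \<Longrightarrow> y \<in> span_basis W \<Longrightarrow> x - y \<in> span_basis W"
  using keys_diff[of x y] by (auto simp: span_basis_def)

lemma span_basis_sum_list:
  "(\<And>x. x \<in> set xs \<Longrightarrow> g x \<in> span_basis W) \<Longrightarrow> sum_list (map g xs) \<in> span_basis W"
  by (induction xs) (auto intro: span_basis_add)

lemma span_basis_frag_extend:
  assumes "x \<in> span_basis V" "\<And>v. v \<in> V \<Longrightarrow> f v \<in> span_basis W"
  shows "frag_extend f x \<in> span_basis W"
  using keys_frag_extend[of f x] assms by (fastforce simp: span_basis_def)

text \<open>A list rather than the set \<open>shuffles\<close>, because the coefficients of the
  shuffle product are multiplicities.\<close>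

fun shuffle_list :: "'a list \<Rightarrow> 'a list \<Rightarrow> 'a list list" where
  "shuffle_list [] v = [v]"
| "shuffle_list u [] = [u]"
| "shuffle_list (a # u) (b # v) =
     map (Cons a) (shuffle_list u (b # v)) @ map (Cons b) (shuffle_list (a # u) v)"

lemma shuffle_list_Nil2 [simp]: "shuffle_list u [] = [u]"
  by (cases u) auto

lemma gen_times_sum_list_frag_of:
  "gen a * sum_list (map frag_of xs) = sum_list (map frag_of (map (Cons a) xs))"
  by (induction xs) (simp_all add: distrib_left gen_def frag_of_mult)

lemma shuffle_word_eq_sum_list:
  "shuffle_word u v = sum_list (map frag_of (shuffle_list u v))"
  by (induction u v rule: shuffle_word.induct) (simp_all only: shuffle_word.simps
    shuffle_list.simps map_append sum_list_append gen_times_sum_list_frag_of, simp_all)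

lemma set_shuffle_list: "set (shuffle_list u v) = shuffles u v"
  by (induction u v rule: shuffle_list.induct) auto

lemma shuffle_list_replicate:
  "shuffle_list [a] (replicate n a) = replicate (Suc n) (replicate (Suc n) a)"
  by (induction n) (auto simp: replicate_append_same)

lemma shuffle_frag_of: "shuffle (frag_of u) (frag_of v) = shuffle_word u v"
  by (simp add: shuffle_def)

text \<open>These are the two convergence conditions: e_0 in front would give a pole at 0, e_1 at
  the end a pole at 1.\<close>

lemma words_z0_iff: "w \<in> words_z0 \<longleftrightarrow> w = [] \<or> hd w \<noteq> E0 \<and> last w \<noteq> E1"
proof -
  have nE0: "a \<noteq> E0 \<longleftrightarrow> a = E1 \<or> a = EZ" and nE1: "a \<noteq> E1 \<longleftrightarrow> a = E0 \<or> a = EZ" for a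
    by (cases a; simp)+
  show ?thesis
  proof (cases w)
    case (Cons a v)
    then show ?thesis
    proof (cases v rule: rev_cases)
      case Nil
      then show ?thesis using Cons by (cases a) (auto simp: words_z0_def)
    next
      case (snoc u b)
      then show ?thesis using Cons nE0[of a] nE1[of b] by (auto simp: words_z0_def)
    qed
  qed (simp add: words_z0_def)
qed

lemma words_zm2_iff: "w \<in> words_zm2 \<longleftrightarrow> w = [] \<or> hd w \<noteq> E0 \<and> last w = E0"
proof (cases w)
  case (Cons a v)
  then show ?thesis
    by (cases v rule: rev_cases; cases a) (auto simp: words_zm2_def)
qed (simp add: words_zm2_def)

lemma words_zm2_subset: "words_zm2 \<subseteq> words_z0"
  by (auto simp: words_z0_iff words_zm2_iff)

lemma hd_shuffles:
  "w \<in> shuffles u v \<Longrightarrow> w \<noteq> [] \<Longrightarrow> (u \<noteq> [] \<and> hd w = hd u) \<or> (v \<noteq> [] \<and> hd w = hd v)"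
  by (cases u; cases v) auto

text \<open>The leading term of \<open>u e\<^sub>0\<close> shuffled with \<open>x\<close> is \<open>u e\<^sub>0 x\<close>; in all other terms the letters after that
  \<open>e\<^sub>0\<close> form a proper suffix of \<open>x\<close>. Induction on the tail makes the two regularization maps
  surjective. Their injectivity plays no role: the argument works for any choice of preimages.\<close>

lemma shuffle_list_append_right:
  "\<exists>zs. mset (shuffle_list (u @ [c]) x) = mset ((u @ c # x) # zs) \<and>
     (\<forall>z\<in>set zs. \<exists>p x1 x2. x = x1 @ x2 \<and> x1 \<noteq> [] \<and> p \<in> shuffles u x1 \<and> z = p @ c # x2)"
proof (induction u arbitrary: x)
  case Nil
  then show ?case
  proof (induction x)
    case (Cons b x)
    then obtain zs where zs: "mset (shuffle_list [c] x) = mset ((c # x) # zs)"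
      "\<forall>z\<in>set zs. \<exists>p x1 x2. x = x1 @ x2 \<and> x1 \<noteq> [] \<and> p \<in> shuffles [] x1 \<and> z = p @ c # x2"
      by auto
    show ?case
    proof (intro exI[of _ "map (Cons b) ((c # x) # zs)"] conjI ballI)
      show "mset (shuffle_list ([] @ [c]) (b # x)) =
        mset (([] @ c # b # x) # map (Cons b) ((c # x) # zs))"
        using zs(1) by (auto simp: mset_map)
    next
      fix z assume "z \<in> set (map (Cons b) ((c # x) # zs))"
      then consider "z = b # c # x" | z' where "z = b # z'" "z' \<in> set zs" by auto
      then show "\<exists>p x1 x2. b # x = x1 @ x2 \<and> x1 \<noteq> [] \<and> p \<in> shuffles [] x1 \<and> z = p @ c # x2"
      proof cases
        case 1
        then show ?thesis by (intro exI[of _ "[b]"] exI[of _ x]) auto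
      next
        case 2
        then obtain x1 x2 where "x = x1 @ x2" "z' = x1 @ c # x2" using zs(2) by fastforce
        then show ?thesis using 2 by (intro exI[of _ "b # x1"] exI[of _ "b # x1"] exI[of _ x2]) auto
      qed
    qed
  qed auto
next
  case (Cons a u)
  note IH = Cons.IH
  show ?case
  proof (induction x)
    case (Cons b x)
    obtain zs where zs: "mset (shuffle_list (u @ [c]) (b # x)) = mset ((u @ c # b # x) # zs)"
      "\<forall>z\<in>set zs. \<exists>p x1 x2. b # x = x1 @ x2 \<and> x1 \<noteq> [] \<and> p \<in> shuffles u x1 \<and> z = p @ c # x2"
      using IH[of "b # x"] by (elim exE conjE) (rule that)
    obtain ys where ys: "mset (shuffle_list ((a # u) @ [c]) x) = mset (((a # u) @ c # x) # ys)"
      "\<forall>z\<in>set ys. \<exists>p x1 x2. x = x1 @ x2 \<and> x1 \<noteq> [] \<and> p \<in> shuffles (a # u) x1 \<and> z = p @ c # x2"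
      using Cons.IH by (elim exE conjE) (rule that)
    show ?case
    \<comment> \<open>A shuffle begins with \<open>a\<close>, which gives the leading term and the
      terms from \<open>zs\<close>, or with \<open>b\<close>. In the latter case a nonempty prefix
      of the tail stands in front of \<open>c\<close>, so even the leading term of the shorter
      shuffle is not leading any more.\<close>
    proof (intro exI[of _ "map (Cons a) zs @ map (Cons b) (((a # u) @ c # x) # ys)"] conjI ballI)
      show "mset (shuffle_list ((a # u) @ [c]) (b # x)) =
        mset (((a # u) @ c # b # x) # map (Cons a) zs @ map (Cons b) (((a # u) @ c # x) # ys))"
        using zs(1) ys(1) by (simp add: mset_map)
    next
      fix z assume "z \<in> set (map (Cons a) zs @ map (Cons b) (((a # u) @ c # x) # ys))"
      then consider z' where "z = a # z'" "z' \<in> set zs" | "z = b # a # u @ c # x"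
        | z' where "z = b # z'" "z' \<in> set ys" by auto
      then show "\<exists>p x1 x2. b # x = x1 @ x2 \<and> x1 \<noteq> [] \<and> p \<in> shuffles (a # u) x1 \<and> z = p @ c # x2"
      proof cases
        case 1
        then obtain p x1 x2 where *: "b # x = x1 @ x2" "x1 \<noteq> []" "p \<in> shuffles u x1" "z' = p @ c # x2"
          using zs(2) by meson
        have "a # p \<in> shuffles (a # u) x1" using * by (cases x1) auto
        then show ?thesis using * 1 by (intro exI[of _ "a # p"] exI[of _ x1] exI[of _ x2]) auto
      next
        case 2
        then show ?thesis by (intro exI[of _ "b # a # u"] exI[of _ "[b]"] exI[of _ x]) auto
      next
        case 3
        then obtain p x1 x2 where *: "x = x1 @ x2" "x1 \<noteq> []" "p \<in> shuffles (a # u) x1" "z' = p @ c # x2"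
          using ys(2) by meson
        then show ?thesis using 3 by (intro exI[of _ "b # p"] exI[of _ "b # x1"] exI[of _ x2]) auto
      qed
    qed
  qed auto
qed

section \<open>Surjectivity of the regularization maps\<close>

lemma shuffle_map_diff: "shuffle_map (x - y) = shuffle_map x - shuffle_map y"
  by (simp add: shuffle_map_def frag_extend_diff)

lemma shuffle_map_frag_of: "shuffle_map (frag_of (u, v)) = shuffle_word u v"
  by (simp add: shuffle_map_def shuffle_frag_of)

lemma shuffle_map_image_diff:
  assumes "x \<in> shuffle_map ` span_basis W" "y \<in> shuffle_map ` span_basis W"
  shows "x - y \<in> shuffle_map ` span_basis W"
proof -
  obtain x' y' where "x = shuffle_map x'" "x' \<in> span_basis W" "y = shuffle_map y'" "y' \<in> span_basis W"
    using assms by blast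
  then show ?thesis
    by (intro image_eqI[of _ _ "x' - y'"]) (simp_all add: shuffle_map_diff span_basis_diff)
qed

lemma shuffle_map_image_0: "0 \<in> shuffle_map ` span_basis W"
  by (rule image_eqI[of _ _ 0]) (auto simp: shuffle_map_def)

lemma shuffle_map_image_add:
  "x \<in> shuffle_map ` span_basis W \<Longrightarrow> y \<in> shuffle_map ` span_basis W \<Longrightarrow>
   x + y \<in> shuffle_map ` span_basis W"
  using shuffle_map_image_diff[of x W "0 - y"] shuffle_map_image_diff[of 0 W y]
    shuffle_map_image_0[of W] by simp

lemma shuffle_map_image_sum_list:
  "(\<And>z. z \<in> set zs \<Longrightarrow> f z \<in> shuffle_map ` span_basis W) \<Longrightarrow>
   sum_list (map f zs) \<in> shuffle_map ` span_basis W"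
  by (induction zs) (simp_all add: shuffle_map_image_add shuffle_map_image_0)

lemma shuffle_map_image_span:
  assumes "\<And>w. w \<in> V \<Longrightarrow> frag_of w \<in> shuffle_map ` span_basis W"
  shows "span_basis V \<subseteq> shuffle_map ` span_basis W"
proof
  fix x assume "x \<in> span_basis V"
  then have "keys x \<subseteq> V" by (simp add: span_basis_def)
  then show "x \<in> shuffle_map ` span_basis W"
    by (induction x rule: frag_induction)
       (fact shuffle_map_image_0 assms | rule shuffle_map_image_diff)+
qed

text \<open>\<open>X\<close> is the set of admissible tails. Closure under suffixes lets the
  induction continue with the shorter tail \<open>x2\<close>; the absence of e_0 in tails guarantees
  that the new front part \<open>p @ [E0]\<close> does not begin with e_0. The two regularization
  maps correspond to two choices of \<open>X\<close>.\<close>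

lemma frag_of_append_in_shuffle_image:
  assumes suffix: "\<And>p s. p @ s \<in> X \<Longrightarrow> s \<in> X" and X: "X \<subseteq> lists {E1, EZ}"
    and "u \<in> words_zm2" "x \<in> X"
  shows "frag_of (u @ x) \<in> shuffle_map ` span_basis (words_zm2 \<times> X)"
  using assms(3,4)
proof (induction "length x" arbitrary: u x rule: less_induct)
  case less
  show ?case
  proof (cases "u = []")
    case True
    have "frag_of x = shuffle_map (frag_of ([], x))"
      by (simp add: shuffle_map_frag_of)
    moreover have "([], x) \<in> words_zm2 \<times> X"
      using less by (simp add: words_zm2_iff)
    ultimately show ?thesis using True by (metis append_Nil image_eqI span_basis_frag_of)
  next
    case False
    then obtain v where u: "u = v @ [E0]"
      using less.prems by (metis append_butlast_last_id words_zm2_iff)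
    with less.prems False have v: "v \<noteq> []" "hd v \<noteq> E0"
      by (auto simp: words_zm2_iff hd_append split: if_splits)
    obtain zs where zs: "mset (shuffle_list (v @ [E0]) x) = mset ((v @ E0 # x) # zs)"
      "\<And>z. z \<in> set zs \<Longrightarrow> \<exists>p x1 x2. x = x1 @ x2 \<and> x1 \<noteq> [] \<and> p \<in> shuffles v x1 \<and> z = p @ E0 # x2"
      using shuffle_list_append_right[of v E0 x] by meson
    have "sum_list (map frag_of (shuffle_list (v @ [E0]) x)) =
      sum_list (map frag_of ((v @ E0 # x) # zs))"
      using zs(1) by (metis mset_map sum_mset_sum_list)
    then have "frag_of (u @ x) = shuffle_map (frag_of (u, x)) - sum_list (map frag_of zs)"
      by (simp add: shuffle_map_frag_of shuffle_word_eq_sum_list u)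
    moreover have "frag_of z \<in> shuffle_map ` span_basis (words_zm2 \<times> X)" if "z \<in> set zs" for z
    proof -
      obtain p x1 x2 where *: "x = x1 @ x2" "x1 \<noteq> []" "p \<in> shuffles v x1" "z = p @ E0 # x2"
        using zs(2) \<open>z \<in> set zs\<close> by meson
      have "hd x1 \<noteq> E0"
        using X less.prems(2) * by (cases x1) auto
      moreover have "p \<noteq> []"
        using *(2,3) v(1) by (metis Nil_in_shuffles)
      ultimately have "p @ [E0] \<in> words_zm2"
        using hd_shuffles[OF *(3)] v by (auto simp: words_zm2_iff)
      then have "frag_of ((p @ [E0]) @ x2) \<in> shuffle_map ` span_basis (words_zm2 \<times> X)"
        using less.prems(2) * suffix by (intro less.hyps) auto
      then show ?thesis using * by simp
    qed
    moreover have "shuffle_map (frag_of (u, x)) \<in> shuffle_map ` span_basis (words_zm2 \<times> X)"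
      using less.prems by (intro imageI) simp
    ultimately show ?thesis
      by (simp only:) (intro shuffle_map_image_diff shuffle_map_image_sum_list)
  qed
qed

lemma word_split_last_E0:
  assumes "hd w \<noteq> E0 \<or> w = []"
  obtains u x where "w = u @ x" "u \<in> words_zm2" "x \<in> lists {E1, EZ}"
proof -
  define x where "x = rev (takeWhile (\<lambda>a. a \<noteq> E0) (rev w))"
  define u where "u = rev (dropWhile (\<lambda>a. a \<noteq> E0) (rev w))"
  have w: "w = u @ x"
    unfolding x_def u_def by (metis rev_append rev_rev_ident takeWhile_dropWhile_id)
  have "a \<in> {E1, EZ}" if "a \<in> set x" for a
    using that set_takeWhileD[of a "\<lambda>a. a \<noteq> E0" "rev w"] letter.exhaust[of a]
    unfolding x_def set_rev by blast
  moreover have "u \<in> words_zm2"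
  proof (cases "u = []")
    case False
    then have "last u = E0"
      unfolding u_def by (metis (full_types) hd_dropWhile last_rev rev_is_Nil_conv)
    moreover have "hd u \<noteq> E0"
      using assms False w by auto
    ultimately show ?thesis by (simp add: words_zm2_iff)
  qed (simp add: words_zm2_iff)
  ultimately show ?thesis using that w by auto
qed

lemma Az0_subset_shuffle_image:
  "Az0 \<subseteq> shuffle_map ` span_basis (words_zm2 \<times> (words_z0 \<inter> lists {E1, EZ}))"
  unfolding Az0_def
proof (rule shuffle_map_image_span)
  fix w assume w: "w \<in> words_z0"
  then obtain u x where ux: "w = u @ x" "u \<in> words_zm2" "x \<in> lists {E1, EZ}"
    by (metis word_split_last_E0 words_z0_iff)
  have "x \<in> words_z0"
    using w ux by (cases x) (auto simp: words_z0_iff)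
  moreover have "s \<in> words_z0 \<inter> lists {E1, EZ}" if "p @ s \<in> words_z0 \<inter> lists {E1, EZ}" for p s
    using that by (cases s) (auto simp: words_z0_iff)
  ultimately show "frag_of w \<in> shuffle_map ` span_basis (words_zm2 \<times> (words_z0 \<inter> lists {E1, EZ}))"
    unfolding ux(1) using ux by (intro frag_of_append_in_shuffle_image) auto
qed

text \<open>The words of \<open>\<A>\<^sub>z\<^sup>-\<^sup>1\<close>\<close>

definition words_zm1 :: "word set" where
  "words_zm1 = {u @ replicate k EZ | u k. u \<in> words_zm2}"

lemma span_words_zm1_subset_shuffle_image:
  "span_basis words_zm1 \<subseteq> shuffle_map ` span_basis (words_zm2 \<times> lists {EZ})"
proof (rule shuffle_map_image_span)
  fix w assume "w \<in> words_zm1"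
  then show "frag_of w \<in> shuffle_map ` span_basis (words_zm2 \<times> lists {EZ})"
    unfolding words_zm1_def by (auto intro!: frag_of_append_in_shuffle_image)
qed

text \<open>Every \<open>e\<^sub>1\<close> is followed by some \<open>e\<^sub>0\<close>: the condition on words that singles out
  \<open>\<A>\<^sub>z\<^sup>-\<^sup>1\<close> inside \<open>\<A>\<^sub>z\<^sup>0\<close>.\<close>

fun E1_then_E0 :: "word \<Rightarrow> bool" where
  "E1_then_E0 [] = True"
| "E1_then_E0 (a # w) = (E1_then_E0 w \<and> (a = E1 \<longrightarrow> E0 \<in> set w))"

text \<open>In a shuffle, each letter keeps to its right everything that followed it in its own
  word.\<close>

lemma E1_then_E0_shuffles:
  "w \<in> shuffles u v \<Longrightarrow> E1_then_E0 u \<Longrightarrow> E1_then_E0 v \<Longrightarrow> E1_then_E0 w"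
proof (induction u v arbitrary: w rule: shuffles.induct)
  case (3 x xs y ys)
  then show ?case by (fastforce dest: set_shuffles)
qed auto

lemma E1_then_E0_append: "E1_then_E0 (u @ v) \<Longrightarrow> E1_then_E0 v"
  by (induction u) auto

lemma E1_then_E0_zm2: "last u = E0 \<Longrightarrow> E1_then_E0 u"
proof (induction u)
  case (Cons a u)
  then show ?case by (cases "u = []") (auto dest: last_in_set)
qed auto

lemma E1_then_E0_no_E1: "E1 \<notin> set u \<Longrightarrow> E1_then_E0 u"
  by (induction u) auto

text \<open>The tail behind the last e_0 satisfies the same condition and contains no e_0. So it
  contains no e_1 either and is a power of e_z.\<close>

lemma words_zm1I:
  assumes "w = [] \<or> hd w \<noteq> E0" "E1_then_E0 w"
  shows "w \<in> words_zm1"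
proof -
  obtain u x where ux: "w = u @ x" "u \<in> words_zm2" "x \<in> lists {E1, EZ}"
    using assms(1) by (metis word_split_last_E0)
  have "E1_then_E0 x" using assms ux E1_then_E0_append by blast
  with ux(3) have "x = replicate (length x) EZ"
    by (induction x) auto
  then show ?thesis using ux unfolding words_zm1_def by blast
qed

text \<open>This is the effect of duality in the definition of N: the second factor has lost its
  letters e_1, and those of the first are followed by its final e_0.\<close>

lemma shuffle_zm2_in_zm1:
  assumes "u \<in> words_zm2" "v \<in> words_z0 \<inter> lists {E0, EZ}" "w \<in> shuffles u v"
  shows "w \<in> words_zm1"
proof (rule words_zm1I)
  show "w = [] \<or> hd w \<noteq> E0"
    using hd_shuffles[OF assms(3)] assms(1,2) by (auto simp: words_zm2_iff words_z0_iff)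
  have "E1_then_E0 u"
    using assms(1) by (auto simp: words_zm2_iff intro: E1_then_E0_zm2)
  moreover have "E1_then_E0 v"
    using assms(2) by (intro E1_then_E0_no_E1) auto
  ultimately show "E1_then_E0 w"
    using assms(3) E1_then_E0_shuffles by blast
qed

text \<open>The words of \<open>\<tau>\<^sub>z(w)\<close> for \<open>w\<close> in the letters \<open>e\<^sub>1\<close>, \<open>e\<^sub>z\<close>, up to reversal.\<close>

fun tau_list :: "word \<Rightarrow> word list" where
  "tau_list [] = [[]]"
| "tau_list (a # w) = map (Cons EZ) (tau_list w) @
     (if a = E1 then map (Cons E0) (tau_list w) else [])"

text \<open>The sign of the product of the 1 / (t - a) for t in (0, 1): positive for the pole 0,
  negative for the poles 1 and z.\<close>

definition word_sign :: "word \<Rightarrow> real" where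
  "word_sign w = (\<Prod>a\<leftarrow>w. if a = E0 then 1 else - 1)"

lemma word_sign_Nil [simp]: "word_sign [] = 1"
  and word_sign_Cons: "word_sign (a # w) = (if a = E0 then 1 else - 1) * word_sign w"
  and word_sign_append: "word_sign (u @ v) = word_sign u * word_sign v"
  by (simp_all add: word_sign_def)

lemma word_sign_shuffles: "w \<in> shuffles u v \<Longrightarrow> word_sign w = word_sign u * word_sign v"
  by (induction u v arbitrary: w rule: shuffles.induct) (auto simp: word_sign_Cons)

section \<open>The duality map on words in e_1 and e_z\<close>

lemma tau_z_frag_of: "tau_z (frag_of w) = prod_list (map tau_letter (rev w))"
  by (simp add: tau_z_def)

text \<open>In tau_z(e_1) = e_z - e_0 the coefficient times the sign of the letter is -1 for both
  summands, which is also the sign of e_1. After weighting with \<open>word_sign\<close> all terms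
  thus have the same sign, and a sum of nonnegative integrals remains.\<close>

lemma lin_tau_z:
  assumes "w \<in> lists {E1, EZ}"
  shows "lin (\<lambda>v. word_sign v * f v) (tau_z (frag_of w))
     = word_sign w * (\<Sum>x\<leftarrow>tau_list w. f (rev x))"
  using assms
proof (induction w arbitrary: f rule: list.induct)
  case (Cons a w)
  have snoc: "lin g (y * gen c) = lin (\<lambda>v. g (v @ [c])) y" for g c and y :: Az
    by (simp add: times_gen_eq_frag_extend lin_frag_extend)
  note IH = Cons.IH[unfolded tau_z_frag_of]
  have z: "lin (\<lambda>v. word_sign v * f v) (prod_list (map tau_letter (rev w)) * gen EZ)
      = - (word_sign w * (\<Sum>x\<leftarrow>tau_list w. f (rev x @ [EZ])))"
    using IH[of "\<lambda>v. - f (v @ [EZ])"] Cons.prems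
    by (simp add: snoc word_sign_append word_sign_Cons)
       (simp add: uminus_sum_list_map[symmetric, unfolded o_def])
  have 0: "lin (\<lambda>v. word_sign v * f v) (prod_list (map tau_letter (rev w)) * gen E0)
      = word_sign w * (\<Sum>x\<leftarrow>tau_list w. f (rev x @ [E0]))"
    using IH[of "\<lambda>v. f (v @ [E0])"] Cons.prems
    by (simp add: snoc word_sign_append word_sign_Cons)
  have "a = E1 \<or> a = EZ" using Cons.prems by (cases a) auto
  then show ?case
    using z 0 by (auto simp: tau_z_frag_of right_diff_distrib lin_diff word_sign_Cons o_def
        algebra_simps)
qed (simp add: tau_z_def frag_of_Nil[symmetric])

lemma keys_tau_z:
  assumes "w \<in> lists {E1, EZ}"
  shows "keys (tau_z (frag_of w)) \<subseteq> rev ` set (tau_list w)"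
  using assms
proof (induction w rule: list.induct)
  case (Cons a w)
  have snoc: "keys (y * gen c) \<subseteq> (\<lambda>v. v @ [c]) ` keys y" for c and y :: Az
    unfolding times_gen_eq_frag_extend by (rule order_trans[OF keys_frag_extend]) auto
  let ?y = "prod_list (map tau_letter (rev w))"
  have IH: "keys ?y \<subseteq> rev ` set (tau_list w)"
    using Cons by (simp add: tau_z_frag_of)
  have y: "keys (?y * gen c) \<subseteq> (\<lambda>x. rev (c # x)) ` set (tau_list w)" for c
    using snoc[of ?y c] image_mono[OF IH, of "\<lambda>v. v @ [c]"] by (simp add: image_image)
  have "a = E1 \<or> a = EZ" using Cons.prems by (cases a) auto
  then show ?case
  proof
    assume a: "a = E1"
    have "keys (?y * gen EZ - ?y * gen E0)
        \<subseteq> (\<lambda>x. rev (EZ # x)) ` set (tau_list w) \<union> (\<lambda>x. rev (E0 # x)) ` set (tau_list w)"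
      using y[of EZ] y[of E0] keys_diff[of "?y * gen EZ" "?y * gen E0"] by blast
    then show ?thesis
      by (simp add: a tau_z_frag_of right_diff_distrib image_Un image_image)
  next
    assume a: "a = EZ"
    show ?thesis using y[of EZ] by (simp add: a tau_z_frag_of image_image)
  qed
qed (simp add: tau_z_def frag_of_Nil[symmetric])

lemma length_tau_list: "x \<in> set (tau_list w) \<Longrightarrow> length x = length w"
  by (induction w arbitrary: x) (auto split: if_splits)

lemma set_tau_list: "x \<in> set (tau_list w) \<Longrightarrow> set x \<subseteq> {E0, EZ}"
  by (induction w arbitrary: x) (fastforce split: if_splits)+

lemma last_tau_list:
  assumes "x \<in> set (tau_list w)" "last w = EZ" "w \<noteq> []"
  shows "last x = EZ"
  using assms
proof (induction w arbitrary: x)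
  case (Cons a w)
  then obtain b y where "x = b # y" "y \<in> set (tau_list w)" "w = [] \<Longrightarrow> b = EZ"
    by (auto split: if_splits)
  then show ?case using Cons length_tau_list[of y w] by (cases "w = []") auto
qed simp

text \<open>A nonempty word of this kind ends in e_z. The anti-automorphism fixes this letter and
  moves it to the front, so no word of the image begins with e_0.\<close>

lemma tau_z_span:
  assumes "v \<in> words_z0 \<inter> lists {E1, EZ}"
  shows "tau_z (frag_of v) \<in> span_basis (words_z0 \<inter> lists {E0, EZ})"
proof -
  have v: "v \<in> lists {E1, EZ}" using assms by simp
  have "rev x \<in> words_z0 \<inter> lists {E0, EZ}" if x: "x \<in> set (tau_list v)" for x
  proof (cases "v = []")
    case True
    then show ?thesis using x by (simp add: words_z0_iff)
  next
    case False
    then have "last v \<in> {E1, EZ}" using v by (metis in_listsD last_in_set)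
    with assms False have "last v = EZ" by (auto simp: words_z0_iff)
    then have "last x = EZ" "x \<noteq> []" "x \<in> lists {E0, EZ}"
      using set_tau_list[OF x] length_tau_list[OF x] last_tau_list[OF x] False by auto
    moreover have "hd x \<noteq> E1" using calculation by (cases x) auto
    ultimately show ?thesis by (auto simp: words_z0_iff hd_rev last_rev)
  qed
  then show ?thesis using keys_tau_z[OF v] unfolding span_basis_def by blast
qed

lemma N_map_mem:
  assumes "r \<in> span_basis (words_zm2 \<times> (words_z0 \<inter> lists {E1, EZ}))"
  shows "shuffle_map (tensor_map id tau_z r) \<in> span_basis words_zm1"
proof -
  have sh: "shuffle_word u v \<in> span_basis words_zm1"
    if "u \<in> words_zm2" "v \<in> words_z0 \<inter> lists {E0, EZ}" for u v
    unfolding shuffle_word_eq_sum_list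
    using that by (intro span_basis_sum_list) (auto simp: set_shuffle_list intro: shuffle_zm2_in_zm1)
  have tm: "tensor_map id tau_z r \<in> span_basis (words_zm2 \<times> (words_z0 \<inter> lists {E0, EZ}))"
    unfolding tensor_map_def tensor_def
    using assms by (rule span_basis_frag_extend)
      (auto intro!: span_basis_frag_extend[OF tau_z_span])
  show ?thesis
    unfolding shuffle_map_def
    using tm by (rule span_basis_frag_extend) (auto simp: shuffle_frag_of intro!: sh)
qed

section \<open>Iterated integrals\<close>

text \<open>The head of the list belongs to the smallest variable here and to the largest one in
  \<open>iint_down\<close>. Splitting off the smallest variable matches the recursion of the shuffle
  product; splitting off the largest one is what reflection and the simplex integral
  produce.\<close>

primrec iint_up :: "(real \<Rightarrow> ennreal) list \<Rightarrow> real \<Rightarrow> ennreal" where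
  "iint_up [] t = 1"
| "iint_up (f # fs) t = (\<integral>\<^sup>+s. f s * iint_up fs s * indicator {t<..<1} s \<partial>lborel)"

primrec iint_down :: "(real \<Rightarrow> ennreal) list \<Rightarrow> real \<Rightarrow> ennreal" where
  "iint_down [] t = 1"
| "iint_down (f # fs) t = (\<integral>\<^sup>+s. f s * iint_down fs s * indicator {0<..<t} s \<partial>lborel)"

section \<open>Measurability and the shuffle relation for iterated integrals\<close>

lemma borel_measurable_nn_integral_upper:
  assumes [measurable]: "f \<in> borel_measurable borel"
  shows "(\<lambda>t. \<integral>\<^sup>+s. f s * indicator {t<..<b} s \<partial>lborel) \<in> borel_measurable (borel :: real measure)"
proof -
  have "(\<lambda>t. \<integral>\<^sup>+s. f s * indicator {t<..<b} s \<partial>lborel)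
      = (\<lambda>t. \<integral>\<^sup>+s. (if t < s \<and> s < b then f s else 0) \<partial>lborel)"
    by (intro ext nn_integral_cong) auto
  also have "\<dots> \<in> borel_measurable borel" by measurable
  finally show ?thesis .
qed

lemma borel_measurable_nn_integral_lower:
  assumes [measurable]: "f \<in> borel_measurable borel"
  shows "(\<lambda>t. \<integral>\<^sup>+s. f s * indicator {a<..<t} s \<partial>lborel) \<in> borel_measurable (borel :: real measure)"
proof -
  have "(\<lambda>t. \<integral>\<^sup>+s. f s * indicator {a<..<t} s \<partial>lborel)
      = (\<lambda>t. \<integral>\<^sup>+s. (if a < s \<and> s < t then f s else 0) \<partial>lborel)"
    by (intro ext nn_integral_cong) auto
  also have "\<dots> \<in> borel_measurable borel" by measurable
  finally show ?thesis .
qed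

lemma borel_measurable_iint_up [measurable (raw)]:
  "set fs \<subseteq> borel_measurable borel \<Longrightarrow> iint_up fs \<in> borel_measurable borel"
proof (induction fs)
  case Nil
  have "iint_up [] = (\<lambda>_. 1)" by auto
  then show ?case by simp
next
  case (Cons f fs)
  then have [measurable]: "f \<in> borel_measurable borel" "iint_up fs \<in> borel_measurable borel" by auto
  have "iint_up (f # fs) = (\<lambda>t. \<integral>\<^sup>+s. (f s * iint_up fs s) * indicator {t<..<1} s \<partial>lborel)"
    by auto
  then show ?case
    using borel_measurable_nn_integral_upper[of "\<lambda>s. f s * iint_up fs s" 1] by simp
qed

lemma borel_measurable_iint_down [measurable (raw)]:
  "set fs \<subseteq> borel_measurable borel \<Longrightarrow> iint_down fs \<in> borel_measurable borel"
proof (induction fs)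
  case Nil
  have "iint_down [] = (\<lambda>_. 1)" by auto
  then show ?case by simp
next
  case (Cons f fs)
  then have [measurable]: "f \<in> borel_measurable borel" "iint_down fs \<in> borel_measurable borel" by auto
  have "iint_down (f # fs) = (\<lambda>t. \<integral>\<^sup>+s. (f s * iint_down fs s) * indicator {0<..<t} s \<partial>lborel)"
    by auto
  then show ?case
    using borel_measurable_nn_integral_lower[of "\<lambda>s. f s * iint_down fs s" 0] by simp
qed

lemma nn_integral_triangle_swap:
  fixes a b :: "real \<Rightarrow> ennreal"
  assumes [measurable]: "a \<in> borel_measurable borel" "b \<in> borel_measurable borel"
  shows "(\<integral>\<^sup>+s. a s * (\<integral>\<^sup>+r. b r * indicator {..<s} r \<partial>lborel) \<partial>lborel)
       = (\<integral>\<^sup>+r. b r * (\<integral>\<^sup>+s. a s * indicator {r<..} s \<partial>lborel) \<partial>lborel)"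
proof -
  have "(\<integral>\<^sup>+s. a s * (\<integral>\<^sup>+r. b r * indicator {..<s} r \<partial>lborel) \<partial>lborel)
      = (\<integral>\<^sup>+s. (\<integral>\<^sup>+r. (if r < s then a s * b r else 0) \<partial>lborel) \<partial>lborel)"
    by (subst nn_integral_cmult[symmetric]) (auto intro!: nn_integral_cong split: split_indicator)
  also have "\<dots> = (\<integral>\<^sup>+r. (\<integral>\<^sup>+s. (if r < s then a s * b r else 0) \<partial>lborel) \<partial>lborel)"
    by (rule lborel_pair.Fubini') measurable
  also have "\<dots> = (\<integral>\<^sup>+r. b r * (\<integral>\<^sup>+s. a s * indicator {r<..} s \<partial>lborel) \<partial>lborel)"
    by (subst nn_integral_cmult[symmetric]) (auto intro!: nn_integral_cong split: split_indicator simp: mult.commute)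
  finally show ?thesis .
qed

text \<open>The product is an integral over the smallest variables s and r of the two chains. It
  splits into the parts s < r and r < s; the diagonal is a null set.\<close>

lemma iint_up_Cons_mult_iint_up_Cons:
  assumes f: "set (f # fs) \<subseteq> borel_measurable borel" and g: "set (g # gs) \<subseteq> borel_measurable borel"
  shows "iint_up (f # fs) t * iint_up (g # gs) t =
    (\<integral>\<^sup>+s. f s * (iint_up fs s * iint_up (g # gs) s) * indicator {t<..<1} s \<partial>lborel) +
    (\<integral>\<^sup>+s. g s * (iint_up (f # fs) s * iint_up gs s) * indicator {t<..<1} s \<partial>lborel)"
proof -
  have [measurable]: "f \<in> borel_measurable borel" "g \<in> borel_measurable borel"
    "iint_up fs \<in> borel_measurable borel" "iint_up gs \<in> borel_measurable borel"
    using f g by (auto intro: borel_measurable_iint_up)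
  define a where "a s = f s * iint_up fs s * indicator {t<..<1} s" for s
  define b where "b s = g s * iint_up gs s * indicator {t<..<1} s" for s
  have [measurable]: "a \<in> borel_measurable borel" "b \<in> borel_measurable borel"
    unfolding a_def b_def by measurable
  have split: "(\<integral>\<^sup>+r. b r \<partial>lborel)
      = (\<integral>\<^sup>+r. b r * indicator {..<s} r \<partial>lborel) + (\<integral>\<^sup>+r. b r * indicator {s<..} r \<partial>lborel)" for s
  proof -
    have "(\<integral>\<^sup>+r. b r \<partial>lborel)
        = (\<integral>\<^sup>+r. b r * indicator {..<s} r + b r * indicator {s<..} r \<partial>lborel)"
      by (intro nn_integral_cong_AE, rule eventually_mono[OF AE_lborel_singleton[of s]])
         (auto split: split_indicator)
    then show ?thesis by (subst (asm) nn_integral_add) auto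
  qed
  have "iint_up (f # fs) t * iint_up (g # gs) t = (\<integral>\<^sup>+s. a s * (\<integral>\<^sup>+r. b r \<partial>lborel) \<partial>lborel)"
    by (subst nn_integral_multc) (simp_all add: a_def[abs_def] b_def[abs_def])
  also have "\<dots> = (\<integral>\<^sup>+s. a s * (\<integral>\<^sup>+r. b r * indicator {..<s} r \<partial>lborel) +
      a s * (\<integral>\<^sup>+r. b r * indicator {s<..} r \<partial>lborel) \<partial>lborel)"
    by (intro nn_integral_cong) (metis split distrib_left)
  also have "\<dots> = (\<integral>\<^sup>+s. a s * (\<integral>\<^sup>+r. b r * indicator {..<s} r \<partial>lborel) \<partial>lborel) +
      (\<integral>\<^sup>+s. a s * (\<integral>\<^sup>+r. b r * indicator {s<..} r \<partial>lborel) \<partial>lborel)"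
  proof (intro nn_integral_add)
    have "(\<lambda>s. \<integral>\<^sup>+r. b r * indicator {..<s} r \<partial>lborel) = (\<lambda>s. \<integral>\<^sup>+r. (if r < s then b r else 0) \<partial>lborel)"
      by (intro ext nn_integral_cong) auto
    also have "\<dots> \<in> borel_measurable borel" by measurable
    finally show "(\<lambda>s. a s * (\<integral>\<^sup>+r. b r * indicator {..<s} r \<partial>lborel)) \<in> borel_measurable lborel"
      by measurable
    have "(\<lambda>s. \<integral>\<^sup>+r. b r * indicator {s<..} r \<partial>lborel) = (\<lambda>s. \<integral>\<^sup>+r. (if s < r then b r else 0) \<partial>lborel)"
      by (intro ext nn_integral_cong) auto
    also have "\<dots> \<in> borel_measurable borel" by measurable
    finally show "(\<lambda>s. a s * (\<integral>\<^sup>+r. b r * indicator {s<..} r \<partial>lborel)) \<in> borel_measurable lborel"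
      by measurable
  qed
  also have "(\<integral>\<^sup>+s. a s * (\<integral>\<^sup>+r. b r * indicator {..<s} r \<partial>lborel) \<partial>lborel)
      = (\<integral>\<^sup>+r. b r * (\<integral>\<^sup>+s. a s * indicator {r<..} s \<partial>lborel) \<partial>lborel)"
    by (rule nn_integral_triangle_swap) measurable
  also have "\<dots> = (\<integral>\<^sup>+s. g s * (iint_up (f # fs) s * iint_up gs s) * indicator {t<..<1} s \<partial>lborel)"
  proof (intro nn_integral_cong)
    fix r
    have "(\<integral>\<^sup>+s. a s * indicator {r<..} s \<partial>lborel) = iint_up (f # fs) r" if "t < r"
      unfolding iint_up.simps a_def using that by (intro nn_integral_cong) (auto split: split_indicator)
    then show "b r * (\<integral>\<^sup>+s. a s * indicator {r<..} s \<partial>lborel)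
        = g r * (iint_up (f # fs) r * iint_up gs r) * indicator {t<..<1} r"
      by (simp add: b_def mult_ac split: split_indicator del: iint_up.simps)
  qed
  also have "(\<integral>\<^sup>+s. a s * (\<integral>\<^sup>+r. b r * indicator {s<..} r \<partial>lborel) \<partial>lborel)
      = (\<integral>\<^sup>+s. f s * (iint_up fs s * iint_up (g # gs) s) * indicator {t<..<1} s \<partial>lborel)"
  proof (intro nn_integral_cong)
    fix r
    have "(\<integral>\<^sup>+s. b s * indicator {r<..} s \<partial>lborel) = iint_up (g # gs) r" if "t < r"
      unfolding iint_up.simps b_def using that by (intro nn_integral_cong) (auto split: split_indicator)
    then show "a r * (\<integral>\<^sup>+s. b s * indicator {r<..} s \<partial>lborel)
        = f r * (iint_up fs r * iint_up (g # gs) r) * indicator {t<..<1} r"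
      by (simp add: a_def mult_ac split: split_indicator del: iint_up.simps)
  qed
  finally show ?thesis by (simp only: add.commute)
qed

lemma sum_list_iint_up_Cons:
  assumes "f \<in> borel_measurable borel" "\<And>a. k a \<in> borel_measurable borel"
  shows "(\<Sum>x\<leftarrow>xs. iint_up (f # map k x) t)
    = (\<integral>\<^sup>+s. f s * (\<Sum>x\<leftarrow>xs. iint_up (map k x) s) * indicator {t<..<1} s \<partial>lborel)"
proof (induction xs)
  case (Cons x xs)
  have [measurable]: "iint_up (map k x) \<in> borel_measurable borel" for x
    using assms by (intro borel_measurable_iint_up) auto
  have [measurable]: "(\<lambda>s. \<Sum>x\<leftarrow>xs. iint_up (map k x) s) \<in> borel_measurable borel"
    by (induction xs) auto
  note [measurable] = assms(1)
  have "(\<Sum>x\<leftarrow>x # xs. iint_up (f # map k x) t)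
      = (\<integral>\<^sup>+s. f s * iint_up (map k x) s * indicator {t<..<1} s + f s * (\<Sum>x\<leftarrow>xs. iint_up (map k x) s) * indicator {t<..<1} s \<partial>lborel)"
    by (subst nn_integral_add) (use Cons in auto)
  then show ?case by (simp only: list.map sum_list.Cons distrib_left distrib_right)
qed simp

lemma iint_up_shuffle:
  assumes k: "\<And>a. k a \<in> borel_measurable borel"
  shows "(\<Sum>x\<leftarrow>shuffle_list u v. iint_up (map k x) t) = iint_up (map k u) t * iint_up (map k v) t"
proof (induction u v arbitrary: t rule: shuffle_list.induct)
  case (3 a u b v)
  have "(\<Sum>x\<leftarrow>shuffle_list (a # u) (b # v). iint_up (map k x) t)
     = (\<Sum>x\<leftarrow>shuffle_list u (b # v). iint_up (k a # map k x) t) + (\<Sum>x\<leftarrow>shuffle_list (a # u) v. iint_up (k b # map k x) t)"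
    by (simp only: shuffle_list.simps map_append sum_list_append map_map o_def list.map)
  also have "\<dots> = iint_up (map k (a # u)) t * iint_up (map k (b # v)) t"
    unfolding sum_list_iint_up_Cons[OF k k] 3 list.map
    by (subst iint_up_Cons_mult_iint_up_Cons) (auto simp: k)
  finally show ?case .
qed simp_all

text \<open>The variable s cuts a chain in two, with the variables of \<open>gs\<close> below it and
  those of \<open>fs\<close> above. The induction hands the smallest upper variable over to the
  lower part.\<close>

lemma nn_integral_iint_down_mult_iint_up:
  assumes "set (f # gs) \<subseteq> borel_measurable borel" "set fs \<subseteq> borel_measurable borel"
  shows "(\<integral>\<^sup>+s. f s * iint_down gs s * iint_up fs s * indicator {0<..<1} s \<partial>lborel) =
    iint_down (rev fs @ f # gs) 1"
  using assms
proof (induction fs arbitrary: f gs)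
  case (Cons h fs)
  have [measurable]: "f \<in> borel_measurable borel" "h \<in> borel_measurable borel"
    "iint_down gs \<in> borel_measurable borel" "iint_up fs \<in> borel_measurable borel"
    using Cons.prems by (auto intro: borel_measurable_iint_down borel_measurable_iint_up)
  define a where "a s = f s * iint_down gs s * indicator {0<..<1} s" for s
  define b where "b s = h s * iint_up fs s * indicator {0<..<1} s" for s
  have [measurable]: "a \<in> borel_measurable borel" "b \<in> borel_measurable borel"
    unfolding a_def b_def by measurable
  have "(\<integral>\<^sup>+s. f s * iint_down gs s * iint_up (h # fs) s * indicator {0<..<1} s \<partial>lborel)
      = (\<integral>\<^sup>+s. a s * (\<integral>\<^sup>+r. b r * indicator {s<..} r \<partial>lborel) \<partial>lborel)"
  proof (intro nn_integral_cong)
    fix s :: real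
    have "iint_up (h # fs) s = (\<integral>\<^sup>+r. b r * indicator {s<..} r \<partial>lborel)" if "0 < s"
      unfolding iint_up.simps b_def using that by (intro nn_integral_cong) (auto split: split_indicator)
    then show "f s * iint_down gs s * iint_up (h # fs) s * indicator {0<..<1} s
        = a s * (\<integral>\<^sup>+r. b r * indicator {s<..} r \<partial>lborel)"
      by (simp add: a_def mult_ac split: split_indicator del: iint_up.simps)
  qed
  also have "\<dots> = (\<integral>\<^sup>+r. b r * (\<integral>\<^sup>+s. a s * indicator {..<r} s \<partial>lborel) \<partial>lborel)"
    by (rule nn_integral_triangle_swap[symmetric]) measurable
  also have "\<dots> = (\<integral>\<^sup>+s. h s * iint_down (f # gs) s * iint_up fs s * indicator {0<..<1} s \<partial>lborel)"
  proof (intro nn_integral_cong)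
    fix r :: real
    have "(\<integral>\<^sup>+s. a s * indicator {..<r} s \<partial>lborel) = iint_down (f # gs) r" if "r < 1"
      unfolding iint_down.simps a_def using that
        by (intro nn_integral_cong) (auto split: split_indicator)
    then show "b r * (\<integral>\<^sup>+s. a s * indicator {..<r} s \<partial>lborel)
        = h r * iint_down (f # gs) r * iint_up fs r * indicator {0<..<1} r"
      by (simp add: b_def mult_ac split: split_indicator del: iint_down.simps)
  qed
  also have "\<dots> = iint_down (rev (h # fs) @ f # gs) 1"
    using Cons.IH[of h "f # gs"] Cons.prems by (simp del: iint_down.simps iint_up.simps)
  finally show ?case .
qed simp

section \<open>Reversal, reflection and substitution\<close>

lemma iint_up_eq_iint_down_rev:
  assumes "set fs \<subseteq> borel_measurable borel"
  shows "iint_up fs 0 = iint_down (rev fs) 1"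
proof (cases fs)
  case (Cons f gs)
  then show ?thesis using nn_integral_iint_down_mult_iint_up[of f "[]" gs] assms by simp
qed simp

lemma iint_up_reflect:
  assumes "set fs \<subseteq> borel_measurable borel"
  shows "iint_up (map (\<lambda>f s. f (1 - s)) fs) t = iint_down fs (1 - t)"
  using assms
proof (induction fs arbitrary: t)
  case (Cons f fs)
  have [measurable]: "f \<in> borel_measurable borel" "iint_down fs \<in> borel_measurable borel"
    using Cons.prems by (auto intro: borel_measurable_iint_down)
  have "iint_down (f # fs) (1 - t) = (\<integral>\<^sup>+s. f (1 + (- 1) * s) * iint_down fs (1 + (- 1) * s) *
    indicator {0<..<1 - t} (1 + (- 1) * s) \<partial>lborel)"
    unfolding iint_down.simps by (subst nn_integral_real_affine[where c = "- 1" and t = 1]) auto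
  also have "\<dots> = iint_up (map (\<lambda>f s. f (1 - s)) (f # fs)) t"
    using Cons by (auto intro!: nn_integral_cong split: split_indicator)
  finally show ?case by simp
qed simp

lemma iint_up_substitution:
  fixes g g' :: "real \<Rightarrow> real"
  assumes fs: "set fs \<subseteq> borel_measurable borel"
    and deriv: "\<And>x. 0 \<le> x \<Longrightarrow> x \<le> 1 \<Longrightarrow> (g has_real_derivative g' x) (at x)"
    and cont: "continuous_on {0..1} g'" and pos: "\<And>x. 0 \<le> x \<Longrightarrow> x \<le> 1 \<Longrightarrow> g' x \<ge> 0"
    and g1: "g 1 = 1" and t: "0 \<le> t" "t < 1"
  shows "iint_up fs (g t) = iint_up (map (\<lambda>f s. f (g s) * ennreal (g' s)) fs) t"
  using fs t
proof (induction fs arbitrary: t)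
  case (Cons f fs)
  have [measurable]: "f \<in> borel_measurable borel" "iint_up fs \<in> borel_measurable borel"
    using Cons.prems by (auto intro: borel_measurable_iint_up)
  \<comment> \<open>The substitution rule speaks of closed intervals; end points are null
    sets.\<close>
  have ends: "(\<integral>\<^sup>+s. h s * indicator {a<..<b} s \<partial>lborel) = (\<integral>\<^sup>+s. h s * indicator {a..b} s \<partial>lborel)"
    for h :: "real \<Rightarrow> ennreal" and a b :: real
  proof (intro nn_integral_cong_AE)
    show "AE s in lborel. h s * indicator {a<..<b} s = h s * indicator {a..b} s"
      using AE_lborel_singleton[of a] AE_lborel_singleton[of b]
      by eventually_elim (auto split: split_indicator)
  qed
  have "iint_up (f # fs) (g t) = (\<integral>\<^sup>+s. (f s * iint_up fs s) * indicator {g t..g 1} s \<partial>lborel)"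
    by (simp add: ends g1)
  also have "\<dots> = (\<integral>\<^sup>+s. (f (g s) * iint_up fs (g s)) * g' s * indicator {t..1} s \<partial>lborel)"
    using Cons.prems by (intro nn_integral_substitution_aux)
      (auto intro!: deriv pos continuous_on_subset[OF cont])
  also have "\<dots> = (\<integral>\<^sup>+s. (f (g s) * iint_up fs (g s)) * g' s * indicator {t<..<1} s \<partial>lborel)"
    by (simp only: ends)
  also have "\<dots> = iint_up (map (\<lambda>f s. f (g s) * ennreal (g' s)) (f # fs)) t"
    using Cons by (auto intro!: nn_integral_cong split: split_indicator simp: mult_ac)
  finally show ?case .
qed simp

section \<open>Integrals over the ordered simplex\<close>

lemma sets_simplex_pred [measurable]:
  fixes n :: nat
  shows "Measurable.pred (\<Pi>\<^sub>M i\<in>{..<n}. lborel)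
     (\<lambda>t. (\<forall>i<n. 0 < t i \<and> t i < b) \<and> (\<forall>i j. i < j \<and> j < n \<longrightarrow> t i < (t j :: real)))"
proof -
  have [measurable]: "(\<lambda>t. t i) \<in> borel_measurable (\<Pi>\<^sub>M i\<in>{..<n}. (lborel :: real measure))"
    if "i \<in> {..<n}" for i
    using measurable_component_singleton[OF that, of "\<lambda>_. lborel :: real measure"] by simp
  have "(\<lambda>t. (\<forall>i<n. 0 < t i \<and> t i < b) \<and> (\<forall>i j. i < j \<and> j < n \<longrightarrow> t i < t j))
    = (\<lambda>t. (\<forall>i\<in>{..<n}. 0 < t i \<and> t i < b) \<and> (\<forall>i\<in>{..<n}. \<forall>j\<in>{..<n}. i < j \<longrightarrow> t i < t j))"
    by (intro ext) auto
  also have "Measurable.pred (\<Pi>\<^sub>M i\<in>{..<n}. lborel) \<dots>"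
    by (intro pred_intros_logic pred_intros_finite finite_lessThan) measurable
  finally show ?thesis .
qed

text \<open>The last coordinate y is the largest, and the others range over the simplex below y.
  This is why the upper end b is arbitrary and the list is reversed.\<close>

lemma nn_integral_simplex:
  assumes "set fs \<subseteq> borel_measurable borel"
  shows "(\<integral>\<^sup>+t. (\<Prod>i<length fs. (fs ! i) (t i)) * indicator {t. (\<forall>i<length fs. 0 < t i \<and> t i < b) \<and>
      (\<forall>i j. i < j \<and> j < length fs \<longrightarrow> t i < t j)} t \<partial>(\<Pi>\<^sub>M i\<in>{..<length fs}. lborel)) = iint_down (rev fs) b"
  using assms
proof (induction fs arbitrary: b rule: rev_induct)
  case Nil
  interpret product_sigma_finite "\<lambda>_ :: nat. lborel :: real measure" ..
  show ?case by (simp add: PiM_empty nn_integral_count_space_finite)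
next
  case (snoc f fs)
  interpret product_sigma_finite "\<lambda>_ :: nat. lborel :: real measure" ..
  define n where "n = length fs"
  define S where "S m b = {t :: nat \<Rightarrow> real. (\<forall>i<m. 0 < t i \<and> t i < b) \<and> (\<forall>i j. i < j \<and> j < m \<longrightarrow>
    t i < t j)}" for m b
  have [measurable]: "f \<in> borel_measurable borel" "i < n \<Longrightarrow> fs ! i \<in> borel_measurable borel" for i
    using snoc.prems by (auto simp: n_def)
  have meas: "(\<lambda>t. (\<Prod>i<m. (hs ! i) (t i)) * indicator (S m b) t) \<in>
    borel_measurable (\<Pi>\<^sub>M i\<in>{..<m}. lborel)"
    if "\<And>i. i < m \<Longrightarrow> hs ! i \<in> borel_measurable borel" for m b and hs :: "(real \<Rightarrow> ennreal) list"
  proof -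
    have "(\<lambda>t. \<Prod>i<m. (hs ! i) (t i)) \<in> borel_measurable (\<Pi>\<^sub>M i\<in>{..<m}. lborel)"
      using that
        by (intro borel_measurable_prod_ennreal) (auto intro!: measurable_compose[OF measurable_component_singleton])
    then show ?thesis unfolding S_def by measurable
  qed
  have ins: "{..<Suc n} = insert n {..<n}" by auto
  have "(\<integral>\<^sup>+t. (\<Prod>i<Suc n. ((fs @ [f]) ! i) (t i)) *
    indicator (S (Suc n) b) t \<partial>(\<Pi>\<^sub>M i\<in>{..<Suc n}. lborel))
      = (\<integral>\<^sup>+y. (\<integral>\<^sup>+t. (\<Prod>i<Suc n. ((fs @ [f]) ! i) ((t(n := y)) i)) * indicator (S (Suc n) b) (t(n := y))
          \<partial>(\<Pi>\<^sub>M i\<in>{..<n}. lborel)) \<partial>lborel)"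
    unfolding ins
    by (rule product_nn_integral_insert_rev, simp, simp, fold ins, rule meas)
       (use snoc.prems in \<open>auto simp: nth_append n_def less_Suc_eq\<close>)
  also have "\<dots> = (\<integral>\<^sup>+y. (\<integral>\<^sup>+t. (f y * indicator {0<..<b} y) * ((\<Prod>i<n. (fs ! i) (t i)) *
    indicator (S n y) t)
          \<partial>(\<Pi>\<^sub>M i\<in>{..<n}. lborel)) \<partial>lborel)"
  proof (intro nn_integral_cong)
    fix y :: real and t :: "nat \<Rightarrow> real"
    have 1: "(\<Prod>i<Suc n. ((fs @ [f]) ! i) ((t(n := y)) i)) = f y * (\<Prod>i<n. (fs ! i) (t i))"
      by (simp add: n_def nth_append mult.commute)
    have 2: "t(n := y) \<in> S (Suc n) b \<longleftrightarrow> y \<in> {0<..<b} \<and> t \<in> S n y"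
      unfolding S_def by (fastforce simp: less_Suc_eq)
    show "(\<Prod>i<Suc n. ((fs @ [f]) ! i) ((t(n := y)) i)) * indicator (S (Suc n) b) (t(n := y))
       = (f y * indicator {0<..<b} y) * ((\<Prod>i<n. (fs ! i) (t i)) * indicator (S n y) t)"
      unfolding 1 using 2 by (auto simp: indicator_def)
  qed
  also have "\<dots> = (\<integral>\<^sup>+y. (f y * indicator {0<..<b} y) * iint_down (rev fs) y \<partial>lborel)"
  proof (intro nn_integral_cong)
    fix y :: real
    have "(\<integral>\<^sup>+t. (\<Prod>i<n. (fs ! i) (t i)) * indicator (S n y) t \<partial>(\<Pi>\<^sub>M i\<in>{..<n}. lborel)) =
      iint_down (rev fs) y"
      using snoc unfolding S_def n_def by simp
    then show "(\<integral>\<^sup>+t. (f y * indicator {0<..<b} y) * ((\<Prod>i<n. (fs ! i) (t i)) * indicator (S n y) t)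
          \<partial>(\<Pi>\<^sub>M i\<in>{..<n}. lborel)) = (f y * indicator {0<..<b} y) * iint_down (rev fs) y"
      by (subst nn_integral_cmult) (auto intro!: meas)
  qed
  also have "\<dots> = iint_down (rev (fs @ [f])) b"
    by (auto intro!: nn_integral_cong simp: mult_ac)
  finally show ?case unfolding S_def n_def by simp
qed

text \<open>On \<open>(0, 1)\<close> each kernel \<open>1 / (s - a)\<close> has constant sign. Working with absolute values makes Tonelli's
  theorem available without any convergence condition; \<open>word_sign\<close> restores the sign.\<close>

definition abs_ker :: "real \<Rightarrow> letter \<Rightarrow> real \<Rightarrow> real" where
  "abs_ker z a s = (case a of E0 \<Rightarrow> 1 / s | E1 \<Rightarrow> 1 / (1 - s) | EZ \<Rightarrow> 1 / (z - s))"

lemma abs_ker_simps [simp]: "abs_ker z E0 s = 1 / s" "abs_ker z E1 s = 1 / (1 - s)"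
    "abs_ker z EZ s = 1 / (z - s)"
  by (simp_all add: abs_ker_def)

lemma borel_measurable_abs_ker [measurable]: "abs_ker z a \<in> borel_measurable borel"
  by (cases a) (simp_all add: abs_ker_def[abs_def])

lemma abs_ker_pos: "1 \<le> z \<Longrightarrow> 0 < s \<Longrightarrow> s < 1 \<Longrightarrow> 0 < abs_ker z a s"
  by (cases a) auto

definition abs_iint :: "real \<Rightarrow> word \<Rightarrow> real \<Rightarrow> ennreal" where
  "abs_iint z w t = iint_up (map (\<lambda>a s. ennreal (abs_ker z a s)) w) t"

lemma abs_iint_Nil [simp]: "abs_iint z [] t = 1"
  by (simp add: abs_iint_def)

lemma abs_iint_Cons:
  "abs_iint z (a # w) t = (\<integral>\<^sup>+s. ennreal (abs_ker z a s) * abs_iint z w s *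
    indicator {t<..<1} s \<partial>lborel)"
  by (simp add: abs_iint_def)

lemma borel_measurable_abs_iint [measurable]: "abs_iint z w \<in> borel_measurable borel"
  unfolding abs_iint_def[abs_def] by (rule borel_measurable_iint_up) auto

lemma abs_iint_shuffle: "(\<Sum>x\<leftarrow>shuffle_list u v. abs_iint z x t) = abs_iint z u t * abs_iint z v t"
  unfolding abs_iint_def by (rule iint_up_shuffle) auto

text \<open>The signed integral over t < t_1 < ... < t_m < 1; its value at t = 0 is L_z(w).\<close>

definition iint :: "real \<Rightarrow> word \<Rightarrow> real \<Rightarrow> real" where
  "iint z w t = word_sign w * enn2real (abs_iint z w t)"

lemma iint_Nil [simp]: "iint z [] t = 1"
  by (simp add: iint_def)

lemma word_sign_abs [simp]: "\<bar>word_sign w\<bar> = 1"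
  by (induction w) (auto simp: word_sign_Cons abs_mult)

lemma borel_measurable_iint [measurable]: "iint z w \<in> borel_measurable borel"
  unfolding iint_def[abs_def] by measurable

lemma word_sign_eq_prod: "word_sign w = (\<Prod>i<length w. if w ! i = E0 then 1 else - 1)"
  unfolding word_sign_def by (simp add: prod.list_conv_set_nth atLeast0LessThan)

text \<open>The integrand has constant sign, so the equation also covers divergent integrals: the
  Bochner integral and \<open>enn2real \<infinity>\<close> are then both 0. The parameter z is
  arbitrary because no kernel of e_z occurs.\<close>

lemma L_word_eq_iint:
  assumes w: "w \<in> lists {E0, E1}"
  shows "L_word w = iint z w 0"
proof (cases "w = []")
  case False
  define n where "n = length w"
  let ?M = "\<Pi>\<^sub>M i\<in>{..<n}. (lborel :: real measure)"
  define S where "S = {t :: nat \<Rightarrow> real. (\<forall>i<n. 0 < t i \<and> t i < 1) \<and> (\<forall>i j. i < j \<and> j < n \<longrightarrow> t i < t j)}"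
  define h where "h t = (\<Prod>i<n. abs_ker z (w ! i) (t i)) * indicator S t" for t
  have wi: "w ! i = E0 \<or> w ! i = E1" if "i < n" for i
    using w that nth_mem[of i w] by (auto simp: n_def)
  have kpn: "0 \<le> abs_ker z (w ! i) (t i)" if "t \<in> S" "i < n" for i t
    using wi[of i] that unfolding S_def by (auto simp: less_imp_le)
  have hpos: "0 \<le> h t" for t
    using kpn by (cases "t \<in> S") (auto simp: h_def intro!: prod_nonneg)
  have "(\<lambda>t. \<Prod>i<n. abs_ker z (w ! i) (t i)) \<in> borel_measurable ?M"
    by (intro borel_measurable_prod measurable_compose[OF measurable_component_singleton]) auto
  then have hm [measurable]: "h \<in> borel_measurable ?M"
    unfolding h_def S_def by measurable
  have "L_word w = (\<integral>t. indicator (simplex_set n) t *\<^sub>R (\<Prod>i<n. 1 / (t i - pole (w ! i))) \<partial>?M)"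
    using False by (simp add: L_word_def n_def set_lebesgue_integral_def)
  also have "\<dots> = (\<integral>t. word_sign w * h t \<partial>?M)"
  proof (intro Bochner_Integration.integral_cong refl)
    fix t assume "t \<in> space ?M"
    then have iff: "t \<in> simplex_set n \<longleftrightarrow> t \<in> S"
      by (auto simp: simplex_set_def S_def space_PiM)
    have "(\<Prod>i<n. 1 / (t i - pole (w ! i))) = word_sign w * (\<Prod>i<n. abs_ker z (w ! i) (t i))"
      unfolding word_sign_eq_prod n_def[symmetric] prod.distrib[symmetric]
    proof (intro prod.cong refl)
      fix i assume "i \<in> {..<n}"
      then show "1 / (t i - pole (w ! i)) = (if w ! i = E0 then 1 else - 1) * abs_ker z (w ! i) (t i)"
        using wi[of i] by (auto simp: divide_simps)
    qed
    then show "indicator (simplex_set n) t *\<^sub>R (\<Prod>i<n. 1 / (t i - pole (w ! i))) = word_sign w * h t"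
      using iff by (auto simp: h_def indicator_def)
  qed
  also have "\<dots> = word_sign w * enn2real (\<integral>\<^sup>+t. ennreal (h t) \<partial>?M)"
    using hpos by (simp add: integral_eq_nn_integral)
  also have "(\<integral>\<^sup>+t. ennreal (h t) \<partial>?M) = abs_iint z w 0"
  proof -
    let ?fs = "map (\<lambda>a s. ennreal (abs_ker z a s)) w"
    have fs: "set ?fs \<subseteq> borel_measurable borel" by auto
    have "(\<integral>\<^sup>+t. ennreal (h t) \<partial>?M) = (\<integral>\<^sup>+t. (\<Prod>i<n. (?fs ! i) (t i)) * indicator S t \<partial>?M)"
    proof (intro nn_integral_cong)
      fix t
      show "ennreal (h t) = (\<Prod>i<n. (?fs ! i) (t i)) * indicator S t"
        using kpn by (cases "t \<in> S") (auto simp: h_def n_def intro!: prod_ennreal[symmetric])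
    qed
    also have "\<dots> = iint_down (rev ?fs) 1"
      using nn_integral_simplex[OF fs, of 1] by (simp add: S_def n_def)
    also have "\<dots> = iint_up ?fs 0" by (rule iint_up_eq_iint_down_rev[symmetric]) auto
    finally show ?thesis by (simp add: abs_iint_def)
  qed
  finally show ?thesis by (simp add: iint_def)
qed (simp add: L_word_def)

text \<open>Here \<open>k'\<close> stands for the kernels pulled back by a substitution. Each e_1
  pulls back to a sum of two kernels, and expanding these sums letter by letter produces
  \<open>tau_list\<close>.\<close>

lemma iint_up_tau_list:
  fixes k k' :: "letter \<Rightarrow> real \<Rightarrow> ennreal"
  assumes k: "\<And>a. k a \<in> borel_measurable borel" "\<And>a. k' a \<in> borel_measurable borel"
    and EZ: "\<And>s. 0 < s \<Longrightarrow> s < 1 \<Longrightarrow> k' EZ s = k EZ s"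
    and E1: "\<And>s. 0 < s \<Longrightarrow> s < 1 \<Longrightarrow> k' E1 s = k EZ s + k E0 s"
    and w: "set w \<subseteq> {E1, EZ}" and t: "0 \<le> t"
  shows "iint_up (map k' w) t = (\<Sum>x\<leftarrow>tau_list w. iint_up (map k x) t)"
  using w t
proof (induction w arbitrary: t)
  case (Cons a w)
  have [measurable]: "(\<lambda>s. \<Sum>x\<leftarrow>xs. iint_up (map k x) s) \<in> borel_measurable borel" for xs
    by (induction xs) (auto intro!: borel_measurable_iint_up borel_measurable_add simp: k)
  note [measurable] = k
  have "iint_up (map k' (a # w)) t = (\<integral>\<^sup>+s. k' a s * (\<Sum>x\<leftarrow>tau_list w. iint_up (map k x) s) *
    indicator {t<..<1} s \<partial>lborel)"
    using Cons by (auto intro!: nn_integral_cong split: split_indicator)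
  also have "\<dots> = (\<Sum>x\<leftarrow>tau_list (a # w). iint_up (map k x) t)"
  proof (cases "a = E1")
    case True
    have "(\<integral>\<^sup>+s. k' a s * (\<Sum>x\<leftarrow>tau_list w. iint_up (map k x) s) * indicator {t<..<1} s \<partial>lborel)
       = (\<integral>\<^sup>+s. k EZ s * (\<Sum>x\<leftarrow>tau_list w. iint_up (map k x) s) * indicator {t<..<1} s
            + k E0 s * (\<Sum>x\<leftarrow>tau_list w. iint_up (map k x) s) * indicator {t<..<1} s \<partial>lborel)"
      using Cons.prems True E1
      by (auto intro!: nn_integral_cong split: split_indicator simp: distrib_right)
    also have "\<dots> = (\<integral>\<^sup>+s. k EZ s * (\<Sum>x\<leftarrow>tau_list w. iint_up (map k x) s) * indicator {t<..<1} s \<partial>lborel)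
        + (\<integral>\<^sup>+s. k E0 s * (\<Sum>x\<leftarrow>tau_list w. iint_up (map k x) s) * indicator {t<..<1} s \<partial>lborel)"
      by (rule nn_integral_add) measurable
    also have "\<dots> = (\<Sum>x\<leftarrow>tau_list (a # w). iint_up (map k x) t)"
      using True by (simp add: sum_list_iint_up_Cons[OF k(1) k(1), symmetric] o_def del: iint_up.simps)
    finally show ?thesis .
  next
    case False
    then have "a = EZ" using Cons.prems by auto
    then have "(\<integral>\<^sup>+s. k' a s * (\<Sum>x\<leftarrow>tau_list w. iint_up (map k x) s) * indicator {t<..<1} s \<partial>lborel)
       = (\<integral>\<^sup>+s. k EZ s * (\<Sum>x\<leftarrow>tau_list w. iint_up (map k x) s) * indicator {t<..<1} s \<partial>lborel)"
      using Cons.prems EZ by (auto intro!: nn_integral_cong split: split_indicator)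
    then show ?thesis
      using False by (simp add: sum_list_iint_up_Cons[OF k(1) k(1), symmetric] o_def del: iint_up.simps)
  qed
  finally show ?case .
qed simp

text \<open>\<open>g\<close> is the substitution t \<mapsto> z (1 - t) / (z - t) taken at t = 1 - s,
  so that it increases from 0 to 1. It pulls the kernel of e_z back to the kernel of e_z at 1 - s,
  and that of e_1 to the sum of the kernels of e_z and e_0 at 1 - s. Undoing the reflection
  exchanges the ends of the chain, hence \<open>rev x\<close>.\<close>

lemma abs_iint_tau_list:
  assumes z: "1 < z" and w: "set w \<subseteq> {E1, EZ}"
  shows "abs_iint z w 0 = (\<Sum>x\<leftarrow>tau_list w. abs_iint z (rev x) 0)"
proof -
  define g where "g s = z * s / (z - 1 + s)" for s :: real
  define g' where "g' s = z * (z - 1) / (z - 1 + s)^2" for s :: real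
  let ?k = "\<lambda>a s. ennreal (abs_ker z a s)"
  let ?kernel = "\<lambda>a s. ennreal (abs_ker z a (1 - s))"
  let ?kg = "\<lambda>a s. ennreal (abs_ker z a (g s)) * ennreal (g' s)"
  have [measurable]: "g \<in> borel_measurable borel" "g' \<in> borel_measurable borel"
    unfolding g_def[abs_def] g'_def[abs_def] by measurable
  have g01: "0 < g s" "g s < 1" if "0 < s" "s < 1" for s
  proof -
    show "0 < g s" using that z by (simp add: g_def)
    have "(z - 1) * s < (z - 1) * 1" using that z by (intro mult_strict_left_mono) auto
    then show "g s < 1" using that z by (simp add: g_def field_simps)
  qed
  have g'0: "0 \<le> g' s" for s using z by (simp add: g'_def)
  have kg: "?kg EZ s = ?kernel EZ s" "?kg E1 s = ?kernel EZ s + ?kernel E0 s" if s: "0 < s"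
    "s < 1" for s
  proof -
    define D where "D = z - 1 + s"
    have d: "D \<noteq> 0" "z \<noteq> 0" "z - 1 \<noteq> 0" "1 - s \<noteq> 0" using s z by (auto simp: D_def)
    have gs: "g s = z * s / D" and g's: "g' s = z * (z - 1) / (D * D)"
      by (simp_all add: g_def g'_def D_def power2_eq_square)
    have "z - g s = (z * D - z * s) / D" using d by (simp add: gs field_simps)
    also have "z * D - z * s = z * (z - 1)" by (simp add: D_def algebra_simps)
    finally have zg: "1 / (z - g s) = D / (z * (z - 1))" by simp
    have "abs_ker z EZ (g s) * g' s = 1 / D"
      unfolding abs_ker_simps zg g's using d
        by (simp only: times_divide_times_eq) (simp add: divide_simps)
    then have eq: "abs_ker z EZ (g s) * g' s = abs_ker z EZ (1 - s)" by (simp add: D_def algebra_simps)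
    have "1 - g s = (D - z * s) / D" using d by (simp add: gs field_simps)
    also have "D - z * s = (z - 1) * (1 - s)" by (simp add: D_def algebra_simps)
    finally have og: "1 / (1 - g s) = D / ((z - 1) * (1 - s))" by simp
    have "abs_ker z E1 (g s) * g' s = z / (D * (1 - s))"
      unfolding abs_ker_simps og g's using d
        by (simp only: times_divide_times_eq) (simp add: divide_simps)
    also have "z / (D * (1 - s)) = (D + (1 - s)) / (D * (1 - s))" by (simp add: D_def)
    also have "\<dots> = 1 / D + 1 / (1 - s)" using d by (simp add: divide_simps)
    finally have eq1: "abs_ker z E1 (g s) * g' s = abs_ker z EZ (1 - s) + abs_ker z E0 (1 - s)"
      by (simp add: D_def algebra_simps)
    show "?kg EZ s = ?kernel EZ s"
      using eq z g01[OF s] g'0[of s]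
        by (subst ennreal_mult[symmetric]) (auto intro!: less_imp_le[OF abs_ker_pos] simp del: abs_ker_simps)
    have "?kg E1 s = ennreal (abs_ker z EZ (1 - s) + abs_ker z E0 (1 - s))"
      using eq1 z g01[OF s] g'0[of s]
        by (subst ennreal_mult[symmetric]) (auto intro!: less_imp_le[OF abs_ker_pos] simp del: abs_ker_simps)
    also have "\<dots> = ?kernel EZ s + ?kernel E0 s"
      using z s by (intro ennreal_plus) auto
    finally show "?kg E1 s = ?kernel EZ s + ?kernel E0 s" .
  qed
  have "abs_iint z w 0 = iint_up (map ?k w) (g 0)" by (simp add: abs_iint_def g_def)
  also have "\<dots> = iint_up (map (\<lambda>f s. f (g s) * ennreal (g' s)) (map ?k w)) 0"
  proof (rule iint_up_substitution)
    fix x :: real assume x: "0 \<le> x" "x \<le> 1"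
    then show "(g has_real_derivative g' x) (at x)"
      unfolding g_def[abs_def] g'_def using z
      by (auto intro!: derivative_eq_intros simp: power2_eq_square algebra_simps)
  next
    show "continuous_on {0..1} g'"
      unfolding g'_def[abs_def] using z by (auto intro!: continuous_intros)
  qed (use z g'0 in \<open>auto simp: g_def\<close>)
  also have "\<dots> = iint_up (map ?kg w) 0" by (simp add: o_def)
  also have "\<dots> = (\<Sum>x\<leftarrow>tau_list w. iint_up (map ?kernel x) 0)"
    using kg w by (intro iint_up_tau_list) auto
  also have "\<dots> = (\<Sum>x\<leftarrow>tau_list w. abs_iint z (rev x) 0)"
  proof (intro arg_cong[where f = sum_list] map_cong refl)
    fix x
    have "iint_up (map ?kernel x) 0 = iint_up (map (\<lambda>f s. f (1 - s)) (map ?k x)) 0" by (simp add: o_def)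
    also have "\<dots> = iint_down (map ?k x) 1" by (subst iint_up_reflect) auto
    also have "\<dots> = iint_up (rev (map ?k x)) 0" by (subst iint_up_eq_iint_down_rev) auto
    finally show "iint_up (map ?kernel x) 0 = abs_iint z (rev x) 0" by (simp add: abs_iint_def rev_map)
  qed
  finally show ?thesis .
qed

section \<open>Growth at the end points\<close>

text \<open>One-sided limits replace values of F at the ends, where the integrand may be
  unbounded.\<close>

lemma nn_integral_FTC_open:
  fixes f F :: "real \<Rightarrow> real"
  assumes "a < b" and F: "\<And>x. a < x \<Longrightarrow> x < b \<Longrightarrow> (F has_real_derivative f x) (at x)"
    and f: "\<And>x. a < x \<Longrightarrow> x < b \<Longrightarrow> isCont f x" and pos: "\<And>x. a < x \<Longrightarrow> x < b \<Longrightarrow> 0 \<le> f x"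
    and A: "(F \<longlongrightarrow> A) (at_right a)" and B: "(F \<longlongrightarrow> B) (at_left b)"
  shows "(\<integral>\<^sup>+s. ennreal (f s) * indicator {a<..<b} s \<partial>lborel) = ennreal (B - A)"
proof -
  have A': "((F \<circ> real_of_ereal) \<longlongrightarrow> A) (at_right (ereal a))"
    and B': "((F \<circ> real_of_ereal) \<longlongrightarrow> B) (at_left (ereal b))"
    using A B by (simp_all add: ereal_tendsto_simps)
  note FTC = interval_integral_FTC_nonneg[of "ereal a" "ereal b" F f A B]
  have int: "set_integrable lborel {a<..<b} f" and eq: "(LBINT x=a..b. f x) = B - A"
    using FTC assms(1) F f pos A' B' by auto
  have "(\<integral>\<^sup>+s. ennreal (f s) * indicator {a<..<b} s \<partial>lborel)
      = (\<integral>\<^sup>+s. ennreal (indicator {a<..<b} s *\<^sub>R f s) \<partial>lborel)"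
    by (intro nn_integral_cong) (auto split: split_indicator)
  also have "\<dots> = ennreal (LINT s|lborel. indicator {a<..<b} s *\<^sub>R f s)"
    using int pos unfolding set_integrable_def
    by (intro nn_integral_eq_integral) (auto split: split_indicator)
  also have "(LINT s|lborel. indicator {a<..<b} s *\<^sub>R f s) = B - A"
    using eq assms(1) by (simp add: interval_lebesgue_integral_def set_lebesgue_integral_def)
  finally show ?thesis .
qed

text \<open>\<open>h = ebound e\<close> satisfies \<open>h' = - e h / (t (1 - t))\<close>, and every kernel is at most \<open>1 / (t (1 - t))\<close>.
  Hence a bound by a multiple of \<open>h\<close> survives integration against any of them.\<close>

definition ebound :: "real \<Rightarrow> real \<Rightarrow> real" where
  "ebound e t = ((1 - t) / t) powr e"

lemma ebound_nonneg [simp]: "0 \<le> ebound e t"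
  by (simp add: ebound_def)

lemma borel_measurable_ebound [measurable]: "ebound e \<in> borel_measurable borel"
  unfolding ebound_def[abs_def] by measurable

lemma ebound_eq: "0 < s \<Longrightarrow> s < 1 \<Longrightarrow> ebound e s = (1 - s) powr e * s powr (- e)"
  by (simp add: ebound_def powr_divide powr_minus field_simps)

lemma has_derivative_ebound:
  assumes "0 < s" "s < 1"
  shows "(ebound e has_real_derivative - e * (ebound e s / (s * (1 - s)))) (at s)"
proof -
  have "((\<lambda>s. ((1 - s) / s) powr e) has_real_derivative
      e * ((1 - s) / s) powr (e - of_nat 1) * (- 1 / s^2)) (at s)"
    using assms
      by (intro DERIV_fun_powr) (auto intro!: derivative_eq_intros simp: power2_eq_square field_simps)
  moreover have "((1 - s) / s) powr (e - of_nat 1) = ebound e s * (s / (1 - s))"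
    using assms by (simp add: ebound_def powr_diff)
  ultimately have "(ebound e has_real_derivative e * (ebound e s * (s / (1 - s))) * (- 1 / s^2)) (at s)"
    by (simp add: ebound_def[abs_def])
  moreover have "e * (ebound e s * (s / (1 - s))) * (- 1 / s^2) = - e * (ebound e s / (s * (1 - s)))"
    using assms by (simp add: power2_eq_square divide_simps)
  ultimately show ?thesis by simp
qed

text \<open>An antiderivative is - (D / e) \<open>ebound e\<close>, which vanishes at 1 because e >
  0. The factor 1 / e gained by each integration accounts for the powers of 1 / e in later
  bounds.\<close>

lemma nn_integral_ebound:
  assumes "0 < e" "0 < t" "t < 1" "0 \<le> D"
  shows "(\<integral>\<^sup>+s. ennreal (D * (ebound e s / (s * (1 - s)))) * indicator {t<..<1} s \<partial>lborel) =
    ennreal (D / e * ebound e t)"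
proof -
  have "(\<integral>\<^sup>+s. ennreal (D * (ebound e s / (s * (1 - s)))) * indicator {t<..<1} s \<partial>lborel)
      = ennreal (- (D / e) * 0 - (- (D / e) * ebound e t))"
  proof (rule nn_integral_FTC_open[where F = "\<lambda>s. - (D / e) * ebound e s"])
    fix x assume x: "t < x" "x < 1"
    have "((\<lambda>s. - (D / e) * ebound e s) has_real_derivative
        - (D / e) * (- e * (ebound e x / (x * (1 - x))))) (at x)"
      using x assms by (intro DERIV_cmult has_derivative_ebound) auto
    then show "((\<lambda>s. - (D / e) * ebound e s) has_real_derivative D * (ebound e x / (x * (1 -
      x)))) (at x)"
      using assms by simp
    have "isCont (ebound e) x" using has_derivative_ebound[of x e] x assms DERIV_isCont by auto
    then show "isCont (\<lambda>s. D * (ebound e s / (s * (1 - s)))) x"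
      using x assms by (intro continuous_intros) auto
    show "0 \<le> D * (ebound e x / (x * (1 - x)))" using x assms by simp
  next
    have "isCont (ebound e) t" using has_derivative_ebound[of t e] assms DERIV_isCont by auto
    then have "(ebound e \<longlongrightarrow> ebound e t) (at_right t)"
      using continuous_at_imp_continuous_at_within continuous_within by blast
    then show "((\<lambda>s. - (D / e) * ebound e s) \<longlongrightarrow> - (D / e) * ebound e t) (at_right t)"
      by (intro tendsto_intros)
    have "((\<lambda>s::real. (1 - s) / s) \<longlongrightarrow> (1 - 1) / 1) (at_left 1)"
      by (intro tendsto_intros) auto
    moreover have "\<forall>\<^sub>F s::real in at_left 1. 0 \<le> (1 - s) / s"
      using eventually_at_left_real[of 0 1] by (auto elim!: eventually_mono)
    ultimately have "(ebound e \<longlongrightarrow> 0) (at_left 1)"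
      unfolding ebound_def[abs_def] using assms by (intro tendsto_zero_powrI[where b = e]) auto
    then show "((\<lambda>s. - (D / e) * ebound e s) \<longlongrightarrow> - (D / e) * 0) (at_left 1)"
      by (intro tendsto_intros)
  qed (use assms in auto)
  then show ?thesis by simp
qed

text \<open>On either half of (0, 1) one of the two factors is at most 2, since its base is at least
  1/2.\<close>

lemma beta_integrand_le:
  assumes "0 < p" "p < 1" "0 < q" "q < 1" "0 < s" "s < (1::real)"
  shows "s powr (- p) * (1 - s) powr (- q) \<le> 2 * s powr (- p) + 2 * (1 - s) powr (- q)"
proof -
  have half: "x powr (- r) \<le> 2" if "1/2 \<le> x" "x < 1" "0 < r" "r < 1" for x r :: real
  proof -
    have "x powr (- r) \<le> (1/2) powr (- r)" using that by (intro powr_mono2') auto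
    also have "\<dots> = 2 powr r" by (simp add: powr_minus_divide powr_divide)
    also have "\<dots> \<le> 2 powr 1" using that by (intro powr_mono) auto
    finally show ?thesis by simp
  qed
  show ?thesis
  proof (cases "s \<le> 1/2")
    case True
    then have "s powr (- p) * (1 - s) powr (- q) \<le> s powr (- p) * 2"
      using assms by (intro mult_left_mono half) auto
    then show ?thesis using powr_ge_zero[of "1 - s" "- q"] by linarith
  next
    case False
    then have "s powr (- p) * (1 - s) powr (- q) \<le> 2 * (1 - s) powr (- q)"
      using assms by (intro mult_right_mono half) auto
    then show ?thesis using powr_ge_zero[of s "- p"] by linarith
  qed
qed

lemma nn_integral_beta_le:
  assumes p: "0 < p" "p < 1" and q: "0 < q" "q < 1" and D: "0 \<le> D"
  shows "(\<integral>\<^sup>+s. ennreal (D * (s powr (- p) * (1 - s) powr (- q))) * indicator {0<..<1} s \<partial>lborel)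
    \<le> ennreal (D * (2 / (1 - p) + 2 / (1 - q)))"
proof -
  let ?f = "\<lambda>s::real. D * (2 * s powr (- p) + 2 * (1 - s) powr (- q))"
  let ?F = "\<lambda>s::real. D * (2 / (1 - p) * s powr (1 - p) - 2 / (1 - q) * (1 - s) powr (1 - q))"
  have "(\<integral>\<^sup>+s. ennreal (D * (s powr (- p) * (1 - s) powr (- q))) * indicator {0<..<1} s \<partial>lborel)
      \<le> (\<integral>\<^sup>+s. ennreal (?f s) * indicator {0<..<1} s \<partial>lborel)"
    using beta_integrand_le[OF p q] D
    by (intro nn_integral_mono) (auto split: split_indicator intro!: ennreal_leI mult_left_mono)
  also have "\<dots> = ennreal (D * (2 / (1 - p) * 1 - 2 / (1 - q) * 0) - D * (2 / (1 - p) * 0 -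
    2 / (1 - q) * 1))"
  proof (rule nn_integral_FTC_open[where F = ?F])
    fix x :: real assume x: "0 < x" "x < 1"
    have 1: "((\<lambda>s. s powr (1 - p)) has_real_derivative (1 - p) * x powr (- p)) (at x)"
      using x has_real_derivative_powr[of x "1 - p"] by simp
    have 2: "((\<lambda>s. (1 - s) powr (1 - q)) has_real_derivative (1 - q) * (1 - x) powr (1 - q -
      of_nat 1) * (- 1)) (at x)"
      using x by (intro DERIV_fun_powr) (auto intro!: derivative_eq_intros)
    have "(?F has_real_derivative D * (2 / (1 - p) * ((1 - p) * x powr (- p))
        - 2 / (1 - q) * ((1 - q) * (1 - x) powr (1 - q - of_nat 1) * (- 1)))) (at x)"
      by (intro DERIV_cmult DERIV_diff 1 2)
    then show "(?F has_real_derivative ?f x) (at x)"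
      using p q by simp
    show "isCont ?f x" using x by (intro continuous_intros) auto
    show "0 \<le> ?f x" using D by (intro mult_nonneg_nonneg add_nonneg_nonneg) auto
  next
    have z: "((\<lambda>s::real. s powr (1 - p)) \<longlongrightarrow> 0) (at_right 0)"
      using p by (intro tendsto_zero_powrI[where b = "1 -
        p"]) (auto simp: eventually_at_right_less intro: eventually_mono[OF eventually_at_right_less])
    have o: "((\<lambda>s::real. s powr (1 - p)) \<longlongrightarrow> 1) (at_left 1)"
      by (auto intro!: tendsto_eq_intros)
    have "((\<lambda>s::real. 1 - s) \<longlongrightarrow> 0) (at_left 1)" by (auto intro!: tendsto_eq_intros)
    then have z': "((\<lambda>s::real. (1 - s) powr (1 - q)) \<longlongrightarrow> 0) (at_left 1)"
      using q by (intro tendsto_zero_powrI[where b = "1 - q"])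
        (auto intro: eventually_mono[OF eventually_at_left_real[of 0 1]])
    have o': "((\<lambda>s::real. (1 - s) powr (1 - q)) \<longlongrightarrow> 1) (at_right 0)"
      by (auto intro!: tendsto_eq_intros)
    show "(?F \<longlongrightarrow> D * (2 / (1 - p) * 0 - 2 / (1 - q) * 1)) (at_right 0)"
      by (intro tendsto_mult tendsto_diff tendsto_const z o')
    show "(?F \<longlongrightarrow> D * (2 / (1 - p) * 1 - 2 / (1 - q) * 0)) (at_left 1)"
      by (intro tendsto_mult tendsto_diff tendsto_const z' o)
  qed auto
  finally show ?thesis by (simp add: algebra_simps)
qed

text \<open>Only e_0 has a pole at 0; the second bound serves for integration down to t = 0.\<close>

lemma abs_ker_le:
  assumes "1 \<le> z" "0 < s" "s < 1"
  shows "abs_ker z a s \<le> 1 / (s * (1 - s))" "a \<noteq> E0 \<Longrightarrow> abs_ker z a s \<le> 1 / (1 - s)"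
proof -
  have 1: "1 / s \<le> 1 / (s * (1 - s))" "1 / (1 - s) \<le> 1 / (s * (1 - s))"
    using assms by (auto simp: divide_simps)
  have 2: "1 / (z - s) \<le> 1 / (1 - s)"
    using assms by (intro divide_left_mono) auto
  show "abs_ker z a s \<le> 1 / (s * (1 - s))" using 1 2 by (cases a) auto
  show "abs_ker z a s \<le> 1 / (1 - s)" if "a \<noteq> E0" using 2 that by (cases a) auto
qed

text \<open>This starts the inductions on length: a kernel without pole at 1 becomes comparable with
  \<open>ebound e s / (s * (1 - s))\<close>.\<close>

lemma one_minus_le_ebound:
  assumes "0 < e" "e \<le> 1" "0 < s" "s < 1"
  shows "1 - s \<le> ebound e s"
proof -
  have "(1 - s) * 1 \<le> (1 - s) powr e * s powr (- e)"
  proof (intro mult_mono)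
    show "1 - s \<le> (1 - s) powr e"
      using powr_mono'[of e 1 "1 - s"] assms by simp
    show "1 \<le> s powr (- e)"
      using powr_mono2'[of "- e" s 1] assms by simp
  qed (use assms in auto)
  then show ?thesis using assms by (simp add: ebound_eq)
qed

lemma abs_iint_Cons_le:
  assumes "0 < e" "0 < t" "t < 1" "0 \<le> D"
    and "\<And>s. t < s \<Longrightarrow> s < 1 \<Longrightarrow> ennreal (abs_ker z a s) * abs_iint z w s \<le> ennreal (D *
      (ebound e s / (s * (1 - s))))"
  shows "abs_iint z (a # w) t \<le> ennreal (D / e * ebound e t)"
proof -
  have "abs_iint z (a # w) t \<le> (\<integral>\<^sup>+s. ennreal (D * (ebound e s / (s * (1 - s)))) *
    indicator {t<..<1} s \<partial>lborel)"
    unfolding abs_iint_Cons using assms(5) by (intro nn_integral_mono) (auto split: split_indicator)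
  also have "\<dots> = ennreal (D / e * ebound e t)"
    using assms by (intro nn_integral_ebound) auto
  finally show ?thesis .
qed

text \<open>The constant is set by the last letter, since every further kernel is at most 1 / (s (1
  - s)) and only contributes 1 / e. For last letter e_0 one can take C = 1 for all z \<ge> 1, so the
  bound stays uniform as z tends to 1; for e_z it must absorb 1 / (z - 1).\<close>

lemma abs_iint_bound:
  assumes z: "1 \<le> z" and e: "0 < e" "e \<le> 1" and t: "0 < t" "t < 1" and w: "w \<noteq> []" "last w \<noteq> E1"
    and C: "0 \<le> C" "last w = E0 \<Longrightarrow> 1 \<le> C" "last w = EZ \<Longrightarrow> 1 < z \<and> 1 / (z - 1) \<le> C"
  shows "abs_iint z w t \<le> ennreal (C * (1 / e) ^ length w * ebound e t)"
  using w C t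
proof (induction w arbitrary: t)
  case (Cons a w)
  let ?D = "C * (1 / e) ^ length w"
  have "abs_iint z (a # w) t \<le> ennreal (?D / e * ebound e t)"
  proof (rule abs_iint_Cons_le)
    fix s assume s: "t < s" "s < 1"
    show "ennreal (abs_ker z a s) * abs_iint z w s \<le> ennreal (?D * (ebound e s / (s * (1 - s))))"
    proof (cases "w = []")
      case True
      have H: "1 \<le> ebound e s / (1 - s)" using one_minus_le_ebound[of e s] e s Cons.prems by simp
      have "abs_ker z a s \<le> C * (ebound e s / (s * (1 - s)))"
      proof (cases a)
        case E0
        have "1 / s * 1 \<le> 1 / s * (C * (ebound e s / (1 - s)))"
          using mult_mono[of 1 C 1 "ebound e s / (1 - s)"] H E0 True Cons.prems s
          by (intro mult_left_mono) auto
        then show ?thesis using E0 by simp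
      next
        case EZ
        then have "1 < z" "1 / (z - 1) \<le> C" using Cons.prems True by auto
        moreover have "1 / (z - s) \<le> 1 / (z - 1)"
          using \<open>1 < z\<close> s by (intro divide_left_mono) auto
        moreover have "C * 1 \<le> C * (ebound e s / (s * (1 - s)))"
        proof (intro mult_left_mono)
          have "1 * 1 \<le> (1 / s) * (ebound e s / (1 - s))"
            using H s Cons.prems by (intro mult_mono) auto
          then show "1 \<le> ebound e s / (s * (1 - s))" by simp
        qed (use Cons.prems in auto)
        ultimately show ?thesis using EZ by simp
      qed (use True Cons.prems in auto)
      then show ?thesis using True by (auto intro!: ennreal_leI)
    next
      case False
      then have "abs_iint z w s \<le> ennreal (?D * ebound e s)"
        using Cons.prems s by (intro Cons.IH) auto
      then have "ennreal (abs_ker z a s) * abs_iint z w s \<le> ennreal (1 / (s * (1 - s))) *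
        ennreal (?D * ebound e s)"
        using abs_ker_le(1)[of z s a] z s Cons.prems by (intro mult_mono ennreal_leI) auto
      also have "\<dots> = ennreal (1 / (s * (1 - s)) * (?D * ebound e s))"
        using s Cons.prems e by (intro ennreal_mult[symmetric]) auto
      finally show ?thesis by (simp add: mult_ac)
    qed
  qed (use e Cons.prems in auto)
  then show ?case by (simp add: mult_ac)
qed simp

text \<open>The decay for large z is earned by the last e_z of the word, whose kernel is at most 1 /
  (z - 1), while the letters behind it are bounded independently of z. Integration over the letters
  before it keeps the factor.\<close>

lemma abs_iint_bound_EZ:
  assumes z: "2 \<le> z" and e: "0 < e" "e \<le> 1" and t: "0 < t" "t < 1" and w: "EZ \<in> set w" "last w \<noteq> E1"
  shows "abs_iint z w t \<le> ennreal (1 / (z - 1) * (1 / e) ^ length w * ebound e t)"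
  using w t
proof (induction w arbitrary: t)
  case (Cons a w)
  show ?case
  proof (cases "last (a # w) = EZ")
    case True
    then show ?thesis using z e Cons.prems by (intro abs_iint_bound) auto
  next
    case False
    with Cons.prems have "last (a # w) = E0" by (cases "last (a # w)") auto
    with Cons.prems have w: "w \<noteq> []" "last w = E0" by (auto split: if_splits)
    let ?D = "1 / (z - 1) * (1 / e) ^ length w"
    have "abs_iint z (a # w) t \<le> ennreal (?D / e * ebound e t)"
    proof (rule abs_iint_Cons_le)
      fix s assume s: "t < s" "s < 1"
      show "ennreal (abs_ker z a s) * abs_iint z w s \<le> ennreal (?D * (ebound e s / (s * (1 - s))))"
      proof (cases "EZ \<in> set w")
        case True
        then have "abs_iint z w s \<le> ennreal (?D * ebound e s)"
          using Cons.prems s w by (intro Cons.IH) auto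
        then have "ennreal (abs_ker z a s) * abs_iint z w s \<le> ennreal (1 / (s * (1 - s))) *
          ennreal (?D * ebound e s)"
          using abs_ker_le(1)[of z s a] z s Cons.prems by (intro mult_mono ennreal_leI) auto
        also have "\<dots> = ennreal (1 / (s * (1 - s)) * (?D * ebound e s))"
          using s Cons.prems e z by (intro ennreal_mult[symmetric]) auto
        finally show ?thesis by (simp add: mult_ac)
      next
        case False
        with Cons.prems have a: "a = EZ" by auto
        have iint: "abs_iint z w s \<le> ennreal (1 * (1 / e) ^ length w * ebound e s)"
          using z e Cons.prems s w by (intro abs_iint_bound) auto
        have "abs_ker z a s \<le> 1 / (z - 1) * 1"
          using a z s by (simp add: frac_le)
        also have "\<dots> \<le> 1 / (z - 1) * (1 / (s * (1 - s)))"
          using s Cons.prems z mult_mono[of s 1 "1 - s" 1]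
            by (intro mult_left_mono) (auto simp: divide_simps)
        finally have "ennreal (abs_ker z a s) * abs_iint z w s
            \<le> ennreal (1 / (z - 1) * (1 / (s * (1 - s)))) * ennreal (1 * (1 / e) ^ length w * ebound e s)"
          using iint by (intro mult_mono ennreal_leI) auto
        also have "\<dots> = ennreal (1 / (z - 1) * (1 / (s * (1 - s))) * (1 * (1 / e) ^ length w *
          ebound e s))"
          using s Cons.prems e z by (intro ennreal_mult[symmetric]) auto
        finally show ?thesis by (simp add: mult_ac)
      qed
    qed (use e Cons.prems z in auto)
    then show ?thesis by (simp add: mult_ac)
  qed
qed simp

lemma ebound_over_eq: "0 < s \<Longrightarrow> s < 1 \<Longrightarrow> ebound e s / (1 - s) = s powr (- e) * (1 - s) powr (- (1 - e))"
  by (simp add: ebound_eq powr_diff)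

text \<open>The majorant of \<open>w\<close> is unbounded near 0, so t = 0 needs its own estimate. A
  first letter other than e_0 has a kernel of at most 1 / (1 - s), and the integrand is dominated by
  s^(-e) (1 - s)^(e - 1), which is integrable for 0 < e < 1.\<close>

lemma abs_iint_0_bound:
  assumes z: "1 \<le> z" and e: "0 < e" "e < 1" and a: "a \<noteq> E0" and C: "0 \<le> C"
    and w: "\<And>s. 0 < s \<Longrightarrow> s < 1 \<Longrightarrow> abs_iint z w s \<le> ennreal (C * ebound e s)"
  shows "abs_iint z (a # w) 0 \<le> ennreal (C * (2 / (1 - e) + 2 / e))"
proof -
  have "abs_iint z (a # w) 0
      \<le> (\<integral>\<^sup>+s. ennreal (C * (s powr (- e) * (1 - s) powr (- (1 - e)))) * indicator {0<..<1} s \<partial>lborel)"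
    unfolding abs_iint_Cons
  proof (intro nn_integral_mono)
    fix s :: real
    show "ennreal (abs_ker z a s) * abs_iint z w s * indicator {0<..<1} s
        \<le> ennreal (C * (s powr (- e) * (1 - s) powr (- (1 - e)))) * indicator {0<..<1} s"
    proof (cases "0 < s \<and> s < 1")
      case True
      have "ennreal (abs_ker z a s) * abs_iint z w s \<le> ennreal (1 / (1 - s)) * ennreal (C * ebound e s)"
        using abs_ker_le(2)[of z s a] z a True w[of s] by (intro mult_mono ennreal_leI) auto
      also have "\<dots> = ennreal (1 / (1 - s) * (C * ebound e s))"
        using True C by (intro ennreal_mult[symmetric]) auto
      also have "1 / (1 - s) * (C * ebound e s) = C * (ebound e s / (1 - s))" by simp
      finally show ?thesis using True by (simp add: ebound_over_eq)
    qed auto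
  qed
  also have "\<dots> \<le> ennreal (C * (2 / (1 - e) + 2 / (1 - (1 - e))))"
    using e C by (intro nn_integral_beta_le) auto
  finally show ?thesis by simp
qed

text \<open>Without convergence, \<open>iint\<close> has the junk value 0, from \<open>enn2real \<infinity>\<close>.\<close>

definition conv1 :: "real \<Rightarrow> word \<Rightarrow> bool" where
  "conv1 z w \<longleftrightarrow> 1 \<le> z \<and> (w = [] \<or> last w = E0 \<or> (last w = EZ \<and> 1 < z))"

text \<open>\<open>conv1\<close> is the condition at the upper end, where e_z behaves like e_1 when
  z = 1. Added here is the condition at the lower end, which concerns only t = 0.\<close>

definition converges :: "real \<Rightarrow> word \<Rightarrow> real \<Rightarrow> bool" where
  "converges z w t \<longleftrightarrow> conv1 z w \<and> t < 1 \<and> (0 < t \<or> (t = 0 \<and> (w = [] \<or> hd w \<noteq> E0)))"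

lemma conv1_abs_iint_bound:
  assumes "conv1 z w" "w \<noteq> []" "0 < e" "e \<le> 1" "0 < t" "t < 1"
  shows "abs_iint z w t \<le> ennreal (max 1 (1 / (z - 1)) * (1 / e) ^ length w * ebound e t)"
  using assms unfolding conv1_def by (intro abs_iint_bound) auto

lemma converges_abs_iint_finite:
  assumes "converges z w t"
  shows "abs_iint z w t < \<infinity>"
proof (cases "w = []")
  case False
  then obtain a v where w: "w = a # v" by (cases w) auto
  show ?thesis
  proof (cases "0 < t")
    case True
    then have "abs_iint z w t \<le> ennreal (max 1 (1 / (z - 1)) * (1 / (1/2)) ^ length w * ebound (1/2) t)"
      using assms False unfolding converges_def by (intro conv1_abs_iint_bound) auto
    then show ?thesis by (rule le_less_trans) simp
  next
    case F: False
    then have t: "t = 0" "a \<noteq> E0" "conv1 z w" using assms w by (auto simp: converges_def)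
    show ?thesis
    proof (cases "v = []")
      case True
      then have "a = EZ" "1 < z" using t w by (auto simp: conv1_def)
      then have "abs_iint z w t \<le> (\<integral>\<^sup>+s. ennreal (1 / (z - 1)) * indicator {0<..<1::real} s \<partial>lborel)"
        unfolding w abs_iint_Cons using True t
        by (intro nn_integral_mono) (auto split: split_indicator intro!: ennreal_leI frac_le)
      also have "\<dots> < \<infinity>" by (simp add: nn_integral_cmult ennreal_mult_less_top)
      finally show ?thesis .
    next
      case False
      then have v: "conv1 z v" using t w by (simp add: conv1_def)
      have "abs_iint z (a # v) 0 \<le> ennreal ((max 1 (1 / (z - 1)) * (1 / (1/2)) ^ length v) *
        (2 / (1 - 1/2) + 2 / (1/2)))"
      proof (rule abs_iint_0_bound)
        fix s :: real assume "0 < s" "s < 1"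
        then show "abs_iint z v s \<le> ennreal (max 1 (1 / (z - 1)) * (1 / (1/2)) ^ length v *
          ebound (1/2) s)"
          using v False by (intro conv1_abs_iint_bound) auto
      qed (use t in \<open>auto simp: conv1_def\<close>)
      then show ?thesis unfolding w t by (rule le_less_trans) simp
    qed
  qed
qed simp

section \<open>Signed kernels and signed integrals\<close>

definition kernel :: "real \<Rightarrow> letter \<Rightarrow> real \<Rightarrow> real" where
  "kernel z a s = (if a = E0 then 1 else - 1) * abs_ker z a s"

lemma kernel_simps [simp]: "kernel z E0 s = 1 / s" "kernel z E1 s = - 1 / (1 - s)"
    "kernel z EZ s = - 1 / (z - s)"
  by (simp_all add: kernel_def)

lemma borel_measurable_kernel [measurable]: "kernel z a \<in> borel_measurable borel"
  unfolding kernel_def[abs_def] by measurable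

lemma abs_kernel: "1 \<le> z \<Longrightarrow> 0 < s \<Longrightarrow> s < 1 \<Longrightarrow> \<bar>kernel z a s\<bar> = abs_ker z a s"
  using abs_ker_pos[of z s a] by (simp add: kernel_def abs_mult)

lemma conv1_Cons: "conv1 z (a # w) \<Longrightarrow> conv1 z w"
  by (auto simp: conv1_def split: if_splits)

lemma conv1_conv: "conv1 z w \<Longrightarrow> 0 < t \<Longrightarrow> t < 1 \<Longrightarrow> converges z w t"
  by (simp add: converges_def)

text \<open>The integrand has the constant sign \<open>word_sign w\<close>, so identities obtained
  by Tonelli's theorem carry over to signed integrals. Finiteness of \<open>abs_iint z w s\<close>
  is needed only at points s > t \<ge> 0, where the condition at the upper end suffices.\<close>

lemma ennreal_integral_iint:
  assumes w: "conv1 z w" and t: "0 \<le> t" and g [measurable]: "g \<in> borel_measurable borel"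
    and pos: "\<And>s. t < s \<Longrightarrow> s < 1 \<Longrightarrow> 0 \<le> g s"
  shows "(LINT s:{t<..<1}|lborel. g s * iint z w s)
      = word_sign w * enn2real (\<integral>\<^sup>+s. ennreal (g s) * abs_iint z w s * indicator {t<..<1} s \<partial>lborel)"
    and "(\<integral>\<^sup>+s. ennreal (g s) * abs_iint z w s * indicator {t<..<1} s \<partial>lborel) < \<infinity> \<Longrightarrow>
      set_integrable lborel {t<..<1} (\<lambda>s. g s * iint z w s)"
proof -
  define p where "p s = indicator {t<..<1} s * (g s * enn2real (abs_iint z w s))" for s
  have [measurable]: "p \<in> borel_measurable borel" unfolding p_def by measurable
  have p0: "0 \<le> p s" for s using pos by (auto simp: p_def indicator_def)
  have eq: "indicator {t<..<1} s *\<^sub>R (g s * iint z w s) = word_sign w * p s" for s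
    by (simp add: p_def iint_def)
  have "ennreal (p s) = ennreal (g s) * abs_iint z w s * indicator {t<..<1} s" for s
  proof (cases "t < s \<and> s < 1")
    case True
    then have "abs_iint z w s < \<infinity>" using w t by (intro converges_abs_iint_finite conv1_conv) auto
    then show ?thesis using True pos by (simp add: p_def ennreal_mult)
  qed (auto simp: p_def)
  then have nn: "(\<integral>\<^sup>+s. ennreal (p s) \<partial>lborel)
      = (\<integral>\<^sup>+s. ennreal (g s) * abs_iint z w s * indicator {t<..<1} s \<partial>lborel)" by simp
  show "(LINT s:{t<..<1}|lborel. g s * iint z w s)
      = word_sign w * enn2real (\<integral>\<^sup>+s. ennreal (g s) * abs_iint z w s * indicator {t<..<1} s \<partial>lborel)"
    unfolding set_lebesgue_integral_def eq nn[symmetric] using p0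
    by (simp add: integral_eq_nn_integral)
  show "set_integrable lborel {t<..<1} (\<lambda>s. g s * iint z w s)"
    if "(\<integral>\<^sup>+s. ennreal (g s) * abs_iint z w s * indicator {t<..<1} s \<partial>lborel) < \<infinity>"
    unfolding set_integrable_def eq using that p0 nn
    by (intro integrable_mult_right integrableI_nonneg) auto
qed

lemma iint_Cons:
  assumes "conv1 z w" "0 \<le> t"
  shows "iint z (a # w) t = (LINT s:{t<..<1}|lborel. kernel z a s * iint z w s)"
proof -
  have z: "1 \<le> z" using assms by (simp add: conv1_def)
  let ?c = "if a = E0 then 1 else - 1 :: real"
  have "(LINT s:{t<..<1}|lborel. kernel z a s * iint z w s) = ?c *
    (LINT s:{t<..<1}|lborel. abs_ker z a s * iint z w s)"
    unfolding kernel_def by (simp only: mult.assoc set_integral_mult_right)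
  also have "(LINT s:{t<..<1}|lborel. abs_ker z a s * iint z w s)
     = word_sign w * enn2real (\<integral>\<^sup>+s. ennreal (abs_ker z a s) * abs_iint z w s * indicator {t<..<1} s \<partial>lborel)"
    using assms z by (intro ennreal_integral_iint) (auto intro!: less_imp_le abs_ker_pos)
  finally show ?thesis by (simp add: iint_def abs_iint_Cons word_sign_Cons)
qed

lemma set_integrable_iint_Cons:
  assumes "converges z (a # w) t"
  shows "set_integrable lborel {t<..<1} (\<lambda>s. kernel z a s * iint z w s)"
proof -
  have z: "1 \<le> z" and t: "0 \<le> t" and w: "conv1 z w"
    using assms conv1_Cons by (auto simp: converges_def conv1_def)
  have "set_integrable lborel {t<..<1} (\<lambda>s. abs_ker z a s * iint z w s)"
    using assms z t w converges_abs_iint_finite[OF assms]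
    by (intro ennreal_integral_iint) (auto intro!: less_imp_le abs_ker_pos simp: abs_iint_Cons)
  then have "set_integrable lborel {t<..<1} (\<lambda>s. (if a = E0 then 1 else - 1) * (abs_ker z a s *
    iint z w s))"
    by (rule set_integrable_mult_right)
  then show ?thesis by (simp add: kernel_def mult.assoc)
qed

lemma abs_iint_le:
  assumes "abs_iint z w t \<le> ennreal C" "0 \<le> C"
  shows "\<bar>iint z w t\<bar> \<le> C"
  using assms by (simp add: iint_def abs_mult enn2real_leI)

lemma abs_iint_le_ebound:
  assumes "conv1 z w" "w \<noteq> []" "0 < e" "e \<le> 1" "0 < t" "t < 1" "1 \<le> M" "last w = EZ \<Longrightarrow> 1 / (z - 1) \<le> M"
  shows "\<bar>iint z w t\<bar> \<le> M * (1 / e) ^ length w * ebound e t"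
  using assms unfolding conv1_def by (intro abs_iint_le abs_iint_bound) auto

lemma sum_list_enn2real:
  "sum_list (map f xs) < (\<infinity> :: ennreal) \<Longrightarrow> enn2real (sum_list (map f xs)) = (\<Sum>x\<leftarrow>xs. enn2real (f x))"
  by (induction xs) (auto simp: enn2real_plus)

text \<open>All shuffles of u and v have the same sign, so the relation for absolute values
  transfers. Convergence enters because \<open>enn2real\<close> is additive only on finite
  values.\<close>

lemma iint_shuffle:
  assumes "converges z u t" "converges z v t"
  shows "lin (\<lambda>x. iint z x t) (shuffle_word u v) = iint z u t * iint z v t"
proof -
  have fin: "abs_iint z u t * abs_iint z v t < \<infinity>"
    using assms converges_abs_iint_finite by (auto simp: ennreal_mult_less_top)
  have "lin (\<lambda>x. iint z x t) (shuffle_word u v) = (\<Sum>x\<leftarrow>shuffle_list u v. iint z x t)"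
    by (simp add: shuffle_word_eq_sum_list lin_sum_list)
  also have "\<dots> = (\<Sum>x\<leftarrow>shuffle_list u v. word_sign u * word_sign v * enn2real (abs_iint z x t))"
    by (intro arg_cong[where f = sum_list] map_cong refl)
       (auto simp: iint_def set_shuffle_list word_sign_shuffles)
  also have "\<dots> = word_sign u * word_sign v * enn2real (\<Sum>x\<leftarrow>shuffle_list u v. abs_iint z x t)"
    using fin by (subst sum_list_enn2real) (auto simp: abs_iint_shuffle sum_list_const_mult)
  finally show ?thesis by (simp add: abs_iint_shuffle iint_def enn2real_mult)
qed

lemma iint_tau_z:
  assumes z: "1 < z" and v: "v \<in> words_z0 \<inter> lists {E1, EZ}"
  shows "lin (\<lambda>x. iint z x 0) (tau_z (frag_of v)) = iint z v 0"
proof -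
  have "v = [] \<or> last v \<in> {E1, EZ}" using v by (metis IntD2 in_listsD last_in_set)
  then have "v = [] \<or> last v = EZ" using v by (auto simp: words_z0_iff)
  moreover have "v = [] \<or> hd v \<noteq> E0" using v by (auto simp: words_z0_iff)
  ultimately have converges: "converges z v 0" using z by (auto simp: converges_def conv1_def)
  have set: "set v \<subseteq> {E1, EZ}" using v by auto
  have fin: "(\<Sum>x\<leftarrow>tau_list v. abs_iint z (rev x) 0) < \<infinity>"
    using converges_abs_iint_finite[OF converges] abs_iint_tau_list[OF z set] by simp
  have "lin (\<lambda>x. iint z x 0) (tau_z (frag_of v)) = word_sign v *
    (\<Sum>x\<leftarrow>tau_list v. enn2real (abs_iint z (rev x) 0))"
    unfolding iint_def using v by (intro lin_tau_z) auto
  also have "\<dots> = iint z v 0"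
    using fin by (simp add: iint_def abs_iint_tau_list[OF z set] sum_list_enn2real)
  finally show ?thesis .
qed

lemma abs_set_integral_le:
  fixes f B :: "real \<Rightarrow> real"
  assumes f: "set_integrable lborel S f" and B: "\<And>s. s \<in> S \<Longrightarrow> \<bar>f s\<bar> \<le> B s"
    and V: "(\<integral>\<^sup>+s. ennreal (B s) * indicator S s \<partial>lborel) \<le> ennreal V" "0 \<le> V"
  shows "\<bar>LINT s:S|lborel. f s\<bar> \<le> V"
proof -
  have "ennreal \<bar>LINT s:S|lborel. f s\<bar> \<le> (\<integral>\<^sup>+s. norm (indicator S s *\<^sub>R f s) \<partial>lborel)"
    using integral_norm_bound_ennreal[OF f[unfolded set_integrable_def]]
    by (simp add: set_lebesgue_integral_def)
  also have "\<dots> \<le> (\<integral>\<^sup>+s. ennreal (B s) * indicator S s \<partial>lborel)"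
    using B by (intro nn_integral_mono) (auto split: split_indicator intro!: ennreal_leI)
  finally show ?thesis using V by (metis ennreal_le_iff order_trans)
qed

subsection \<open>The limit at one\<close>

text \<open>For e_z the difference is x / (1 - s) with x = (z - 1) / (z - s) \<le> 1. Replacing x by
  the larger x^(1/4) trades most of the factor z - 1 for a pole of order only 5/4 at s = 1.\<close>

lemma kernel_diff_le:
  assumes "1 < z" "0 < s" "s < 1"
  shows "\<bar>kernel z a s - kernel 1 a s\<bar> \<le> (z - 1) powr (1/4) * (1 - s) powr (- (5/4))"
proof (cases "a = EZ")
  case True
  have "\<bar>kernel z a s - kernel 1 a s\<bar> = (z - 1) / ((z - s) * (1 - s))"
    using True assms by (simp add: divide_simps)
  also have "\<dots> = ((z - 1) / (z - s)) * (1 / (1 - s))" by simp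
  also have "\<dots> \<le> ((z - 1) / (1 - s)) powr (1/4) * (1 / (1 - s))"
  proof (intro mult_right_mono)
    have x: "0 < (z - 1) / (z - s)" "(z - 1) / (z - s) \<le> 1" using assms by auto
    have "(z - 1) / (z - s) \<le> ((z - 1) / (z - s)) powr (1/4)"
      using powr_mono'[of "1/4" 1 "(z - 1) / (z - s)"] x assms by simp
    also have "\<dots> \<le> ((z - 1) / (1 - s)) powr (1/4)"
      using assms by (intro powr_mono2 frac_le) auto
    finally show "(z - 1) / (z - s) \<le> ((z - 1) / (1 - s)) powr (1/4)" .
  qed (use assms in auto)
  also have "\<dots> = (z - 1) powr (1/4) * ((1 - s) powr (- (1/4)) * (1 - s) powr (- 1))"
    using assms by (simp add: powr_divide powr_minus_divide)
  also have "(1 - s) powr (- (1/4)) * (1 - s) powr (- 1) = (1 - s) powr (- (5/4))"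
    by (subst powr_add[symmetric]) simp
  finally show ?thesis .
next
  case False
  then show ?thesis by (cases a) auto
qed

text \<open>The choice of exponents: order 5/4 of the kernel difference, minus the 1/2 won from the
  remaining word, leaves 3/4 = 1 - 1/4 at s = 1, which \<open>ebound (1/4)\<close> can absorb. The
  second inequality is for integration down to t > 0, the third for t = 0.\<close>

lemma ebound_mult_powr:
  assumes "0 < s" "s < 1"
  shows "(1 - s) powr (- (5/4)) * ebound (1/2) s = s powr (- (1/2)) * (1 - s) powr (- (3/4))"
    "s powr (- (1/2)) * (1 - s) powr (- (3/4)) \<le> ebound (1/4) s / (s * (1 - s))"
    "ebound (1/4) s / (1 - s) \<le> s powr (- (1/2)) * (1 - s) powr (- (3/4))"
proof -
  have "(1 - s) powr (- (5/4)) * ebound (1/2) s = s powr (- (1/2)) * ((1 - s) powr (- (5/4)) *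
    (1 - s) powr (1/2))"
    using assms by (simp add: ebound_eq)
  also have "(1 - s) powr (- (5/4)) * (1 - s) powr (1/2) = (1 - s) powr (- (3/4))"
    by (simp add: powr_add[symmetric])
  finally show "(1 - s) powr (- (5/4)) * ebound (1/2) s = s powr (- (1/2)) * (1 - s) powr (- (3/4))" .
  have H: "ebound (1/4) s / (1 - s) = s powr (- (1/4)) * (1 - s) powr (- (3/4))"
    using ebound_over_eq[OF assms, of "1/4"] by simp
  have "s powr (- (1/2)) \<le> s powr (- (5/4))" using assms by (intro powr_mono') auto
  also have "\<dots> = s powr (- (1/4)) / s"
    using assms powr_diff[of s "- (1/4)" 1] by simp
  finally have "s powr (- (1/2)) * (1 - s) powr (- (3/4)) \<le> s powr (- (1/4)) / s * (1 -
    s) powr (- (3/4))"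
    by (intro mult_right_mono) auto
  also have "\<dots> = ebound (1/4) s / (1 - s) / s" using H by simp
  finally show "s powr (- (1/2)) * (1 - s) powr (- (3/4)) \<le> ebound (1/4) s / (s * (1 - s))"
    by (simp add: mult.commute)
  show "ebound (1/4) s / (1 - s) \<le> s powr (- (1/2)) * (1 - s) powr (- (3/4))"
    unfolding H using assms by (intro mult_right_mono powr_mono') auto
qed

lemma conv1_E0: "1 \<le> z \<Longrightarrow> w \<noteq> [] \<Longrightarrow> last w = E0 \<Longrightarrow> conv1 z w"
  by (simp add: conv1_def)

text \<open>The telescoping pairs the kernel difference, which has the worse pole at 1, with the
  integral at z = 1, whose bound does not involve z.\<close>

lemma iint_Cons_diff:
  assumes z: "1 < z" and w: "w \<noteq> []" "last w = E0" and t: "0 < t \<or> t = 0 \<and> a \<noteq> E0" "t < 1"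
  shows "iint z (a # w) t - iint 1 (a # w) t
      = (LINT s:{t<..<1}|lborel. (kernel z a s - kernel 1 a s) * iint 1 w s + kernel z a s * (iint z w s - iint 1 w s))"
    (is "_ = (LINT s:_|lborel. ?f s)")
    and "set_integrable lborel {t<..<1} (\<lambda>s. (kernel z a s - kernel 1 a s) * iint 1 w s +
      kernel z a s * (iint z w s - iint 1 w s))"
proof -
  have eq: "?f = (\<lambda>s. kernel z a s * iint z w s - kernel 1 a s * iint 1 w s)"
    by (auto simp: algebra_simps)
  have c: "converges z (a # w) t" "converges 1 (a # w) t" using assms
    by (auto simp: converges_def conv1_def)
  have i: "set_integrable lborel {t<..<1} (\<lambda>s. kernel z a s * iint z w s)"
    "set_integrable lborel {t<..<1} (\<lambda>s. kernel 1 a s * iint 1 w s)"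
    using c by (auto intro: set_integrable_iint_Cons)
  show "set_integrable lborel {t<..<1} ?f" unfolding eq using i by (rule set_integral_diff)
  have "iint y (a # w) t = (LINT s:{t<..<1}|lborel. kernel y a s * iint y w s)" if "1 \<le> y" for y
    using w t that by (intro iint_Cons conv1_E0) auto
  then show "iint z (a # w) t - iint 1 (a # w) t = (LINT s:{t<..<1}|lborel. ?f s)"
    unfolding eq using i z by (simp add: set_integral_diff)
qed

lemma iint_diff_integrand_le:
  assumes z: "1 < z" and w: "w \<noteq> []" "last w = E0" and s: "0 < s" "s < 1"
    and C: "\<bar>iint z w s - iint 1 w s\<bar> \<le> C * (z - 1) powr (1/4) * ebound (1/4) s"
  shows "\<bar>(kernel z a s - kernel 1 a s) * iint 1 w s + kernel z a s * (iint z w s - iint 1 w s)\<bar>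
    \<le> (z - 1) powr (1/4) * (2 ^ length w * (s powr (- (1/2)) * (1 - s) powr (- (3/4))) + C * (ebound (1/4) s * abs_ker z a s))"
proof -
  have "\<bar>iint 1 w s\<bar> \<le> 1 * (1 / (1/2)) ^ length w * ebound (1/2) s"
    using w s by (intro abs_iint_le_ebound conv1_E0) auto
  then have G1: "\<bar>iint 1 w s\<bar> \<le> 2 ^ length w * ebound (1/2) s" by simp
  have "\<bar>(kernel z a s - kernel 1 a s) * iint 1 w s + kernel z a s * (iint z w s - iint 1 w s)\<bar>
      \<le> \<bar>kernel z a s - kernel 1 a s\<bar> * \<bar>iint 1 w s\<bar> + \<bar>kernel z a s\<bar> * \<bar>iint z w s - iint 1 w s\<bar>"
    unfolding abs_mult[symmetric] by (rule abs_triangle_ineq)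
  also have "\<dots> \<le> ((z - 1) powr (1/4) * (1 - s) powr (- (5/4))) * (2 ^ length w * ebound (1/2) s)
      + abs_ker z a s * (C * (z - 1) powr (1/4) * ebound (1/4) s)"
    using z s C G1 kernel_diff_le[OF z s] abs_ker_pos[of z s a]
    by (intro add_mono mult_mono) (auto simp: abs_kernel)
  also have "\<dots> = (z - 1) powr (1/4) * (2 ^ length w * ((1 - s) powr (- (5/4)) * ebound (1/2) s) +
    C * (ebound (1/4) s * abs_ker z a s))"
    by (simp add: algebra_simps)
  finally show ?thesis using ebound_mult_powr(1)[OF s] by simp
qed

lemma iint_tendsto_1_rate:
  assumes "w \<noteq> []" "last w = E0"
  shows "\<exists>C\<ge>0. \<forall>z>1. \<forall>t. 0 < t \<longrightarrow> t < 1 \<longrightarrow>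
    \<bar>iint z w t - iint 1 w t\<bar> \<le> C * (z - 1) powr (1/4) * ebound (1/4) t"
  using assms
proof (induction w)
  case (Cons a w)
  show ?case
  proof (cases "w = []")
    case True
    then have "iint z (a # w) t = iint 1 (a # w) t" for z t
      using Cons.prems by (simp add: iint_def abs_iint_def)
    then show ?thesis by (intro exI[of _ 0]) auto
  next
    case False
    then have w: "w \<noteq> []" "last w = E0" using Cons.prems by auto
    then obtain C where C: "0 \<le> C"
      "\<And>z t. 1 < z \<Longrightarrow> 0 < t \<Longrightarrow> t < 1 \<Longrightarrow> \<bar>iint z w t - iint 1 w t\<bar> \<le> C * (z - 1) powr (1/4) *
        ebound (1/4) t"
      using Cons.IH by auto
    show ?thesis
    \<comment> \<open>The 4 is 1 / e for e = 1/4 in \<open>nn_integral_ebound\<close>, the power of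
      2 bounds the integral at z = 1 with e = 1/2, and \<open>C\<close> is the constant of the
      shorter word.\<close>
    proof (intro exI[of _ "4 * (2 ^ length w + C)"] conjI allI impI)
      fix z t :: real assume z: "1 < z" and t: "0 < t" "t < 1"
      let ?D = "(z - 1) powr (1/4) * (2 ^ length w + C)"
      show "\<bar>iint z (a # w) t - iint 1 (a # w) t\<bar> \<le> 4 * (2 ^ length w + C) * (z - 1) powr (1/4) *
        ebound (1/4) t"
        unfolding iint_Cons_diff(1)[OF z w disjI1[OF t(1)] t(2)]
      proof (rule abs_set_integral_le[OF iint_Cons_diff(2)[OF z w disjI1[OF t(1)] t(2)]])
        fix s assume "s \<in> {t<..<1}"
        then have s: "0 < s" "s < 1" using t by auto
        have "ebound (1/4) s * abs_ker z a s \<le> ebound (1/4) s * (1 / (s * (1 - s)))"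
          using abs_ker_le(1)[of z s a] z s by (intro mult_left_mono) auto
        then have k: "ebound (1/4) s * abs_ker z a s \<le> ebound (1/4) s / (s * (1 - s))" by simp
        have "\<bar>(kernel z a s - kernel 1 a s) * iint 1 w s + kernel z a s * (iint z w s - iint 1 w s)\<bar>
            \<le> (z - 1) powr (1/4) * (2 ^ length w * (s powr (- (1/2)) * (1 - s) powr (- (3/4))) + C * (ebound (1/4) s * abs_ker z a s))"
          using C(2)[OF z s] by (intro iint_diff_integrand_le z w s) auto
        also have "\<dots> \<le> (z - 1) powr (1/4) * (2 ^ length w * (ebound (1/4) s / (s * (1 - s))) + C *
          (ebound (1/4) s / (s * (1 - s))))"
          using k C(1) ebound_mult_powr(2)[OF s] by (intro mult_left_mono add_mono) auto
        finally show "\<bar>(kernel z a s - kernel 1 a s) * iint 1 w s + kernel z a s * (iint z w s -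
          iint 1 w s)\<bar>
            \<le> ?D * (ebound (1/4) s / (s * (1 - s)))" by (simp only: mult.assoc distrib_right)
      next
        have "(\<integral>\<^sup>+s. ennreal (?D * (ebound (1/4) s / (s * (1 - s)))) * indicator {t<..<1} s \<partial>lborel)
            = ennreal (?D / (1/4) * ebound (1/4) t)"
          using C(1) t by (intro nn_integral_ebound) auto
        then show "(\<integral>\<^sup>+s. ennreal (?D * (ebound (1/4) s / (s * (1 - s)))) *
          indicator {t<..<1} s \<partial>lborel)
            \<le> ennreal (4 * (2 ^ length w + C) * (z - 1) powr (1/4) * ebound (1/4) t)"
          by (simp add: algebra_simps)
      qed (use C in auto)
    qed (use C in auto)
  qed
qed simp

lemma iint_0_tendsto_1_rate:
  assumes "w \<in> words_zm2"
  shows "\<exists>C\<ge>0. \<forall>z>1. \<bar>iint z w 0 - iint 1 w 0\<bar> \<le> C * (z - 1) powr (1/4)"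
proof (cases w)
  case (Cons a v)
  then have a: "a \<noteq> E0" and v: "v \<noteq> []" "last v = E0"
    using assms by (auto simp: words_zm2_iff split: if_splits)
  obtain C where C: "0 \<le> C"
    "\<And>z t. 1 < z \<Longrightarrow> 0 < t \<Longrightarrow> t < 1 \<Longrightarrow> \<bar>iint z v t - iint 1 v t\<bar> \<le> C * (z - 1) powr (1/4) * ebound (1/4) t"
    using iint_tendsto_1_rate[OF v] by auto
  show ?thesis
  \<comment> \<open>The last factor is the bound of \<open>nn_integral_beta_le\<close> for the
    exponents 1/2 at 0 and 3/4 at 1.\<close>
  proof (intro exI[of _ "(2 ^ length v + C) * (2 / (1 - 1/2) + 2 / (1 - 3/4))"] conjI allI impI)
    fix z :: real assume z: "1 < z"
    let ?D = "(z - 1) powr (1/4) * (2 ^ length v + C)"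
    have d: "0 < (0::real) \<or> 0 = (0::real) \<and> a \<noteq> E0" "0 < (1::real)" using a by auto
    show "\<bar>iint z w 0 - iint 1 w 0\<bar> \<le> (2 ^ length v + C) * (2 / (1 - 1/2) + 2 / (1 - 3/4)) * (z -
      1) powr (1/4)"
      unfolding Cons iint_Cons_diff(1)[OF z v d]
    proof (rule abs_set_integral_le[OF iint_Cons_diff(2)[OF z v d]])
      fix s :: real assume "s \<in> {0<..<1}"
      then have s: "0 < s" "s < 1" by auto
      have "ebound (1/4) s * abs_ker z a s \<le> ebound (1/4) s * (1 / (1 - s))"
        using abs_ker_le(2)[of z s a] z s a by (intro mult_left_mono) auto
      then have k: "ebound (1/4) s * abs_ker z a s \<le> s powr (- (1/2)) * (1 - s) powr (- (3/4))"
        using ebound_mult_powr(3)[OF s] by simp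
      have "\<bar>(kernel z a s - kernel 1 a s) * iint 1 v s + kernel z a s * (iint z v s - iint 1 v s)\<bar>
          \<le> (z - 1) powr (1/4) * (2 ^ length v * (s powr (- (1/2)) * (1 - s) powr (- (3/4))) + C * (ebound (1/4) s * abs_ker z a s))"
        using C(2)[OF z s] by (intro iint_diff_integrand_le z v s) auto
      also have "\<dots> \<le> (z - 1) powr (1/4) * (2 ^ length v * (s powr (- (1/2)) * (1 - s) powr (- (3/4)))
          + C * (s powr (- (1/2)) * (1 - s) powr (- (3/4))))"
        using k C(1) by (intro mult_left_mono add_mono) auto
      finally show "\<bar>(kernel z a s - kernel 1 a s) * iint 1 v s + kernel z a s * (iint z v s -
        iint 1 v s)\<bar>
          \<le> ?D * (s powr (- (1/2)) * (1 - s) powr (- (3/4)))" by (simp only: mult.assoc distrib_right)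
    next
      have "(\<integral>\<^sup>+s. ennreal (?D * (s powr (- (1/2)) * (1 - s) powr (- (3/4)))) *
        indicator {0<..<1} s \<partial>lborel)
          \<le> ennreal (?D * (2 / (1 - 1/2) + 2 / (1 - 3/4)))"
        using C(1) by (intro nn_integral_beta_le) auto
      then show "(\<integral>\<^sup>+s. ennreal (?D * (s powr (- (1/2)) * (1 - s) powr (- (3/4)))) *
        indicator {0<..<1} s \<partial>lborel)
          \<le> ennreal ((2 ^ length v + C) * (2 / (1 - 1/2) + 2 / (1 - 3/4)) * (z - 1) powr (1/4))"
        by (simp only: mult_ac)
    qed (use C in auto)
  qed (use C in auto)
qed (auto intro: exI[of _ 0])

subsection \<open>The limit at infinity\<close>

text \<open>Meant for words whose only e_z is the first letter: the tail does not decay in z, so the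
  factor 1 / (z - 1) has to come from comparing e_z with e_1.\<close>

lemma abs_iint_EZ_0_le:
  assumes z: "1 < z"
  shows "abs_iint z (EZ # w) 0 \<le> ennreal (1 / (z - 1)) * abs_iint z (E1 # w) 0"
proof -
  have "abs_iint z (EZ # w) 0 \<le> (\<integral>\<^sup>+s. ennreal (1 / (z - 1)) * (ennreal (abs_ker z E1 s) *
    abs_iint z w s * indicator {0<..<1} s) \<partial>lborel)"
    unfolding abs_iint_Cons
  proof (intro nn_integral_mono)
    fix s :: real
    show "ennreal (abs_ker z EZ s) * abs_iint z w s * indicator {0<..<1} s
        \<le> ennreal (1 / (z - 1)) * (ennreal (abs_ker z E1 s) * abs_iint z w s * indicator {0<..<1} s)"
    proof (cases "0 < s \<and> s < 1")
      case True
      have "1 / (z - s) \<le> 1 / (z - 1) * 1" using True z by (simp add: frac_le)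
      also have "\<dots> \<le> 1 / (z - 1) * (1 / (1 - s))" using True z by (intro mult_left_mono) auto
      finally have "ennreal (1 / (z - s)) \<le> ennreal (1 / (z - 1)) * ennreal (1 / (1 - s))"
        using z True by (subst ennreal_mult[symmetric]) (auto intro!: ennreal_leI)
      then show ?thesis using True by (simp add: mult.assoc[symmetric] mult_right_mono)
    qed auto
  qed
  also have "\<dots> = ennreal (1 / (z - 1)) * abs_iint z (E1 # w) 0"
    unfolding abs_iint_Cons by (rule nn_integral_cmult) measurable
  finally show ?thesis .
qed

text \<open>The 8 is 2 / (1 - 1/2) + 2 / (1/2), from \<open>abs_iint_0_bound\<close> with e = 1/2.
  The cases are: the word e_z, an e_z behind the first letter, and e_z in front only.\<close>

lemma abs_iint_0_EZ_le:
  assumes w: "w \<in> words_z0" "EZ \<in> set w" and z: "2 \<le> z"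
  shows "\<bar>iint z w 0\<bar> \<le> 2 ^ length w * 8 * (1 / (z - 1))"
proof -
  obtain a v where av: "w = a # v" using w by (cases w) auto
  have a: "a \<noteq> E0" and last: "last w \<noteq> E1" using w av by (auto simp: words_z0_iff)
  have "abs_iint z w 0 \<le> ennreal (2 ^ length w * 8 * (1 / (z - 1)))"
  proof (cases "v = []")
    case True
    then have "a = EZ" using av w by auto
    then have "abs_iint z w 0 \<le> (\<integral>\<^sup>+s. ennreal (1 / (z - 1)) * indicator {0<..<1::real} s \<partial>lborel)"
      unfolding av abs_iint_Cons using True z
      by (intro nn_integral_mono) (auto split: split_indicator intro!: ennreal_leI frac_le)
    also have "\<dots> = ennreal (1 / (z - 1))" by (simp add: nn_integral_cmult)
    also have "\<dots> \<le> ennreal (2 ^ length w * 8 * (1 / (z - 1)))"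
    proof (intro ennreal_leI)
      have "1 \<le> (2::real) ^ length w * 8" using one_le_power[of "2::real" "length w"] by linarith
      then show "1 / (z - 1) \<le> 2 ^ length w * 8 * (1 / (z - 1))"
        using z mult_right_mono[of 1 "2 ^ length w * 8" "1 / (z - 1)"] by auto
    qed
    finally show ?thesis .
  next
    case False
    show ?thesis
    proof (cases "EZ \<in> set v")
      case True
      have "abs_iint z (a # v) 0 \<le> ennreal ((1 / (z - 1) * (1 / (1/2)) ^ length v) * (2 / (1 -
        1/2) + 2 / (1/2)))"
      proof (rule abs_iint_0_bound)
        fix s :: real assume "0 < s" "s < 1"
        then show "abs_iint z v s \<le> ennreal (1 / (z - 1) * (1 / (1/2)) ^ length v * ebound (1/2) s)"
          using True False last av z by (intro abs_iint_bound_EZ) auto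
      qed (use z a in auto)
      also have "\<dots> \<le> ennreal (2 ^ length w * 8 * (1 / (z - 1)))"
        using z by (intro ennreal_leI) (simp add: av divide_simps)
      finally show ?thesis by (simp add: av)
    next
      case F: False
      then have "a = EZ" using av w by auto
      have "last v \<in> set v" using False by simp
      then have "last v \<noteq> EZ" using F by auto
      moreover have "last v \<noteq> E1" using last False av by simp
      ultimately have lv: "last v = E0" by (metis letter.exhaust)
      have "abs_iint z (E1 # v) 0 \<le> ennreal ((1 * (1 / (1/2)) ^ length v) * (2 / (1 - 1/2) +
        2 / (1/2)))"
      proof (rule abs_iint_0_bound)
        fix s :: real assume "0 < s" "s < 1"
        then show "abs_iint z v s \<le> ennreal (1 * (1 / (1/2)) ^ length v * ebound (1/2) s)"
          using False lv z by (intro abs_iint_bound) auto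
      qed (use z in auto)
      then have "abs_iint z w 0 \<le> ennreal (1 / (z - 1)) * ennreal ((1 * (1 / (1/2)) ^ length v) *
        (2 / (1 - 1/2) + 2 / (1/2)))"
        unfolding av \<open>a = EZ\<close> using z by (intro order_trans[OF abs_iint_EZ_0_le] mult_left_mono) auto
      also have "\<dots> = ennreal (1 / (z - 1) * ((1 * (1 / (1/2)) ^ length v) * (2 / (1 - 1/2) +
        2 / (1/2))))"
        using z by (intro ennreal_mult[symmetric]) auto
      also have "\<dots> \<le> ennreal (2 ^ length w * 8 * (1 / (z - 1)))"
        using z by (intro ennreal_leI) (simp add: av divide_simps)
      finally show ?thesis .
    qed
  qed
  then show ?thesis using z by (intro abs_iint_le) auto
qed

lemma iint_0_tendsto_at_top:
  assumes w: "w \<in> words_z0" "EZ \<in> set w"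
  shows "((\<lambda>z. iint z w 0) \<longlongrightarrow> 0) at_top"
proof (rule Lim_null_comparison)
  show "\<forall>\<^sub>F z in at_top. norm (iint z w 0) \<le> 2 ^ length w * 8 * (1 / (z - 1))"
    using eventually_ge_at_top[of 2] by eventually_elim (simp add: abs_iint_0_EZ_le[OF w, simplified])
  have "filterlim (\<lambda>z::real. - 1 + z) at_top at_top"
    by (intro filterlim_tendsto_add_at_top[OF tendsto_const filterlim_ident])
  then have "filterlim (\<lambda>z::real. z - 1) at_infinity at_top"
    by (intro filterlim_at_top_imp_at_infinity) (simp add: algebra_simps)
  then show "((\<lambda>z. 2 ^ length w * 8 * (1 / (z - 1))) \<longlongrightarrow> (0::real)) at_top"
    by (intro tendsto_mult_right_zero tendsto_divide_0[OF tendsto_const])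
qed

section \<open>The differential equation in \<open>z\<close>\<close>

text \<open>\<open>del_open \<alpha>\<close> is \<open>\<partial>\<^sub>z\<^sub>,\<^sub>\<alpha>\<close> without the terms that involve the left boundary letter \<open>a\<^sub>0\<close>: it describes
  the derivative of the iterated integral over \<open>t < t\<^sub>1 < \<dots> < 1\<close> for a generic lower end \<open>t\<close>.\<close>

fun del_open :: "letter \<Rightarrow> word \<Rightarrow> Az" where
  "del_open \<alpha> [] = 0"
| "del_open \<alpha> [a] = (if {a, E1} = {EZ, \<alpha>} then frag_of [] else 0)"
| "del_open \<alpha> (a # b # w) = gen a * del_open \<alpha> (b # w)
     + (if {a, b} = {EZ, \<alpha>} then frag_of (b # w) - frag_of (a # w) else 0)"

lemma gen_times_frag_of: "gen a * frag_of w = frag_of (a # w)"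
  by (simp add: gen_def frag_of_mult)

lemma gen_times_cmul: "gen a * frag_cmul c x = frag_cmul c (gen a * x)"
  by (simp add: gen_times_eq_frag_extend frag_extend_cmul)

lemma del_word_eq_del_open:
  "del_word EZ \<alpha> w = del_open \<alpha> w - (if w \<noteq> [] \<and> {E0, hd w} = {EZ, \<alpha>} then frag_of (tl w) else 0)"
proof -
  \<comment> \<open>The left boundary letter becomes a parameter \<open>l\<close>, because in the
    recursion the removed head is the left neighbour of the rest. Indices are shifted to start at
    0.\<close>
  define dl where "dl l w = (\<Sum>k<length w. frag_cmul
      (of_bool ({(l # w @ [E1]) ! Suc k, (l # w @ [E1]) ! Suc (Suc k)} = {EZ, \<alpha>})
       - of_bool ({(l # w @ [E1]) ! k, (l # w @ [E1]) ! Suc k} = {EZ, \<alpha>}))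
      (frag_of (take k w @ drop (Suc k) w)))" for l w
  have rec: "dl l (b # v) = frag_cmul (of_bool ({b, hd (v @ [E1])} = {EZ, \<alpha>}) - of_bool ({l, b} =
    {EZ, \<alpha>})) (frag_of v)
      + gen b * dl b v" for l b v
  proof -
    have "gen b * dl b v = (\<Sum>k<length v. frag_cmul
      (of_bool ({(b # v @ [E1]) ! Suc k, (b # v @ [E1]) ! Suc (Suc k)} = {EZ, \<alpha>})
       - of_bool ({(b # v @ [E1]) ! k, (b # v @ [E1]) ! Suc k} = {EZ, \<alpha>}))
      (frag_of (b # take k v @ drop (Suc k) v)))"
      by (simp add: dl_def sum_distrib_left gen_times_cmul gen_times_frag_of)
    moreover have "(v @ [E1]) ! 0 = hd (v @ [E1])" by (simp add: hd_conv_nth)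
    ultimately show ?thesis
      unfolding dl_def[of l] by (simp add: sum.lessThan_Suc_shift del: sum.lessThan_Suc)
  qed
  have "dl l w = del_open \<alpha> w - (if w \<noteq> [] \<and> {l, hd w} = {EZ, \<alpha>} then frag_of (tl w) else 0)" for l
  proof (induction w arbitrary: l)
    case Nil
    show ?case by (simp add: dl_def)
  next
    case (Cons b v)
    show ?case
    proof (cases v)
      case Nil
      then show ?thesis by (simp add: rec) (simp add: dl_def)
    next
      case (Cons c u)
      have IH: "dl b v = del_open \<alpha> v - (if {b, c} = {EZ, \<alpha>} then frag_of u else 0)"
        using Cons.IH[of b] Cons by simp
      show ?thesis
        unfolding rec[of l b v] IH by (simp add: Cons algebra_simps gen_times_frag_of)
    qed
  qed
  moreover have "del_word EZ \<alpha> w = dl E0 w"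
    unfolding del_word_def dl_def Let_def
    by (rule sum.reindex_bij_witness[of _ Suc "\<lambda>i. i - 1"]) auto
  ultimately show ?thesis by simp
qed

text \<open>Only a word ending in e_1 e_z could lose its last letter and end in e_1. This term
  occurs twice with opposite signs, once on account of the left neighbour e_1 and once on account of
  the right boundary letter, and cancels.\<close>

lemma keys_del_open_good:
  assumes "\<alpha> \<noteq> EZ" "2 \<le> length w" "last w \<noteq> E1" "v \<in> keys (del_open \<alpha> w)"
  shows "v \<noteq> [] \<and> last v \<noteq> E1"
  using assms
proof (induction \<alpha> w arbitrary: v rule: del_open.induct)
  case (3 \<alpha> a b w)
  show ?case
  proof (cases "w = []")
    case True
    then show ?thesis using 3(2-)
      by (cases a; cases b; cases \<alpha>)
         (auto simp: doubleton_eq_iff gen_times_frag_of split: if_splits dest!: subsetD[OF keys_diff])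
  next
    case False
    let ?x = "if {a, b} = {EZ, \<alpha>} then frag_of (b # w) - frag_of (a # w) else 0"
    have "v \<in> keys (gen a * del_open \<alpha> (b # w)) \<union> keys ?x"
      using 3(5) keys_add[of "gen a * del_open \<alpha> (b # w)" ?x] by (simp only: del_open.simps) blast
    then show ?thesis
    proof
      assume "v \<in> keys (gen a * del_open \<alpha> (b # w))"
      then obtain u where u: "v = a # u" "u \<in> keys (del_open \<alpha> (b # w))"
        using keys_gen_times[of a "del_open \<alpha> (b # w)"] by blast
      have "u \<noteq> [] \<and> last u \<noteq> E1"
        using 3(2,3,4) False u by (intro 3(1)) (auto simp: Suc_le_eq)
      then show ?thesis using u by simp
    next
      assume "v \<in> keys ?x"
      then have "v = b # w \<or> v = a # w"
        using keys_diff[of "frag_of (b # w)" "frag_of (a # w)"] by (auto split: if_splits)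
      then show ?thesis using False 3 by auto
    qed
  qed
qed simp_all

text \<open>Dominated convergence of the difference quotients, which the mean value inequality on
  the convex set y > c bounds by B.\<close>

lemma has_derivative_set_integral:
  fixes f f' :: "real \<Rightarrow> real \<Rightarrow> real"
  assumes S: "S \<in> sets lborel" and c: "c < z"
    and int: "\<And>y. c < y \<Longrightarrow> set_integrable lborel S (f y)"
    and der: "\<And>y s. c < y \<Longrightarrow> s \<in> S \<Longrightarrow> ((\<lambda>y. f y s) has_real_derivative f' y s) (at y)"
    and bnd: "\<And>y s. c < y \<Longrightarrow> s \<in> S \<Longrightarrow> \<bar>f' y s\<bar> \<le> B s" and B: "set_integrable lborel S B"
    and meas: "f' z \<in> borel_measurable borel"
  shows "((\<lambda>y. LINT s:S|lborel. f y s) has_real_derivative (LINT s:S|lborel. f' z s)) (at z)"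
proof -
  let ?F = "\<lambda>y. LINT s:S|lborel. f y s"
  have "((\<lambda>y. (?F y - ?F z) / (y - z)) \<longlongrightarrow> (LINT s:S|lborel. f' z s)) (at z within {c<..})"
    unfolding tendsto_at_iff_sequentially o_def
  proof (intro allI impI)
    fix X :: "nat \<Rightarrow> real" assume X: "\<forall>i. X i \<in> {c<..} - {z}" "X \<longlonglongrightarrow> z"
    have eq: "(?F (X i) - ?F z) / (X i - z)
        = (LINT s|lborel. indicator S s *\<^sub>R ((f (X i) s - f z s) / (X i - z)))" for i
    proof -
      have "(LINT s:S|lborel. (f (X i) s - f z s) / (X i - z)) = (LINT s:S|lborel. f (X i) s -
        f z s) / (X i - z)"
        by (simp add: divide_inverse)
      also have "(LINT s:S|lborel. f (X i) s - f z s) = ?F (X i) - ?F z"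
        using X c int by (intro set_integral_diff) auto
      finally show ?thesis unfolding set_lebesgue_integral_def by (rule sym)
    qed
    show "(\<lambda>i. (?F (X i) - ?F z) / (X i - z)) \<longlonglongrightarrow> (LINT s:S|lborel. f' z s)"
      unfolding eq unfolding set_lebesgue_integral_def
    proof (rule integral_dominated_convergence[where w = "\<lambda>s. indicator S s *\<^sub>R B s"])
      show "(\<lambda>s. indicator S s *\<^sub>R f' z s) \<in> borel_measurable lborel"
        using S meas by measurable
      show "integrable lborel (\<lambda>s. indicator S s *\<^sub>R B s)" using B by (simp add: set_integrable_def)
      show "(\<lambda>s. indicator S s *\<^sub>R ((f (X i) s - f z s) / (X i - z))) \<in> borel_measurable lborel" for i
      proof -
        have "set_integrable lborel S (\<lambda>s. (f (X i) s - f z s) / (X i - z))"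
          using X c int by (intro set_integrable_divide set_integral_diff) auto
        then show ?thesis unfolding set_integrable_def by (rule borel_measurable_integrable)
      qed
      show "AE s in lborel. (\<lambda>i. indicator S s *\<^sub>R ((f (X i) s - f z s) / (X i -
        z))) \<longlonglongrightarrow> indicator S s *\<^sub>R f' z s"
      proof (intro AE_I2)
        fix s
        show "(\<lambda>i. indicator S s *\<^sub>R ((f (X i) s - f z s) / (X i - z))) \<longlonglongrightarrow> indicator S s *\<^sub>R f' z s"
        proof (cases "s \<in> S")
          case True
          then have "((\<lambda>y. (f y s - f z s) / (y - z)) \<longlongrightarrow> f' z s) (at z)"
            using der c by (simp add: has_field_derivative_iff)
          moreover have "filterlim X (at z) sequentially"
            using X by (auto simp: filterlim_at)
          ultimately have "(\<lambda>i. (f (X i) s - f z s) / (X i - z)) \<longlonglongrightarrow> f' z s"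
            by (rule filterlim_compose)
          then show ?thesis using True by simp
        qed simp
      qed
      show "AE s in lborel. norm (indicator S s *\<^sub>R ((f (X i) s - f z s) / (X i - z))) \<le>
        indicator S s *\<^sub>R B s" for i
      proof (intro AE_I2)
        fix s
        show "norm (indicator S s *\<^sub>R ((f (X i) s - f z s) / (X i - z))) \<le> indicator S s *\<^sub>R B s"
        proof (cases "s \<in> S")
          case True
          have "norm (f (X i) s - f z s) \<le> B s * norm (X i - z)"
            using True X c der bnd
            by (intro field_differentiable_bound[where S = "{c<..}" and f' = "\<lambda>y. f' y s"])
               (auto intro: has_field_derivative_at_within)
          moreover have "X i \<noteq> z" using X by auto
          ultimately show ?thesis using True by (simp add: divide_le_eq)
        qed simp
      qed
    qed
  qed
  then show ?thesis using c by (simp add: has_field_derivative_iff at_within_open[of z "{c<..}"])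
qed

text \<open>The derivative in z that \<open>iint_has_derivative\<close> establishes. In the last
  term the lower end t acts on a leading e_z like a neighbouring letter with pole t.\<close>

definition iint_deriv :: "real \<Rightarrow> word \<Rightarrow> real \<Rightarrow> real" where
  "iint_deriv z w t = lin (\<lambda>v. iint z v t) (del_open E0 w) / z +
    lin (\<lambda>v. iint z v t) (del_open E1 w) / (z - 1)
     - (if w \<noteq> [] \<and> hd w = EZ then iint z (tl w) t / (z - t) else 0)"

lemma borel_measurable_lin_iint [measurable]: "(\<lambda>s. lin (\<lambda>v. iint z v s) x) \<in> borel_measurable borel"
  unfolding lin_def by measurable

lemma borel_measurable_iint_deriv [measurable]: "iint_deriv z w \<in> borel_measurable borel"
  unfolding iint_deriv_def[abs_def] by measurable

lemma iint_deriv_Nil [simp]: "iint_deriv z [] t = 0"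
  by (simp add: iint_deriv_def)

lemma iint_deriv_singleton_E0 [simp]: "iint_deriv z [E0] t = 0"
  by (simp add: iint_deriv_def doubleton_eq_iff)

lemma iint_deriv_singleton_EZ: "iint_deriv z [EZ] t = 1 / (z - 1) - 1 / (z - t)"
  by (simp add: iint_deriv_def doubleton_eq_iff)

lemma lin_abs_le:
  assumes "\<And>v. v \<in> keys x \<Longrightarrow> \<bar>f v\<bar> \<le> g v * h"
  shows "\<bar>lin f x\<bar> \<le> (\<Sum>v\<in>keys x. \<bar>of_int (Poly_Mapping.lookup x v)\<bar> * g v) * h"
proof -
  have "\<bar>lin f x\<bar> \<le> (\<Sum>v\<in>keys x. \<bar>of_int (Poly_Mapping.lookup x v) * f v\<bar>)"
    unfolding lin_def by (rule sum_abs)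
  also have "\<dots> \<le> (\<Sum>v\<in>keys x. \<bar>of_int (Poly_Mapping.lookup x v)\<bar> * (g v * h))"
    unfolding abs_mult using assms by (intro sum_mono mult_left_mono) auto
  finally show ?thesis by (simp add: sum_distrib_right mult.assoc)
qed

lemma conv1_iff: "1 < z \<Longrightarrow> conv1 z w \<longleftrightarrow> w = [] \<or> last w \<noteq> E1"
  unfolding conv1_def by (cases "last w") auto

lemma iint_bound_uniform:
  assumes "1 < c" "c \<le> z" "w \<noteq> []" "last w \<noteq> E1" "0 < s" "s < 1"
  shows "\<bar>iint z w s\<bar> \<le> max 1 (1 / (c - 1)) * 2 ^ length w * ebound (1/2) s"
proof -
  have "1 / (z - 1) \<le> 1 / (c - 1)" using assms by (intro frac_le) auto
  then have "\<bar>iint z w s\<bar> \<le> max 1 (1 / (c - 1)) * (1 / (1/2)) ^ length w * ebound (1/2) s"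
    using assms by (intro abs_iint_le_ebound) (auto simp: conv1_iff)
  then show ?thesis by simp
qed

text \<open>This is the majorant for differentiating a word that is one letter longer. The terms are
  bounded singly except for the word e_z: there 1 / (z - 1) and 1 / (z - s) do not vanish at s = 1,
  but their difference (1 - s) / ((z - 1) (z - s)) does.\<close>

lemma iint_deriv_bound:
  assumes c: "1 < c" and w: "w = [] \<or> last w \<noteq> E1"
  shows "\<exists>C\<ge>0. \<forall>z\<ge>c. \<forall>s. 0 < s \<longrightarrow> s < 1 \<longrightarrow> \<bar>iint_deriv z w s\<bar> \<le> C * ebound (1/2) s"
proof (cases "length w \<ge> 2")
  case True
  let ?g = "\<lambda>v :: word. max 1 (1 / (c - 1)) * 2 ^ length v"
  let ?L = "\<lambda>x :: Az. \<Sum>v\<in>keys x. \<bar>of_int (Poly_Mapping.lookup x v)\<bar> * ?g v"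
  have w': "w \<noteq> []" "last w \<noteq> E1" "tl w \<noteq> []" "last (tl w) \<noteq> E1"
    using True w by (auto simp: numeral_2_eq_2 Suc_le_length_iff)
  have L0: "0 \<le> ?L x" for x by (intro sum_nonneg mult_nonneg_nonneg) auto
  show ?thesis
  proof (intro exI[of _ "?L (del_open E0 w) + ?L (del_open E1 w) / (c - 1) + ?g (tl w) / (c -
    1)"] conjI allI impI)
    show "0 \<le> ?L (del_open E0 w) + ?L (del_open E1 w) / (c - 1) + ?g (tl w) / (c - 1)"
      using L0 c by (intro add_nonneg_nonneg divide_nonneg_nonneg) auto
  next
    fix z s :: real assume z: "c \<le> z" and s: "0 < s" "s < 1"
    have lin: "\<bar>lin (\<lambda>v. iint z v s) (del_open \<alpha> w)\<bar> \<le> ?L (del_open \<alpha> w) * ebound (1/2) s"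
      if "\<alpha> \<noteq> EZ" for \<alpha>
      using keys_del_open_good[OF that True w'(2)] c z s
      by (intro lin_abs_le iint_bound_uniform) auto
    have 1: "\<bar>lin (\<lambda>v. iint z v s) (del_open E0 w) / z\<bar> \<le> ?L (del_open E0 w) * ebound (1/2) s"
    proof -
      have "\<bar>lin (\<lambda>v. iint z v s) (del_open E0 w) / z\<bar> = \<bar>lin (\<lambda>v. iint z v s) (del_open E0 w)\<bar> / z"
        using z c by simp
      also have "\<dots> \<le> (?L (del_open E0 w) * ebound (1/2) s) / 1"
        using lin[of E0] z c by (intro frac_le) auto
      finally show ?thesis by simp
    qed
    have 2: "\<bar>lin (\<lambda>v. iint z v s) (del_open E1 w) / (z - 1)\<bar> \<le> ?L (del_open E1 w) / (c - 1) *
      ebound (1/2) s"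
    proof -
      have "\<bar>lin (\<lambda>v. iint z v s) (del_open E1 w) / (z - 1)\<bar> =
        \<bar>lin (\<lambda>v. iint z v s) (del_open E1 w)\<bar> / (z - 1)"
        using z c by simp
      also have "\<dots> \<le> (?L (del_open E1 w) * ebound (1/2) s) / (c - 1)"
        using lin[of E1] z c by (intro frac_le) auto
      finally show ?thesis by simp
    qed
    have 3: "\<bar>iint z (tl w) s / (z - s)\<bar> \<le> ?g (tl w) / (c - 1) * ebound (1/2) s"
    proof -
      have "\<bar>iint z (tl w) s / (z - s)\<bar> = \<bar>iint z (tl w) s\<bar> / (z - s)"
        using z c s by simp
      also have "\<dots> \<le> (?g (tl w) * ebound (1/2) s) / (c - 1)"
        using iint_bound_uniform[OF c z w'(3,4) s] z c s by (intro frac_le) auto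
      finally show ?thesis by simp
    qed
    have "\<bar>iint_deriv z w s\<bar> \<le> \<bar>lin (\<lambda>v. iint z v s) (del_open E0 w) / z\<bar> +
      \<bar>lin (\<lambda>v. iint z v s) (del_open E1 w) / (z - 1)\<bar>
        + \<bar>iint z (tl w) s / (z - s)\<bar>"
    proof -
      have "\<bar>A + B - (if P then D else 0)\<bar> \<le> \<bar>A\<bar> + \<bar>B\<bar> + \<bar>D\<bar>" for A B D :: real and P by auto
      then show ?thesis unfolding iint_deriv_def .
    qed
    also have "\<dots> \<le> ?L (del_open E0 w) * ebound (1/2) s + ?L (del_open E1 w) / (c - 1) *
      ebound (1/2) s + ?g (tl w) / (c - 1) * ebound (1/2) s"
      using 1 2 3 by linarith
    finally show "\<bar>iint_deriv z w s\<bar> \<le> (?L (del_open E0 w) + ?L (del_open E1 w) / (c - 1) +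
      ?g (tl w) / (c - 1)) * ebound (1/2) s"
      by (simp only: distrib_right)
  qed
next
  case False
  then consider "w = [] \<or> w = [E0]" | "w = [EZ]"
    using w by (cases w; cases "hd w") (auto simp: not_le)
  then show ?thesis
  proof cases
    case 1
    then show ?thesis by (intro exI[of _ 0]) auto
  next
    case 2
    show ?thesis
    proof (intro exI[of _ "1 / (c - 1)^2"] conjI allI impI)
      fix z s :: real assume z: "c \<le> z" and s: "0 < s" "s < 1"
      have "iint_deriv z w s = (1 - s) / ((z - 1) * (z - s))"
        using 2 z c s by (simp add: iint_deriv_singleton_EZ divide_simps)
      then have "\<bar>iint_deriv z w s\<bar> = (1 - s) / ((z - 1) * (z - s))" using z c s by simp
      also have "\<dots> \<le> ebound (1/2) s / ((c - 1) * (c - 1))"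
        using z c s one_minus_le_ebound[of "1/2" s] by (intro frac_le mult_mono) auto
      finally show "\<bar>iint_deriv z w s\<bar> \<le> 1 / (c - 1)^2 * ebound (1/2) s" by (simp add: power2_eq_square)
    qed simp
  qed
qed

lemma set_integrable_ebound_bound:
  assumes f: "f \<in> borel_measurable borel" and C: "0 \<le> C" and t: "t < 1"
    and t0: "a \<noteq> E0 \<and> 0 \<le> t \<or> 0 < t"
    and B: "\<And>s. t < s \<Longrightarrow> s < 1 \<Longrightarrow> \<bar>f s\<bar> \<le> C * (ebound (1/2) s * abs_ker 1 a s)"
  shows "set_integrable lborel {t<..<1} f"
proof -
  have "(\<integral>\<^sup>+s. ennreal (norm (indicator {t<..<1} s *\<^sub>R f s)) \<partial>lborel) < \<infinity>"
  proof (cases "0 < t")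
    case True
    have "(\<integral>\<^sup>+s. ennreal (norm (indicator {t<..<1} s *\<^sub>R f s)) \<partial>lborel)
        \<le> (\<integral>\<^sup>+s. ennreal (C * (ebound (1/2) s / (s * (1 - s)))) * indicator {t<..<1} s \<partial>lborel)"
    proof (intro nn_integral_mono)
      fix s :: real
      have "\<bar>f s\<bar> \<le> C * (ebound (1/2) s / (s * (1 - s)))" if "t < s" "s < 1"
      proof -
        have "C * (ebound (1/2) s * abs_ker 1 a s) \<le> C * (ebound (1/2) s * (1 / (s * (1 - s))))"
          using C True that by (intro mult_left_mono abs_ker_le) auto
        then show ?thesis using B[OF that] by simp
      qed
      then show "ennreal (norm (indicator {t<..<1} s *\<^sub>R f s))
          \<le> ennreal (C * (ebound (1/2) s / (s * (1 - s)))) * indicator {t<..<1} s"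
        by (auto split: split_indicator intro!: ennreal_leI)
    qed
    also have "\<dots> = ennreal (C / (1/2) * ebound (1/2) t)"
      using True t C by (intro nn_integral_ebound) auto
    also have "\<dots> < \<infinity>" by simp
    finally show ?thesis .
  next
    case False
    then have a: "a \<noteq> E0" "t = 0" using t0 by auto
    have "(\<integral>\<^sup>+s. ennreal (norm (indicator {t<..<1} s *\<^sub>R f s)) \<partial>lborel)
        \<le> (\<integral>\<^sup>+s. ennreal (C * (s powr (- (1/2)) * (1 - s) powr (- (1/2)))) * indicator {0<..<1} s \<partial>lborel)"
    proof (intro nn_integral_mono)
      fix s :: real
      have "\<bar>f s\<bar> \<le> C * (s powr (- (1/2)) * (1 - s) powr (- (1/2)))" if s: "0 < s" "s < 1"
      proof -
        have "C * (ebound (1/2) s * abs_ker 1 a s) \<le> C * (ebound (1/2) s * (1 / (1 - s)))"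
          using C a s by (intro mult_left_mono abs_ker_le) auto
        also have "ebound (1/2) s * (1 / (1 - s)) = s powr (- (1/2)) * (1 - s) powr (- (1/2))"
          using ebound_over_eq[OF s, of "1/2"] by simp
        finally show ?thesis using B[of s] s a by simp
      qed
      then show "ennreal (norm (indicator {t<..<1} s *\<^sub>R f s))
          \<le> ennreal (C * (s powr (- (1/2)) * (1 - s) powr (- (1/2)))) * indicator {0<..<1} s"
        using a by (auto split: split_indicator intro!: ennreal_leI)
    qed
    also have "\<dots> \<le> ennreal (C * (2 / (1 - 1/2) + 2 / (1 - 1/2)))"
      using C by (intro nn_integral_beta_le) auto
    also have "\<dots> < \<infinity>" by simp
    finally show ?thesis .
  qed
  then show ?thesis unfolding set_integrable_def using f by (intro integrableI_bounded) auto
qed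

text \<open>For the empty word the integral is 1 and does not decay at s = 1. The kernel 1 / (1 - s)
  makes room for it, since 1 \<le> \<open>ebound (1/2) s / (1 - s)\<close>, and the bound remains
  integrable down to 0.\<close>

lemma iint_sq_bound:
  assumes c: "1 < c" and z: "c \<le> z" and w: "w = [] \<or> last w \<noteq> E1" and s: "0 < s" "s < 1"
  shows "\<bar>iint z w s / (z - s)^2\<bar> \<le> (max 1 (1 / (c - 1)) * 2 ^ length w / (c - 1)^2) *
    (ebound (1/2) s * abs_ker 1 EZ s)"
proof -
  have H: "1 - s \<le> ebound (1/2) s" using one_minus_le_ebound[of "1/2" s] s by simp
  have "\<bar>iint z w s\<bar> \<le> (max 1 (1 / (c - 1)) * 2 ^ length w) * (ebound (1/2) s / (1 - s))"
  proof (cases "w = []")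
    case True
    have "1 * 1 \<le> max 1 (1 / (c - 1)) * (ebound (1/2) s / (1 - s))"
      using H s by (intro mult_mono) auto
    then show ?thesis using True by simp
  next
    case False
    have "\<bar>iint z w s\<bar> \<le> max 1 (1 / (c - 1)) * 2 ^ length w * ebound (1/2) s"
      using False w c z s by (intro iint_bound_uniform) auto
    also have "\<dots> \<le> max 1 (1 / (c - 1)) * 2 ^ length w * (ebound (1/2) s / (1 - s))"
      using s mult_right_mono[of "1 - s" 1 "ebound (1/2) s"]
        by (intro mult_left_mono) (auto simp: le_divide_eq mult.commute)
    finally show ?thesis .
  qed
  then have "\<bar>iint z w s\<bar> / (z - s)^2 \<le> (max 1 (1 / (c - 1)) * 2 ^ length w) *
    (ebound (1/2) s / (1 - s)) / (c - 1)^2"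
    using c z s by (intro frac_le power_mono) auto
  then show ?thesis by (simp add: mult_ac)
qed

lemma set_integrable_iint_sq:
  assumes z: "1 < z" and w: "w = [] \<or> last w \<noteq> E1" and t: "0 \<le> t" "t < 1"
  shows "set_integrable lborel {t<..<1} (\<lambda>s. iint z w s / (z - s)^2)"
proof (rule set_integrable_ebound_bound[where a = EZ])
  fix s assume "t < s" "s < 1"
  then show "\<bar>iint z w s / (z - s)^2\<bar> \<le> (max 1 (1 / (z - 1)) * 2 ^ length w / (z - 1)^2) *
    (ebound (1/2) s * abs_ker 1 EZ s)"
    using z w t by (intro iint_sq_bound) auto
qed (use t in auto)

lemma iint_Cons_has_derivative:
  assumes z: "1 < z" and aw: "last (a # w) \<noteq> E1" and t: "0 \<le> t" "t < 1" "0 < t \<or> a \<noteq> E0"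
    and der: "\<And>y s. 1 < y \<Longrightarrow> 0 < s \<Longrightarrow> s < 1 \<Longrightarrow> ((\<lambda>y. iint y w s) has_real_derivative
      iint_deriv y w s) (at y)"
  shows "((\<lambda>y. iint y (a # w) t) has_real_derivative
    (LINT s:{t<..<1}|lborel. kernel z a s * iint_deriv z w s + (if a = EZ then iint z w s / (z - s)^2 else 0))) (at z)"
proof -
  \<comment> \<open>The majorants contain 1 / (c - 1), so they are uniform only on a half-line that
    stays away from 1.\<close>
  define c where "c = (1 + z) / 2"
  have c: "1 < c" "c < z" using z by (auto simp: c_def)
  have w: "w = [] \<or> last w \<noteq> E1" using aw by auto
  let ?f = "\<lambda>y s. kernel y a s * iint y w s"
  let ?f' = "\<lambda>y s. kernel y a s * iint_deriv y w s + (if a = EZ then iint y w s / (y - s)^2 else 0)"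
  obtain C where C: "0 \<le> C" "\<And>y s. c \<le> y \<Longrightarrow> 0 < s \<Longrightarrow> s < 1 \<Longrightarrow> \<bar>iint_deriv y w s\<bar> \<le> C * ebound (1/2) s"
    using iint_deriv_bound[OF c(1) w] by auto
  define C' where "C' = max 1 (1 / (c - 1)) * 2 ^ length w / (c - 1)^2"
  have C': "0 \<le> C'" by (simp add: C'_def)
  have bound: "\<bar>?f' y s\<bar> \<le> (C + C') * (ebound (1/2) s * abs_ker 1 a s)" if y: "c < y"
    and s: "0 < s" "s < 1" for y s
  proof -
    have k: "abs_ker y a s \<le> abs_ker 1 a s" "0 \<le> abs_ker 1 a s" using y c s abs_ker_pos[of 1 s a]
      by (cases a; auto intro!: frac_le)+
    have "\<bar>kernel y a s * iint_deriv y w s\<bar> \<le> abs_ker 1 a s * (C * ebound (1/2) s)"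
      unfolding abs_mult using C(2)[of y s] y c s k by (intro mult_mono) (auto simp: abs_kernel)
    moreover have "\<bar>if a = EZ then iint y w s / (y - s)^2 else 0\<bar> \<le> C' * (ebound (1/2) s *
      abs_ker 1 a s)"
    proof (cases "a = EZ")
      case True
      then show ?thesis unfolding C'_def using iint_sq_bound[OF c(1) less_imp_le[OF y] w s] by simp
    next
      case False
      then show ?thesis using C' k by simp
    qed
    ultimately show ?thesis using abs_triangle_ineq[of "kernel y a s * iint_deriv y w s"]
      by (simp add: algebra_simps)
  qed
  have "((\<lambda>y. LINT s:{t<..<1}|lborel. ?f y s) has_real_derivative
    (LINT s:{t<..<1}|lborel. ?f' z s)) (at z)"
  proof (rule has_derivative_set_integral[where c = c and B = "\<lambda>s. (C + C') * (ebound (1/2) s *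
    abs_ker 1 a s)"])
    fix y assume y: "c < y"
    have "conv1 y (a # w)" using y c aw by (subst conv1_iff) auto
    then show "set_integrable lborel {t<..<1} (?f y)"
      using t by (intro set_integrable_iint_Cons) (auto simp: converges_def)
    fix s assume "s \<in> {t<..<1}"
    then have s: "0 < s" "s < 1" using t by auto
    show "\<bar>?f' y s\<bar> \<le> (C + C') * (ebound (1/2) s * abs_ker 1 a s)" by (rule bound[OF y s])
    have k: "((\<lambda>y. kernel y a s) has_real_derivative (if a = EZ then 1 / (y - s)^2 else 0)) (at y)"
      using y c s by (cases a) (auto intro!: derivative_eq_intros simp: power2_eq_square)
    have "((\<lambda>y. kernel y a s * iint y w s) has_real_derivative
        (if a = EZ then 1 / (y - s)^2 else 0) * iint y w s + iint_deriv y w s * kernel y a s) (at y)"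
      using k der[of y s] y c s by (intro DERIV_mult) auto
    then show "((\<lambda>y. ?f y s) has_real_derivative ?f' y s) (at y)"
      by (rule DERIV_cong) auto
  next
    show "set_integrable lborel {t<..<1} (\<lambda>s. (C + C') * (ebound (1/2) s * abs_ker 1 a s))"
    proof (rule set_integrable_ebound_bound[where a = a and C = "C + C'"])
      fix s assume "t < s" "s < 1"
      then have "0 \<le> abs_ker 1 a s" using abs_ker_pos[of 1 s a] t by auto
      then show "\<bar>(C + C') * (ebound (1/2) s * abs_ker 1 a s)\<bar> \<le> (C + C') * (ebound (1/2) s *
        abs_ker 1 a s)"
        using C C' by simp
    qed (use C C' t in auto)
  qed (use c in auto)
  then show ?thesis
  proof (rule has_field_derivative_transform_within_open[where S = "{1<..}"])
    fix y :: real assume "y \<in> {1<..}"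
    then show "(LINT s:{t<..<1}|lborel. ?f y s) = iint y (a # w) t"
      using w t by (intro iint_Cons[symmetric]) (auto simp: conv1_iff)
  qed (use z in auto)
qed

section \<open>Integration of the differentiated integrand\<close>

lemma set_integral_kernel_lin:
  assumes "\<And>v. v \<in> keys x \<Longrightarrow> converges z (a # v) t"
  shows "set_integrable lborel {t<..<1} (\<lambda>s. kernel z a s * lin (\<lambda>v. iint z v s) x) \<and>
    (LINT s:{t<..<1}|lborel. kernel z a s * lin (\<lambda>v. iint z v s) x) = lin (\<lambda>v. iint z v t) (gen a * x)"
proof -
  have "keys x \<subseteq> {v. converges z (a # v) t}" using assms by auto
  then show ?thesis
  proof (induction x rule: frag_induction)
    case zero
    show ?case by (simp add: set_integrable_def)
  next
    case (one v)
    then have c: "converges z (a # v) t" by simp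
    then have "conv1 z v" "0 \<le> t" using conv1_Cons by (auto simp: converges_def)
    then show ?case
      using set_integrable_iint_Cons[OF c] iint_Cons[of z v t a] by (simp add: gen_times_frag_of)
  next
    case (diff x y)
    then show ?case by (simp add: lin_diff right_diff_distrib set_integral_diff)
  qed
qed

text \<open>Integration by parts in the form of Tonelli's theorem, without a boundary term at 1:
  \<open>iint z (b # w) s\<close> is an integral over r > s, and after the exchange the integral of
  1 / (z - s)^2 over t < s < r is 1 / (z - r) - 1 / (z - t).\<close>

lemma set_integral_iint_by_parts:
  assumes z: "1 < z" and w: "last (b # w) \<noteq> E1" and t: "0 \<le> t" "t < 1"
  shows "(LINT s:{t<..<1}|lborel. iint z (b # w) s / (z - s)^2)
       = (LINT s:{t<..<1}|lborel. kernel z b s * (1 / (z - s) - 1 / (z - t)) * iint z w s)"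
proof -
  have cb: "conv1 z (b # w)" and cw: "conv1 z w"
    using w by (simp_all add: conv1_iff[OF z] split: if_splits)
  define g where "g s = 1 / (z - s)^2" for s
  define h where "h s = abs_ker z b s * (1 / (z - s) - 1 / (z - t))" for s
  have [measurable]: "g \<in> borel_measurable borel" "h \<in> borel_measurable borel"
    unfolding g_def[abs_def] h_def[abs_def] by measurable
  have diff: "0 \<le> 1 / (z - s) - 1 / (z - t)" if "t < s" "s < 1" for s
    using that z t by (simp add: frac_le)
  have h0: "0 \<le> h s" if "t < s" "s < 1" for s
    unfolding h_def using that z t diff abs_ker_pos[of z s b] by (intro mult_nonneg_nonneg) auto
  have "(LINT s:{t<..<1}|lborel. iint z (b # w) s / (z - s)^2) = (LINT s:{t<..<1}|lborel. g s *
    iint z (b # w) s)"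
    by (simp add: g_def)
  also have "\<dots> = word_sign (b # w) * enn2real (\<integral>\<^sup>+s. ennreal (g s) * abs_iint z (b # w) s *
    indicator {t<..<1} s \<partial>lborel)"
    using cb t by (intro ennreal_integral_iint) (auto simp: g_def)
  also have "(\<integral>\<^sup>+s. ennreal (g s) * abs_iint z (b # w) s * indicator {t<..<1} s \<partial>lborel)
      = (\<integral>\<^sup>+s. ennreal (h s) * abs_iint z w s * indicator {t<..<1} s \<partial>lborel)"
  proof -
    define A where "A s = ennreal (g s) * indicator {t<..<1} s" for s
    define B where "B s = ennreal (abs_ker z b s) * abs_iint z w s * indicator {t<..<1} s" for s
    have [measurable]: "A \<in> borel_measurable borel" "B \<in> borel_measurable borel"
      unfolding A_def B_def by measurable
    have "(\<integral>\<^sup>+s. ennreal (g s) * abs_iint z (b # w) s * indicator {t<..<1} s \<partial>lborel)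
        = (\<integral>\<^sup>+s. A s * (\<integral>\<^sup>+r. B r * indicator {s<..} r \<partial>lborel) \<partial>lborel)"
    proof (intro nn_integral_cong)
      fix s
      have "abs_iint z (b # w) s = (\<integral>\<^sup>+r. B r * indicator {s<..} r \<partial>lborel)" if "t < s"
        unfolding abs_iint_Cons B_def using that
          by (intro nn_integral_cong) (auto split: split_indicator)
      then show "ennreal (g s) * abs_iint z (b # w) s * indicator {t<..<1} s
          = A s * (\<integral>\<^sup>+r. B r * indicator {s<..} r \<partial>lborel)"
        by (auto simp: A_def split: split_indicator)
    qed
    also have "\<dots> = (\<integral>\<^sup>+r. B r * (\<integral>\<^sup>+s. A s * indicator {..<r} s \<partial>lborel) \<partial>lborel)"
      by (rule nn_integral_triangle_swap[symmetric]) measurable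
    also have "\<dots> = (\<integral>\<^sup>+s. ennreal (h s) * abs_iint z w s * indicator {t<..<1} s \<partial>lborel)"
    proof (intro nn_integral_cong)
      fix r
      have "(\<integral>\<^sup>+s. A s * indicator {..<r} s \<partial>lborel) = ennreal (1 / (z - r) - 1 / (z - t))"
        if r: "t < r" "r < 1"
      proof -
        have "(\<integral>\<^sup>+s. A s * indicator {..<r} s \<partial>lborel) = (\<integral>\<^sup>+s. ennreal (g s) *
          indicator {t<..<r} s \<partial>lborel)"
          unfolding A_def using r by (intro nn_integral_cong) (auto split: split_indicator)
        also have "\<dots> = ennreal (1 / (z - r) - 1 / (z - t))"
        proof (rule nn_integral_FTC_open[where F = "\<lambda>s. 1 / (z - s)"])
          fix x assume x: "t < x" "x < r"
          then show "((\<lambda>s. 1 / (z - s)) has_real_derivative g x) (at x)"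
            using r z unfolding g_def by (auto intro!: derivative_eq_intros simp: power2_eq_square)
          show "isCont g x" unfolding g_def[abs_def] using x r z by (intro continuous_intros) auto
          show "0 \<le> g x" by (simp add: g_def)
        next
          show "((\<lambda>s. 1 / (z - s)) \<longlongrightarrow> 1 / (z - t)) (at_right t)"
            using z t by (intro tendsto_intros) auto
          show "((\<lambda>s. 1 / (z - s)) \<longlongrightarrow> 1 / (z - r)) (at_left r)"
            using z r by (intro tendsto_intros) auto
        qed (use r in auto)
        finally show ?thesis .
      qed
      moreover have "ennreal (h r) = ennreal (abs_ker z b r) * ennreal (1 / (z - r) - 1 / (z -
        t))" if r: "t < r" "r < 1"
        unfolding h_def using diff[OF r] abs_ker_pos[of z r b] z r t by (intro ennreal_mult) auto
      ultimately show "B r * (\<integral>\<^sup>+s. A s * indicator {..<r} s \<partial>lborel)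
          = ennreal (h r) * abs_iint z w r * indicator {t<..<1} r"
        by (auto simp: B_def mult_ac split: split_indicator)
    qed
    finally show ?thesis .
  qed
  also have "word_sign (b # w) * enn2real (\<integral>\<^sup>+s. ennreal (h s) * abs_iint z w s *
    indicator {t<..<1} s \<partial>lborel)
      = (if b = E0 then 1 else - 1) * (LINT s:{t<..<1}|lborel. h s * iint z w s)"
    using ennreal_integral_iint(1)[OF cw t(1), of h] h0 by (simp add: word_sign_Cons)
  also have "\<dots> = (LINT s:{t<..<1}|lborel. (if b = E0 then 1 else - 1) * (h s * iint z w s))"
    by (rule set_integral_mult_right[symmetric])
  also have "\<dots> = (LINT s:{t<..<1}|lborel. kernel z b s * (1 / (z - s) - 1 / (z - t)) * iint z w s)"
    by (simp only: kernel_def h_def mult.assoc)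
  finally show ?thesis .
qed

lemma set_integral_diff_scaled:
  fixes f g :: "real \<Rightarrow> real"
  assumes "set_integrable M S f" "set_integrable M S g"
  shows "(LINT s:S|M. c * f s - d * g s) = c * (LINT s:S|M. f s) - d * (LINT s:S|M. g s)"
  using assms by (subst set_integral_diff) auto

text \<open>The origin of the coefficients 1 / z and 1 / (z - 1) in the differential
  equation.\<close>

lemma kernel_partial_fraction:
  assumes "1 < z" "0 < s" "s < 1" "a \<noteq> EZ"
  shows "kernel z a s / (z - s) = (kernel z a s - kernel z EZ s) / (z - pole a)"
  using assms by (cases a) (auto simp: divide_simps)

text \<open>The part of \<open>iint_deriv z (a # b # w) t\<close> in which \<open>a\<close> or \<open>b\<close> is removed on account of the other or of \<open>t\<close>.\<close>

definition adj_terms :: "real \<Rightarrow> letter \<Rightarrow> letter \<Rightarrow> word \<Rightarrow> real \<Rightarrow> real" where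
  "adj_terms z a b w t = (if a = EZ \<and> b \<noteq> EZ then (iint z (b # w) t - iint z (EZ # w) t) / (z - pole b)
     else if a \<noteq> EZ \<and> b = EZ then (iint z (EZ # w) t - iint z (a # w) t) / (z - pole a) else 0)
     - (if a = EZ then iint z (b # w) t / (z - t) else 0)"

lemma iint_deriv_Cons_Cons:
  "iint_deriv z (a # b # w) t = lin (\<lambda>v. iint z v t) (gen a * del_open E0 (b # w)) / z
     + lin (\<lambda>v. iint z v t) (gen a * del_open E1 (b # w)) / (z - 1) + adj_terms z a b w t"
  by (cases a; cases b) (simp_all add: iint_deriv_def adj_terms_def lin_add lin_diff doubleton_eq_iff add_divide_distrib)

text \<open>\<open>ex\<close> collects what is not a deletion inside \<open>b # w\<close>: for a =
  e_z the derivative of its kernel, for b = e_z the boundary term of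
  \<open>iint_deriv z (b # w) s\<close>. For the excluded word e_1 e_z the function
  \<open>ex\<close> has the non-integrable pole 1 / (1 - s).\<close>

lemma set_integral_adj_terms:
  assumes z: "1 < z" and t: "0 \<le> t" "t < 1" "0 < t \<or> a \<noteq> E0"
    and w: "last (b # w) \<noteq> E1" and special: "\<not> (a = E1 \<and> b = EZ \<and> w = [])"
  defines "ex \<equiv> \<lambda>s. (if a = EZ then iint z (b # w) s / (z - s)^2 else 0)
     - (if b = EZ then kernel z a s * (iint z w s / (z - s)) else 0)"
  shows "set_integrable lborel {t<..<1} ex \<and> (LINT s:{t<..<1}|lborel. ex s) = adj_terms z a b w t"
proof -
  have w': "w = [] \<or> last w \<noteq> E1" using w by auto
  have ce: "conv1 z w" using z w' by (simp add: conv1_iff)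
  let ?I = "\<lambda>f. LINT s:{t<..<1}|lborel. f s" and ?int = "set_integrable lborel {t<..<1}"
  have kG: "?I (\<lambda>s. kernel z c s * iint z w s) = iint z (c # w) t" for c
    using ce t by (simp add: iint_Cons)
  have convI: "converges z (c # w) t" if "0 < t \<or> c \<noteq> E0" "w \<noteq> [] \<or> c \<noteq> E1" for c
    using w' t that by (auto simp: converges_def conv1_iff[OF z])
  have ikG: "?int (\<lambda>s. kernel z c s * iint z w s)" if "0 < t \<or> c \<noteq> E0" "w \<noteq> [] \<or> c \<noteq> E1" for c
    using convI[OF that] by (rule set_integrable_iint_Cons)
  have pf: "(LINT s:{t<..<1}|lborel. kernel z c s * (iint z w s / (z - s))) = (iint z (c # w) t -
    iint z (EZ # w) t) / (z - pole c)
      \<and> ?int (\<lambda>s. kernel z c s * (iint z w s / (z - s)))"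
    if c: "c \<noteq> EZ" "0 < t \<or> c \<noteq> E0" "w \<noteq> [] \<or> c \<noteq> E1" for c
  proof -
    have eq: "kernel z c s * (iint z w s / (z - s)) = (1 / (z - pole c)) * (kernel z c s *
      iint z w s - kernel z EZ s * iint z w s)"
      if "s \<in> {t<..<1}" for s
    proof -
      have "kernel z c s * (iint z w s / (z - s)) = (kernel z c s / (z - s)) * iint z w s" by simp
      also have "\<dots> = (kernel z c s - kernel z EZ s) / (z - pole c) * iint z w s"
        using that t z c by (subst kernel_partial_fraction) auto
      finally show ?thesis by (simp only: left_diff_distrib[symmetric] times_divide_eq_left mult_1_left)
    qed
    have i: "?int (\<lambda>s. (1 / (z - pole c)) * (kernel z c s * iint z w s - kernel z EZ s * iint z w s))"
      using ikG[of c] ikG[of EZ] c by (intro set_integrable_mult_right set_integral_diff) auto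
    have "?I (\<lambda>s. kernel z c s * (iint z w s / (z - s)))
        = ?I (\<lambda>s. (1 / (z - pole c)) * (kernel z c s * iint z w s - kernel z EZ s * iint z w s))"
      using eq by (intro set_lebesgue_integral_cong) auto
    also have "\<dots> = (1 / (z - pole c)) * ?I (\<lambda>s. kernel z c s * iint z w s - kernel z EZ s * iint z w s)"
      by (rule set_integral_mult_right)
    also have "?I (\<lambda>s. kernel z c s * iint z w s - kernel z EZ s * iint z w s) =
      iint z (c # w) t - iint z (EZ # w) t"
      using ikG[of c] ikG[of EZ] c by (subst set_integral_diff) (auto simp: kG simp del: kernel_simps)
    moreover have "?int (\<lambda>s. kernel z c s * (iint z w s / (z - s)))"
      using i by (subst set_integrable_cong[OF refl refl eq])
    ultimately show ?thesis by simp
  qed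
  have sq: "?int (\<lambda>s. iint z v s / (z - s)^2)" if "v = [] \<or> last v \<noteq> E1" for v
    using z that t by (intro set_integrable_iint_sq) auto
  consider "a \<noteq> EZ" "b \<noteq> EZ" | "a \<noteq> EZ" "b = EZ" | "a = EZ" "b = EZ" | "a = EZ" "b \<noteq> EZ"
    "0 < t \<or> b \<noteq> E0"
    | "a = EZ" "b = E0" "t = 0" using t by (metis letter.distinct(3) order_le_less)
  then show ?thesis
  proof cases
    case 1
    then show ?thesis by (simp add: ex_def adj_terms_def set_integrable_def set_lebesgue_integral_def)
  next
    case 2
    have "?int (\<lambda>s. (- 1) * (kernel z a s * (iint z w s / (z - s))))"
      using pf[of a] 2 t special by (intro set_integrable_mult_right) auto
    moreover have "?I (\<lambda>s. (- 1) * (kernel z a s * (iint z w s / (z - s)))) = (- 1) *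
      ((iint z (a # w) t - iint z (EZ # w) t) / (z - pole a))"
      using pf[of a] 2 t special by (subst set_integral_mult_right) (auto simp: diff_divide_distrib)
    ultimately show ?thesis using 2 by (simp add: ex_def adj_terms_def diff_divide_distrib)
  next
    \<comment> \<open>The integral of \<open>iint z w s / (z - s)^2\<close> that integration by
      parts produces cancels against the second term of \<open>ex\<close>.\<close>
    case 3
    have e: "ex s = iint z (b # w) s / (z - s)^2 + iint z w s / (z - s)^2" if "s \<in> {t<..<1}" for s
      using 3 that z by (simp add: ex_def power2_eq_square)
    have i1: "?int (\<lambda>s. iint z (b # w) s / (z - s)^2)" "?int (\<lambda>s. iint z w s / (z - s)^2)"
      using sq w w' by auto
    then have int: "?int ex" using e by (subst set_integrable_cong[OF refl refl e]) auto
    have "?I ex = ?I (\<lambda>s. iint z (b # w) s / (z - s)^2 + iint z w s / (z - s)^2)"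
      using e by (intro set_lebesgue_integral_cong) auto
    also have "\<dots> = ?I (\<lambda>s. kernel z b s * (1 / (z - s) - 1 / (z - t)) * iint z w s) +
      ?I (\<lambda>s. iint z w s / (z - s)^2)"
      using i1 set_integral_iint_by_parts[OF z w t(1,2)] by (subst set_integral_add) auto
    also have "?I (\<lambda>s. kernel z b s * (1 / (z - s) - 1 / (z - t)) * iint z w s)
        = ?I (\<lambda>s. (- 1) * (iint z w s / (z - s)^2) - (1 / (z - t)) * (kernel z b s * iint z w s))"
    proof (intro set_lebesgue_integral_cong allI impI)
      fix s assume "s \<in> {t<..<1}"
      have "kernel z b s * (1 / (z - s) - 1 / (z - t)) * iint z w s
          = kernel z b s * (1 / (z - s)) * iint z w s - (1 / (z - t)) * (kernel z b s * iint z w s)"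
        by (simp only: right_diff_distrib left_diff_distrib mult_ac)
      then show "kernel z b s * (1 / (z - s) - 1 / (z - t)) * iint z w s
          = (- 1) * (iint z w s / (z - s)^2) - (1 / (z - t)) * (kernel z b s * iint z w s)"
        using 3 by (simp add: power2_eq_square)
    qed auto
    also have "\<dots> = (- 1) * ?I (\<lambda>s. iint z w s / (z - s)^2) - (1 / (z - t)) * iint z (b # w) t"
      using i1 ikG[of b] 3 by (subst set_integral_diff_scaled) (auto simp: kG simp del: kernel_simps)
    finally show ?thesis using int 3 by (simp add: adj_terms_def)
  next
    case 4
    have nb: "w \<noteq> [] \<or> b \<noteq> E1" using w by auto
    have int: "?int ex" using sq[of "b # w"] w 4 by (simp add: ex_def)
    have "?I ex = ?I (\<lambda>s. kernel z b s * (1 / (z - s) - 1 / (z - t)) * iint z w s)"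
      using set_integral_iint_by_parts[OF z w t(1,2)] 4 by (simp add: ex_def)
    also have "\<dots> = ?I (\<lambda>s. kernel z b s * (iint z w s / (z - s)) - (1 / (z - t)) * (kernel z b s *
      iint z w s))"
      by (simp add: algebra_simps)
    also have "\<dots> = (iint z (b # w) t - iint z (EZ # w) t) / (z - pole b) - (1 / (z - t)) *
      iint z (b # w) t"
      using pf[of b] ikG[of b] 4 nb by (subst set_integral_diff) (auto simp: kG)
    finally show ?thesis using int 4 by (simp add: adj_terms_def)
  next
    \<comment> \<open>Here \<open>iint z (b # w) 0\<close> is a divergent integral. Its two
      occurrences in \<open>adj_terms\<close> both have the coefficient 1 / z and cancel; under the
      integral, 1 / (z - s) - 1 / z = s / (z (z - s)) removes the pole at 0.\<close>
    case 5
    have int: "?int ex" using sq[of "b # w"] w 5 by (simp add: ex_def)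
    have "?I ex = ?I (\<lambda>s. kernel z b s * (1 / (z - s) - 1 / (z - t)) * iint z w s)"
      using set_integral_iint_by_parts[OF z w t(1,2)] 5 by (simp add: ex_def)
    also have "\<dots> = ?I (\<lambda>s. (- (1 / z)) * (kernel z EZ s * iint z w s))"
    proof (intro set_lebesgue_integral_cong allI impI)
      fix s assume "s \<in> {t<..<1}"
      then have "kernel z b s * (1 / (z - s) - 1 / (z - t)) = - (1 / z) * kernel z EZ s"
        using 5 z by (simp add: divide_simps)
      then show "kernel z b s * (1 / (z - s) - 1 / (z - t)) * iint z w s = (- (1 / z)) *
        (kernel z EZ s * iint z w s)"
        by simp
    qed auto
    also have "\<dots> = - (1 / z) * iint z (EZ # w) t"
      by (simp only: set_integral_mult_right kG)
    finally show ?thesis using int 5 by (simp add: adj_terms_def diff_divide_distrib)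
  qed
qed

text \<open>This closes the induction on words: deletions inside \<open>w\<close> are integrated
  term by term against the first kernel, and the rest adds up to \<open>adj_terms\<close>.\<close>

lemma set_integral_iint_deriv:
  assumes z: "1 < z" and aw: "last (a # w) \<noteq> E1" and t: "0 \<le> t" "t < 1" "0 < t \<or> a \<noteq> E0"
  shows "(LINT s:{t<..<1}|lborel. kernel z a s * iint_deriv z w s + (if a =
    EZ then iint z w s / (z - s)^2 else 0)) = iint_deriv z (a # w) t"
proof -
  let ?I = "\<lambda>f. LINT s:{t<..<1}|lborel. f s" and ?int = "set_integrable lborel {t<..<1}"
  show ?thesis
  proof (cases w)
    case Nil
    then consider "a = E0" | "a = EZ" using aw by (cases a) auto
    then show ?thesis
    proof cases
      case 1
      then show ?thesis using Nil by (simp add: set_lebesgue_integral_def)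
    next
      case 2
      have "(\<integral>\<^sup>+s. ennreal (1 / (z - s)^2) * indicator {t<..<1} s \<partial>lborel) = ennreal (1 / (z -
        1) - 1 / (z - t))"
      proof (rule nn_integral_FTC_open[where F = "\<lambda>s. 1 / (z - s)"])
        fix x assume x: "t < x" "x < 1"
        then show "((\<lambda>s. 1 / (z - s)) has_real_derivative 1 / (z - x)^2) (at x)"
          using z by (auto intro!: derivative_eq_intros simp: power2_eq_square)
        show "isCont (\<lambda>s. 1 / (z - s)^2) x" using x z by (intro continuous_intros) auto
        show "0 \<le> 1 / (z - x)^2" by simp
      next
        show "((\<lambda>s. 1 / (z - s)) \<longlongrightarrow> 1 / (z - t)) (at_right t)"
          using z t by (intro tendsto_intros) auto
        show "((\<lambda>s. 1 / (z - s)) \<longlongrightarrow> 1 / (z - 1)) (at_left 1)"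
          using z by (intro tendsto_intros) auto
      qed (use t in auto)
      moreover have "?I (\<lambda>s. 1 / (z - s)^2 * iint z [] s)
          = word_sign [] * enn2real (\<integral>\<^sup>+s. ennreal (1 / (z - s)^2) * abs_iint z [] s * indicator {t<..<1} s \<partial>lborel)"
        using z t by (intro ennreal_integral_iint) (auto simp: conv1_def)
      moreover have "0 \<le> 1 / (z - 1) - 1 / (z - t)" using z t by (simp add: frac_le)
      ultimately have "?I (\<lambda>s. 1 / (z - s)^2) = 1 / (z - 1) - 1 / (z - t)" by simp
      then show ?thesis using Nil 2 by (simp add: iint_deriv_singleton_EZ)
    qed
  next
    case (Cons b u)
    have bu: "last (b # u) \<noteq> E1" using aw Cons by simp
    show ?thesis
    proof (cases "a = E1 \<and> b = EZ \<and> u = []")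
      case True
      \<comment> \<open>For e_1 e_z the two terms of \<open>iint_deriv z [EZ] s\<close> must stay
        together: their difference has a factor 1 - s, which cancels the pole of e_1.\<close>
      have "?I (\<lambda>s. kernel z a s * iint_deriv z w s + (if a = EZ then iint z w s / (z - s)^2 else 0))
          = ?I (\<lambda>s. (1 / (z - 1)) * (kernel z EZ s * iint z [] s))"
      proof (intro set_lebesgue_integral_cong allI impI)
        fix s assume s: "s \<in> {t<..<1}"
        have "1 / (z - 1) - 1 / (z - s) = (1 - s) / ((z - 1) * (z - s))"
          using s z by (simp add: divide_simps)
        then have "kernel z E1 s * iint_deriv z [EZ] s = - 1 / (1 - s) * ((1 - s) / ((z - 1) *
          (z - s)))"
          by (simp only: iint_deriv_singleton_EZ kernel_simps)
        also have "\<dots> = (1 / (z - 1)) * kernel z EZ s" using s by simp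
        finally show "kernel z a s * iint_deriv z w s + (if a = EZ then iint z w s / (z -
          s)^2 else 0) = (1 / (z - 1)) * (kernel z EZ s * iint z [] s)"
          using True Cons by simp
      qed auto
      also have "\<dots> = (1 / (z - 1)) * ?I (\<lambda>s. kernel z EZ s * iint z [] s)"
        by (rule set_integral_mult_right)
      also have "?I (\<lambda>s. kernel z EZ s * iint z [] s) = iint z [EZ] t"
        using z t by (intro iint_Cons[symmetric]) (auto simp: conv1_def)
      finally show ?thesis
        using True Cons by (simp add: iint_deriv_def doubleton_eq_iff gen_times_frag_of)
    next
      case False
      have converges: "converges z (a # v) t" if "v \<in> keys (del_open \<alpha> w)" "\<alpha> \<noteq> EZ" for \<alpha> v
      proof -
        have "last (a # v) \<noteq> E1"
        proof (cases "u = []")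
          case True
          then have "v = [] \<and> b = EZ" using that bu Cons
            by (cases b) (auto simp: doubleton_eq_iff split: if_splits)
          then show ?thesis using False True by auto
        next
          case u: False
          then have "v \<noteq> [] \<and> last v \<noteq> E1"
            using that bu Cons by (intro keys_del_open_good[of \<alpha> w]) (auto simp: Suc_le_eq)
          then show ?thesis by simp
        qed
        then show ?thesis using z t unfolding converges_def by (auto simp: conv1_iff)
      qed
      define l where "l \<alpha> s = kernel z a s * lin (\<lambda>v. iint z v s) (del_open \<alpha> w)" for \<alpha> s
      define ex where "ex s = (if a = EZ then iint z (b # u) s / (z - s)^2 else 0)
        - (if b = EZ then kernel z a s * (iint z u s / (z - s)) else 0)" for s
      have l: "?int (l \<alpha>)" "?I (l \<alpha>) = lin (\<lambda>v. iint z v t) (gen a * del_open \<alpha> w)" if "\<alpha> \<noteq> EZ" for \<alpha>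
        using set_integral_kernel_lin[of "del_open \<alpha> w" z a t] converges that unfolding l_def by auto
      have ex: "?int ex" "?I ex = adj_terms z a b u t"
        using set_integral_adj_terms[OF z t bu False] unfolding ex_def by auto
      have i: "?int (\<lambda>s. (1 / z) * l E0 s)" "?int (\<lambda>s. (1 / (z - 1)) * l E1 s)"
        using l by (auto intro: set_integrable_mult_right)
      have "?I (\<lambda>s. kernel z a s * iint_deriv z w s + (if a = EZ then iint z w s / (z - s)^2 else 0))
          = ?I (\<lambda>s. ((1 / z) * l E0 s + (1 / (z - 1)) * l E1 s) + ex s)"
        unfolding iint_deriv_def l_def ex_def Cons
        by (intro set_lebesgue_integral_cong allI impI) (cases "b = EZ"; simp add: algebra_simps)+
      also have "\<dots> = ((1 / z) * ?I (l E0) + (1 / (z - 1)) * ?I (l E1)) + ?I ex"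
        using i ex by (simp add: set_integral_add)
      also have "\<dots> = iint_deriv z (a # w) t"
        unfolding Cons iint_deriv_Cons_Cons using l ex Cons by simp
      finally show ?thesis .
    qed
  qed
qed

lemma iint_has_derivative:
  assumes "w = [] \<or> last w \<noteq> E1" "1 < z" "0 \<le> t" "t < 1" "0 < t \<or> w = [] \<or> hd w \<noteq> E0"
  shows "((\<lambda>y. iint y w t) has_real_derivative iint_deriv z w t) (at z)"
  using assms
proof (induction w arbitrary: z t)
  case (Cons a w)
  have "((\<lambda>y. iint y (a # w) t) has_real_derivative
    (LINT s:{t<..<1}|lborel. kernel z a s * iint_deriv z w s + (if a = EZ then iint z w s / (z - s)^2 else 0))) (at z)"
  proof (intro iint_Cons_has_derivative)
    fix y s :: real assume "1 < y" "0 < s" "s < 1"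
    then show "((\<lambda>y. iint y w s) has_real_derivative iint_deriv y w s) (at y)"
      using Cons.prems(1) by (intro Cons.IH) (auto split: if_splits)
  qed (use Cons.prems in auto)
  then show ?case using Cons.prems by (subst (asm) set_integral_iint_deriv) auto
qed simp

section \<open>Standard relations\<close>

definition Lz :: "real \<Rightarrow> Az \<Rightarrow> real" where
  "Lz z x = lin (\<lambda>w. iint z w 0) x"

lemma converges_words_z0: "1 < z \<Longrightarrow> w \<in> words_z0 \<Longrightarrow> converges z w 0"
  by (auto simp: converges_def conv1_iff words_z0_iff)

text \<open>At t = 0 the coefficient 1 / (z - t) becomes 1 / z, and the boundary term supplies the
  part of \<open>del_word EZ E0 w\<close> that comes from the letter a_0 = 0.\<close>

lemma iint_deriv_0_eq:
  assumes "w \<in> words_z0"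
  shows "iint_deriv z w 0 = Lz z (del_word EZ E0 w) / z + Lz z (del_word EZ E1 w) / (z - 1)"
proof -
  have "{E0, hd w} = {EZ, E0} \<longleftrightarrow> hd w = EZ" "{E0, hd w} \<noteq> {EZ, E1}"
    by (auto simp: doubleton_eq_iff)
  then show ?thesis
    by (simp add: iint_deriv_def Lz_def del_word_eq_del_open lin_diff diff_divide_distrib)
qed

lemma Lz_has_derivative:
  assumes z: "1 < z" and x: "x \<in> Az0"
  shows "((\<lambda>y. Lz y x) has_real_derivative Lz z (del_op EZ E0 x) / z +
    Lz z (del_op EZ E1 x) / (z - 1)) (at z)"
proof -
  have w: "w \<in> words_z0" if "w \<in> keys x" for w
    using x that by (auto simp: Az0_def span_basis_def)
  have "((\<lambda>y. Lz y x) has_real_derivative (\<Sum>w\<in>keys x. of_int (Poly_Mapping.lookup x w) *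
    iint_deriv z w 0)) (at z)"
    unfolding Lz_def lin_def
  proof (intro DERIV_sum DERIV_cmult iint_has_derivative)
    fix w assume "w \<in> keys x"
    then show "w = [] \<or> last w \<noteq> E1" "0 < (0::real) \<or> w = [] \<or> hd w \<noteq> E0"
      using w by (auto simp: words_z0_iff)
  qed (use z in auto)
  also have "(\<Sum>w\<in>keys x. of_int (Poly_Mapping.lookup x w) * iint_deriv z w 0) =
    lin (\<lambda>w. iint_deriv z w 0) x"
    by (simp add: lin_def)
  also have "\<dots> = lin (\<lambda>w. (1 / z) * Lz z (del_word EZ E0 w) + (1 / (z - 1)) *
    Lz z (del_word EZ E1 w)) x"
    using w by (intro lin_cong) (simp add: iint_deriv_0_eq)
  also have "\<dots> = Lz z (del_op EZ E0 x) / z + Lz z (del_op EZ E1 x) / (z - 1)"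
    unfolding lin_plus lin_mult_left by (simp add: Lz_def del_op_def lin_frag_extend)
  finally show ?thesis .
qed

lemma length_keys_del_open: "v \<in> keys (del_open \<alpha> w) \<Longrightarrow> Suc (length v) = length w"
proof (induction \<alpha> w arbitrary: v rule: del_open.induct)
  case (3 \<alpha> a b w)
  let ?x = "if {a, b} = {EZ, \<alpha>} then frag_of (b # w) - frag_of (a # w) else 0"
  have "v \<in> keys (gen a * del_open \<alpha> (b # w)) \<union> keys ?x"
    using 3(2) keys_add[of "gen a * del_open \<alpha> (b # w)" ?x] by (simp only: del_open.simps) blast
  then show ?case
  proof
    assume "v \<in> keys (gen a * del_open \<alpha> (b # w))"
    then obtain u where u: "v = a # u" "u \<in> keys (del_open \<alpha> (b # w))"
      using keys_gen_times[of a "del_open \<alpha> (b # w)"] by blast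
    then show ?thesis using 3(1)[of u] by simp
  next
    assume "v \<in> keys ?x"
    then have "v = b # w \<or> v = a # w"
      using keys_diff[of "frag_of (b # w)" "frag_of (a # w)"] by (auto split: if_splits)
    then show ?thesis by auto
  qed
qed (auto split: if_splits)

lemma keys_del_word_subset:
  "keys (del_word EZ \<alpha> w) \<subseteq> keys (del_open \<alpha> w) \<union> (if w = [] then {} else {tl w})"
  using keys_diff[of "del_open \<alpha> w" "frag_of (tl w)"]
    by (auto simp: del_word_eq_del_open split: if_splits)

lemma length_keys_del_word:
  "v \<in> keys (del_word EZ \<alpha> w) \<Longrightarrow> length v < length w"
  using keys_del_word_subset[of \<alpha> w] length_keys_del_open[of v \<alpha> w] by (cases w) (auto split: if_splits)

text \<open>At the end of the word this is \<open>keys_del_open_good\<close>. At the front the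
  critical words begin with e_z e_0: deleting e_z on account of e_0 and deleting it on account of
  a_0 = 0 give the same word with opposite signs.\<close>

lemma del_word_Az0:
  assumes w: "w \<in> words_z0" and \<alpha>: "\<alpha> \<noteq> EZ"
  shows "del_word EZ \<alpha> w \<in> Az0"
proof (cases "length w \<ge> 2")
  case False
  then have "v = []" if "v \<in> keys (del_word EZ \<alpha> w)" for v
    using length_keys_del_word[OF that] by (cases v) auto
  then show ?thesis by (auto simp: Az0_def span_basis_def words_z0_iff)
next
  case True
  then obtain a b u where abu: "w = a # b # u"
    by (auto simp: numeral_2_eq_2 Suc_le_length_iff)
  have a: "a \<noteq> E0" and last: "last w \<noteq> E1" using w abu by (auto simp: words_z0_iff)
  have good: "v \<noteq> [] \<and> last v \<noteq> E1" if "v \<in> keys (del_word EZ \<alpha> w)" for v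
    using keys_del_word_subset[of \<alpha> w] keys_del_open_good[OF \<alpha> True last, of v] last that abu by auto
  have hd: "hd v \<noteq> E0" if "v \<in> keys (del_word EZ \<alpha> w)" for v
  proof (cases "b = E0")
    case False
    have "v \<in> keys (del_open \<alpha> w) \<union> {b # u}"
      using keys_del_word_subset[of \<alpha> w] that abu by (auto simp del: del_open.simps)
    moreover have "keys (del_open \<alpha> w) \<subseteq> (Cons a) ` UNIV \<union> {b # u}"
    proof -
      let ?x = "if {a, b} = {EZ, \<alpha>} then frag_of (b # u) - frag_of (a # u) else 0"
      have "keys ?x \<subseteq> {b # u, a # u}"
        using keys_diff[of "frag_of (b # u)" "frag_of (a # u)"] by auto
      then show ?thesis
        using keys_add[of "gen a * del_open \<alpha> (b # u)" ?x] keys_gen_times[of a "del_open \<alpha> (b # u)"]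
        unfolding abu del_open.simps by blast
    qed
    ultimately show ?thesis using a False by auto
  next
    case True
    have "{a, b} = {EZ, \<alpha>} \<longleftrightarrow> {E0, a} = {EZ, \<alpha>}" using True by (simp add: insert_commute)
    then have "del_word EZ \<alpha> w = gen a * del_open \<alpha> (b # u) - (if {a, b} = {EZ,
      \<alpha>} then frag_of (a # u) else 0)"
      by (simp add: del_word_eq_del_open abu)
    then have "v \<in> keys (gen a * del_open \<alpha> (b # u)) \<union> {a # u}"
      using that keys_diff[of "gen a * del_open \<alpha> (b # u)" "frag_of (a # u)"] by (auto split: if_splits)
    then show ?thesis using keys_gen_times[of a "del_open \<alpha> (b # u)"] a by auto
  qed
  show ?thesis using good hd by (auto simp: Az0_def span_basis_def words_z0_iff)
qed

lemma del_op_I_ST: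
  assumes x: "x \<in> I_ST" and \<alpha>: "\<alpha> \<in> {E0, E1}"
  shows "del_op EZ \<alpha> x \<in> I_ST"
proof -
  have "del_op EZ \<alpha> x \<in> Az0"
    unfolding del_op_def Az0_def
    using x \<alpha> by (intro span_basis_frag_extend[where V = words_z0])
      (auto simp: I_ST_def Az0_def intro!: del_word_Az0[unfolded Az0_def])
  moreover have "Const_map (foldr (del_op EZ) \<alpha>s (del_op EZ \<alpha> x)) = 0" if "set \<alpha>s \<subseteq> {E0, E1}" for \<alpha>s
  proof -
    \<comment> \<open>\<open>foldr\<close> applies the last entry of the list first.\<close>
    have "set (\<alpha>s @ [\<alpha>]) \<subseteq> {E0, E1}" using that \<alpha> by auto
    then have "Const_map (foldr (del_op EZ) (\<alpha>s @ [\<alpha>]) x) = 0"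
      using x unfolding I_ST_def by blast
    then show ?thesis by simp
  qed
  ultimately show ?thesis by (simp add: I_ST_def)
qed

lemma iint_no_EZ: "EZ \<notin> set w \<Longrightarrow> iint z w t = iint y w t"
proof -
  assume "EZ \<notin> set w"
  then have "map (\<lambda>a s. ennreal (abs_ker z a s)) w = map (\<lambda>a s. ennreal (abs_ker y a s)) w"
    by (intro map_cong refl ext) (metis abs_ker_simps(1,2) letter.exhaust)
  then show ?thesis by (simp only: iint_def abs_iint_def)
qed

text \<open>The 2 is an arbitrary parameter: \<open>Const_map x\<close> contains no e_z, so its
  integrals do not depend on it.\<close>

lemma Lz_tendsto_at_top:
  assumes "x \<in> Az0"
  shows "((\<lambda>z. Lz z x) \<longlongrightarrow> Lz 2 (Const_map x)) at_top"
proof -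
  have "((\<lambda>z. iint z w 0) \<longlongrightarrow> (if EZ \<in> set w then 0 else iint 2 w 0)) at_top" if "w \<in> keys x" for w
  proof (cases "EZ \<in> set w")
    case True
    then show ?thesis using iint_0_tendsto_at_top[of w] that assms
      by (auto simp: Az0_def span_basis_def)
  next
    case False
    then have "(\<lambda>z. iint z w 0) = (\<lambda>z. iint 2 w 0)" by (intro ext iint_no_EZ)
    then show ?thesis using False by simp
  qed
  then have "((\<lambda>z. Lz z x) \<longlongrightarrow> lin (\<lambda>w. if EZ \<in> set w then 0 else iint 2 w 0) x) at_top"
    unfolding Lz_def lin_def by (intro tendsto_sum tendsto_mult tendsto_const)
  also have "lin (\<lambda>w. if EZ \<in> set w then 0 else iint 2 w 0) x = Lz 2 (Const_map x)"
    unfolding Lz_def Const_map_def lin_frag_extend by (intro lin_cong) auto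
  finally show ?thesis .
qed

lemma Lz_I_ST:
  assumes "x \<in> I_ST" "1 < z"
  shows "Lz z x = 0"
proof -
  have "\<forall>x\<in>I_ST. (\<forall>w\<in>keys x. length w < n) \<longrightarrow> (\<forall>z>1. Lz z x = 0)" for n
  proof (induction n)
    case 0
    have "x = 0" if "\<forall>w\<in>keys x. length w < 0" for x :: Az using that by auto
    then show ?case by (auto simp: Lz_def)
  next
    case (Suc n)
    show ?case
    proof (intro ballI impI allI)
      fix x and z :: real
      assume x: "x \<in> I_ST" and len: "\<forall>w\<in>keys x. length w < Suc n" and z: "1 < z"
      have Az0: "x \<in> Az0" using x by (simp add: I_ST_def)
      have del: "Lz y (del_op EZ \<alpha> x) = 0" if "\<alpha> \<in> {E0, E1}" "1 < y" for \<alpha> y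
      proof -
        have "length v < n" if v: "v \<in> keys (del_op EZ \<alpha> x)" for v
        proof -
          obtain w where "w \<in> keys x" "v \<in> keys (del_word EZ \<alpha> w)"
            using v keys_frag_extend[of "del_word EZ \<alpha>" x] unfolding del_op_def by blast
          then show ?thesis using length_keys_del_word[of v \<alpha> w] len by fastforce
        qed
        then show ?thesis using Suc del_op_I_ST[OF x that(1)] that(2) by blast
      qed
      have "\<exists>c. \<forall>y\<in>{1<..}. Lz y x = c"
      proof (rule has_field_derivative_zero_constant)
        fix y :: real assume y: "y \<in> {1<..}"
        then have "((\<lambda>y. Lz y x) has_real_derivative 0) (at y)"
          using Lz_has_derivative[of y x] Az0 del by simp
        then show "((\<lambda>y. Lz y x) has_real_derivative 0) (at y within {1<..})"
          by (rule has_field_derivative_at_within)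
      qed simp
      then obtain c where c: "\<And>y. 1 < y \<Longrightarrow> Lz y x = c" by auto
      have "Const_map x = 0" using x unfolding I_ST_def by (auto dest: spec[of _ "[]"])
      then have "((\<lambda>y. Lz y x) \<longlongrightarrow> 0) at_top"
        using Lz_tendsto_at_top[OF Az0] by (simp add: Lz_def)
      moreover have "((\<lambda>y. Lz y x) \<longlongrightarrow> c) at_top"
        by (rule tendsto_eventually, rule eventually_mono[OF eventually_gt_at_top[of 1]]) (rule c)
      ultimately have "c = 0" using tendsto_unique[OF trivial_limit_at_top_linorder] by blast
      then show "Lz z x = 0" using c z by simp
    qed
  qed
  moreover have "\<exists>n. \<forall>w\<in>keys x. length w < n"
    by (intro exI[of _ "Suc (Max (length ` keys x))"]) (auto simp: less_Suc_eq_le)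
  ultimately show ?thesis using assms by blast
qed

section \<open>Asymptotics at one\<close>

lemma lin_shuffle_map: "lin f (shuffle_map y) = lin (\<lambda>(u, v). lin f (shuffle_word u v)) y"
  by (simp add: shuffle_map_def lin_frag_extend shuffle_frag_of case_prod_unfold)

lemma Lz_shuffle_map:
  assumes z: "1 < z" and y: "y \<in> span_basis (words_z0 \<times> words_z0)"
  shows "Lz z (shuffle_map y) = lin (\<lambda>(u, v). iint z u 0 * iint z v 0) y"
  unfolding Lz_def lin_shuffle_map
  using y z by (intro lin_cong) (auto simp: span_basis_def intro!: iint_shuffle converges_words_z0)

text \<open>The shuffle relation makes each term a product of two integrals both before and after
  tau_z acts, and tau_z preserves the second factor.\<close>

lemma Lz_N_map:
  assumes z: "1 < z" and x: "x \<in> Az0"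
  shows "Lz z (N_map x) = Lz z x"
proof -
  define r where "r = reg_z1 x"
  let ?W = "words_zm2 \<times> (words_z0 \<inter> lists {E1, EZ})"
  have r: "r \<in> span_basis ?W" "shuffle_map r = x"
    using x Az0_subset_shuffle_image unfolding r_def reg_z1_def
    by (auto intro!: inv_into_into f_inv_into_f)
  have W: "(u, v) \<in> ?W" if "(u, v) \<in> keys r" for u v
    using r(1) that by (auto simp: span_basis_def)
  have "Lz z (N_map x) = lin (\<lambda>(u, v). Lz z (shuffle_word u v)) (tensor_map id tau_z r)"
    by (simp add: N_map_def r_def Lz_def lin_shuffle_map)
  also have "\<dots> = lin (\<lambda>(u, v). lin (\<lambda>v'. Lz z (shuffle_word u v')) (tau_z (frag_of v))) r"
    by (simp add: tensor_map_def tensor_def lin_frag_extend case_prod_unfold)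
  also have "\<dots> = lin (\<lambda>(u, v). iint z u 0 * iint z v 0) r"
  proof (intro lin_cong, clarify)
    fix u v assume "(u, v) \<in> keys r"
    then have u: "u \<in> words_zm2" and v: "v \<in> words_z0 \<inter> lists {E1, EZ}" using W by auto
    have "v' \<in> words_z0" if "v' \<in> keys (tau_z (frag_of v))" for v'
      using tau_z_span[OF v] that by (auto simp: span_basis_def)
    then have "lin (\<lambda>v'. Lz z (shuffle_word u v')) (tau_z (frag_of v))
        = lin (\<lambda>v'. iint z u 0 * iint z v' 0) (tau_z (frag_of v))"
      using u z words_zm2_subset unfolding Lz_def
      by (intro lin_cong iint_shuffle converges_words_z0) auto
    also have "\<dots> = iint z u 0 * iint z v 0"
      using iint_tau_z[OF z v] by (simp add: lin_mult_left)
    finally show "lin (\<lambda>v'. Lz z (shuffle_word u v')) (tau_z (frag_of v)) = iint z u 0 * iint z v 0" .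
  qed
  also have "\<dots> = Lz z (shuffle_map r)"
    using r(1) words_zm2_subset z
    by (intro Lz_shuffle_map[symmetric]) (auto simp: span_basis_def)
  finally show ?thesis using r by simp
qed

section \<open>The divergent logarithm and its powers\<close>

lemma iint_EZ:
  assumes "1 < z"
  shows "iint z [EZ] 0 = ln (z - 1) - ln z"
proof -
  have "(\<integral>\<^sup>+s. ennreal (1 / (z - s)) * indicator {0<..<1} s \<partial>lborel) = ennreal (- ln (z - 1) -
    (- ln (z - 0)))"
  proof (rule nn_integral_FTC_open[where F = "\<lambda>s. - ln (z - s)"])
    fix x :: real assume x: "0 < x" "x < 1"
    show "((\<lambda>s. - ln (z - s)) has_real_derivative 1 / (z - x)) (at x)"
      using x assms by (auto intro!: derivative_eq_intros)
    show "isCont (\<lambda>s. 1 / (z - s)) x" using x assms by (intro continuous_intros) auto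
    show "0 \<le> 1 / (z - x)" using x assms by simp
  next
    show "((\<lambda>s. - ln (z - s)) \<longlongrightarrow> - ln (z - 0)) (at_right 0)"
      using assms by (intro tendsto_intros) auto
    show "((\<lambda>s. - ln (z - s)) \<longlongrightarrow> - ln (z - 1)) (at_left 1)"
      using assms by (intro tendsto_intros) auto
  qed auto
  moreover have "ln (z - 1) \<le> ln z" using assms by simp
  ultimately show ?thesis by (simp add: iint_def abs_iint_Cons word_sign_Cons)
qed

text \<open>The shuffle of e_z with e_z^n is (n + 1) e_z^(n + 1).\<close>

lemma iint_EZ_power:
  assumes z: "1 < z"
  shows "iint z (replicate n EZ) 0 = iint z [EZ] 0 ^ n / fact n"
proof (induction n)
  case (Suc n)
  have c: "converges z (replicate m EZ) 0" for m
    using z by (intro converges_words_z0) (auto simp: words_z0_iff)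
  have "iint z [EZ] 0 * iint z (replicate n EZ) 0 =
    lin (\<lambda>x. iint z x 0) (shuffle_word [EZ] (replicate n EZ))"
    using c[of n] c[of 1] by (simp add: iint_shuffle)
  also have "\<dots> = real (Suc n) * iint z (replicate (Suc n) EZ) 0"
    unfolding shuffle_word_eq_sum_list lin_sum_list shuffle_list_replicate
    by (simp only: lin_frag_of map_replicate sum_list_replicate)
  finally have "iint z (replicate (Suc n) EZ) 0 = iint z [EZ] 0 *
    iint z (replicate n EZ) 0 / real (Suc n)"
    by (simp del: replicate_Suc of_nat_Suc)
  then show ?case using Suc by (simp add: mult.commute del: replicate_Suc)
qed simp

text \<open>With u = ln z - ln (z - 1) one has z - 1 = z exp(-u), so the product is z^(1/4) u^k
  exp(-u/4), where u tends to infinity.\<close>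

lemma rate_times_log_power:
  "((\<lambda>z. (z - 1) powr (1/4) * \<bar>iint z [EZ] 0\<bar> ^ k) \<longlongrightarrow> 0) (at_right 1)"
  and iint_EZ_at_infinity: "filterlim (\<lambda>z. iint z [EZ] 0) at_infinity (at_right 1)"
proof -
  define u where "u z = ln z - ln (z - 1)" for z :: real
  have iint: "\<forall>\<^sub>F z in at_right 1. iint z [EZ] 0 = - u z \<and> \<bar>iint z [EZ] 0\<bar> = u z \<and> 1 < z"
    using eventually_at_right_less[of "1::real"] by eventually_elim (auto simp: iint_EZ u_def)
  have u: "filterlim u at_top (at_right 1)"
  proof -
    have "filterlim (\<lambda>z::real. z - 1) (at_right 0) (at_right 1)"
      by (intro tendsto_imp_filterlim_at_right tendsto_eq_intros) (auto simp: eventually_at_right_less)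
    then have "filterlim (\<lambda>z::real. ln (z - 1)) at_bot (at_right 1)"
      by (rule filterlim_compose[OF ln_at_0])
    then have "filterlim (\<lambda>z::real. - ln (z - 1)) at_top (at_right 1)"
      by (simp add: filterlim_uminus_at_bot)
    moreover have "((\<lambda>z::real. ln z) \<longlongrightarrow> ln 1) (at_right 1)" by (intro tendsto_intros) auto
    ultimately have "filterlim (\<lambda>z::real. ln z + - ln (z - 1)) at_top (at_right 1)"
      by (intro filterlim_tendsto_add_at_top)
    then show ?thesis by (simp add: u_def[abs_def])
  qed
  have "filterlim (\<lambda>z. - u z) at_bot (at_right 1)"
    using u by (simp add: filterlim_uminus_at_bot)
  then have "filterlim (\<lambda>z. - u z) at_infinity (at_right 1)"
    by (rule filterlim_at_bot_imp_at_infinity)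
  then show "filterlim (\<lambda>z. iint z [EZ] 0) at_infinity (at_right 1)"
    by (rule filterlim_cong[THEN iffD1, rotated -1]) (auto intro: eventually_mono[OF iint])
  have "filterlim (\<lambda>z. 1/4 * u z) at_top (at_right 1)"
    by (intro filterlim_tendsto_pos_mult_at_top[OF tendsto_const _ u]) auto
  then have "((\<lambda>z. (1/4 * u z) ^ k / exp (1/4 * u z)) \<longlongrightarrow> 0) (at_right 1)"
    by (rule filterlim_compose[OF tendsto_power_div_exp_0])
  moreover have "((\<lambda>z::real. exp (ln z / 4)) \<longlongrightarrow> exp (ln 1 / 4)) (at_right 1)"
    by (intro tendsto_intros) auto
  ultimately have "((\<lambda>z. exp (ln z / 4) * (4 ^ k * ((1/4 * u z) ^ k / exp (1/4 *
    u z)))) \<longlongrightarrow> exp (ln 1 / 4) * (4 ^ k * 0)) (at_right 1)"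
    by (intro tendsto_mult tendsto_const)
  then have lim: "((\<lambda>z. exp (ln z / 4) * (4 ^ k * ((1/4 * u z) ^ k / exp (1/4 *
    u z)))) \<longlongrightarrow> 0) (at_right 1)"
    by simp
  show "((\<lambda>z. (z - 1) powr (1/4) * \<bar>iint z [EZ] 0\<bar> ^ k) \<longlongrightarrow> 0) (at_right 1)"
  proof (rule Lim_transform_eventually[OF lim])
    show "\<forall>\<^sub>F z in at_right 1. exp (ln z / 4) * (4 ^ k * ((1/4 * u z) ^ k / exp (1/4 * u z)))
        = (z - 1) powr (1/4) * \<bar>iint z [EZ] 0\<bar> ^ k"
      using iint
    proof eventually_elim
      case (elim z)
      have "(z - 1) powr (1/4) = exp (ln z / 4 - 1/4 * u z)"
        using elim by (simp add: powr_def u_def algebra_simps)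
      also have "\<dots> = exp (ln z / 4) / exp (1/4 * u z)" by (rule exp_diff)
      finally have p: "(z - 1) powr (1/4) = exp (ln z / 4) / exp (1/4 * u z)" .
      have q: "4 ^ k * (1/4 * u z) ^ k = u z ^ k"
        by (simp add: power_mult_distrib[symmetric])
      have "\<bar>iint z [EZ] 0\<bar> = u z" using elim by blast
      then show ?case unfolding p q[symmetric] by (simp only: q[symmetric]) simp
    qed
  qed
qed

text \<open>A nonconstant polynomial tends to infinity with its argument; a constant one equals its
  limit.\<close>

lemma poly_tendsto_0_imp_coeff_0:
  fixes p :: "real poly"
  assumes "filterlim f at_infinity F" "((\<lambda>x. poly p (f x)) \<longlongrightarrow> 0) F" "F \<noteq> bot"
  shows "coeff p 0 = 0"
proof (cases "degree p = 0")
  case True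
  then obtain c where "p = [:c:]" by (metis degree_eq_zeroE)
  then show ?thesis using assms(2,3) by (simp add: tendsto_const_iff)
next
  case False
  then have "filterlim (poly p) at_infinity at_infinity"
    by (intro filterlim_poly_at_infinity) auto
  then have "filterlim (\<lambda>x. poly p (f x)) at_infinity F"
    using assms(1) by (rule filterlim_compose)
  then show ?thesis using assms not_tendsto_and_filterlim_at_infinity by blast
qed

text \<open>At z = 1 the kernels of e_z and e_1 are the same function, so evaluation at z = 1
  performs the replacement of e_z by e_1.\<close>

lemma iint_1_eq_L_word: "iint 1 w 0 = L_word (map (\<lambda>a. if a = EZ then E1 else a) w)"
proof -
  let ?\<rho> = "\<lambda>a. if a = EZ then E1 else a"
  have "map (\<lambda>a s. ennreal (abs_ker 1 a s)) (map ?\<rho> w) = map (\<lambda>a s. ennreal (abs_ker 1 a s)) w"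
    by auto
  moreover have "word_sign (map ?\<rho> w) = word_sign w"
    by (induction w) (auto simp: word_sign_Cons)
  moreover have "map ?\<rho> w \<in> lists {E0, E1}"
    by (auto) (metis letter.exhaust)
  ultimately show ?thesis using L_word_eq_iint[of "map ?\<rho> w" 1] by (simp only: iint_def abs_iint_def)
qed

lemma L_map_lambda': "L_map (lambda' x) = lin (\<lambda>w. iint 1 w 0) x"
proof -
  have "prod_list (map (\<lambda>a. if a = EZ then gen E1 else gen a) w) = frag_of (map (\<lambda>a. if a =
    EZ then E1 else a) w)" for w
    by (induction w) (auto simp: gen_times_frag_of frag_of_Nil)
  then have "lin L_word (lambda' x) = lin (\<lambda>w. iint 1 w 0) x"
    by (simp add: lambda'_def lin_frag_extend iint_1_eq_L_word)
  then show ?thesis by (simp add: L_map_def lin_def)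
qed

theorem theorem20:
  fixes w :: Az
  assumes "w \<in> I_ST"
  shows "L_map (lambda_map w) = 0"
proof -
  have w0: "w \<in> Az0" using assms by (simp add: I_ST_def)
  define y where "y = reg_z (N_map w)"
  let ?W = "words_zm2 \<times> lists {EZ}"
  have "N_map w \<in> span_basis words_zm1"
    unfolding N_map_def reg_z1_def using w0 Az0_subset_shuffle_image
    by (intro N_map_mem inv_into_into) auto
  then have y: "y \<in> span_basis ?W" "shuffle_map y = N_map w"
    using span_words_zm1_subset_shuffle_image unfolding y_def reg_z_def
    by (auto intro!: inv_into_into f_inv_into_f)
  have W: "u \<in> words_zm2" "v = replicate (length v) EZ" if "(u, v) \<in> keys y" for u v
  proof -
    have "u \<in> words_zm2" "\<forall>a\<in>set v. a = EZ" using y(1) that by (auto simp: span_basis_def)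
    then show "u \<in> words_zm2" "v = replicate (length v) EZ"
      by (simp_all add: replicate_length_same)
  qed
  define l where "l z = iint z [EZ] 0" for z
  define c :: "word \<times> word \<Rightarrow> real" where
    "c uv = of_int (Poly_Mapping.lookup y uv) / fact (length (snd uv))" for uv
  define P where "P = (\<Sum>uv\<in>keys y. monom (c uv * iint 1 (fst uv) 0) (length (snd uv)))"
  have zero: "(\<Sum>uv\<in>keys y. c uv * iint z (fst uv) 0 * l z ^ length (snd uv)) = 0" if z: "1 < z" for z
  proof -
    have "v \<in> words_z0" if "v \<in> lists {EZ}" for v
      using that by (cases "v =
        []") (auto simp: words_z0_iff dest: bspec[OF _ hd_in_set] bspec[OF _ last_in_set])
    then have "y \<in> span_basis (words_z0 \<times> words_z0)"
      using y(1) words_zm2_subset by (auto simp: span_basis_def)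
    then have "lin (\<lambda>(u, v). iint z u 0 * iint z v 0) y = Lz z (N_map w)"
      unfolding y(2)[symmetric] by (rule Lz_shuffle_map[OF z, symmetric])
    also have "\<dots> = 0" using Lz_N_map[OF z w0] Lz_I_ST[OF assms z] by simp
    finally have "lin (\<lambda>(u, v). iint z u 0 * iint z v 0) y = 0" .
    moreover have "lin (\<lambda>(u, v). iint z u 0 * iint z v 0) y
        = (\<Sum>uv\<in>keys y. c uv * iint z (fst uv) 0 * l z ^ length (snd uv))"
      unfolding lin_def
    proof (intro sum.cong refl, clarify)
      fix u v assume "(u, v) \<in> keys y"
      then have "iint z v 0 = l z ^ length v / fact (length v)"
        using W(2) iint_EZ_power[OF z] unfolding l_def by metis
      then show "real_of_int (Poly_Mapping.lookup y (u, v)) * (iint z u 0 * iint z v 0)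
          = c (u, v) * iint z (fst (u, v)) 0 * l z ^ length (snd (u, v))"
        by (simp add: c_def)
    qed
    ultimately show ?thesis by simp
  qed
  \<comment> \<open>By \<open>zero\<close>, the sum with integrals at z in place of those at 1 may
    be subtracted from \<open>poly P (l z)\<close>. What remains are differences of integrals times
    powers of the logarithm.\<close>
  have "((\<lambda>z. poly P (l z)) \<longlongrightarrow> 0) (at_right 1)"
  proof (rule Lim_transform_eventually)
    show "((\<lambda>z. \<Sum>uv\<in>keys y. c uv * ((iint 1 (fst uv) 0 - iint z (fst uv) 0) *
      l z ^ length (snd uv))) \<longlongrightarrow> 0) (at_right 1)"
    proof (intro tendsto_null_sum tendsto_mult_right_zero)
      fix uv assume "uv \<in> keys y"
      then obtain C where C: "\<And>z. 1 < z \<Longrightarrow> \<bar>iint z (fst uv) 0 - iint 1 (fst uv) 0\<bar> \<le> C * (z -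
        1) powr (1/4)"
        using iint_0_tendsto_1_rate[of "fst uv"] W(1)[of "fst uv" "snd uv"] by auto
      show "((\<lambda>z. (iint 1 (fst uv) 0 - iint z (fst uv) 0) * l z ^ length (snd uv)) \<longlongrightarrow> 0) (at_right 1)"
      proof (rule Lim_null_comparison)
        show "((\<lambda>z. C * ((z - 1) powr (1/4) * \<bar>l z\<bar> ^ length (snd uv))) \<longlongrightarrow> 0) (at_right 1)"
          unfolding l_def by (intro tendsto_mult_right_zero rate_times_log_power)
        show "\<forall>\<^sub>F z in at_right 1. norm ((iint 1 (fst uv) 0 - iint z (fst uv) 0) *
          l z ^ length (snd uv))
            \<le> C * ((z - 1) powr (1/4) * \<bar>l z\<bar> ^ length (snd uv))"
          using eventually_at_right_less[of "1::real"]
        proof eventually_elim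
          case (elim z)
          then show ?case
            using mult_right_mono[OF C[OF elim], of "\<bar>l z\<bar> ^ length (snd uv)"]
            by (simp add: abs_mult power_abs abs_minus_commute mult.assoc)
        qed
      qed
    qed
    show "\<forall>\<^sub>F z in at_right 1. (\<Sum>uv\<in>keys y. c uv * ((iint 1 (fst uv) 0 - iint z (fst uv) 0) *
      l z ^ length (snd uv)))
        = poly P (l z)"
      using eventually_at_right_less[of "1::real"]
    proof eventually_elim
      case (elim z)
      have "poly P (l z) = (\<Sum>uv\<in>keys y. c uv * iint 1 (fst uv) 0 * l z ^ length (snd uv))"
        by (simp add: P_def poly_sum poly_monom)
      then show ?case
        using zero[OF elim] by (simp add: algebra_simps sum_subtractf)
    qed
  qed
  then have "coeff P 0 = 0"
    using iint_EZ_at_infinity unfolding l_def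
    by (intro poly_tendsto_0_imp_coeff_0[of "\<lambda>z. iint z [EZ] 0" "at_right 1"]) auto
  \<comment> \<open>The constant coefficient collects the pairs with empty second word, which are
    those that \<open>id_tensor_const\<close> keeps.\<close>
  moreover have "coeff P 0 = lin (\<lambda>(u, v). (if v = [] then 1 else 0) * iint 1 u 0) y"
    unfolding P_def lin_def coeff_sum
    by (intro sum.cong refl) (auto simp: c_def)
  moreover have "L_map (lambda_map w) = lin (\<lambda>(u, v). (if v = [] then 1 else 0) * iint 1 u 0) y"
    unfolding lambda_map_def L_map_lambda' id_tensor_const_def lin_frag_extend y_def[symmetric]
    by (intro lin_cong) (auto simp: lin_cmul const_term_def)
  ultimately show ?thesis by simp
qed

end
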